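(* In the differential setting described in the context, assume that $\mathfrak{a}$ satisfies Condition (L) or Condition (B). Let $X,Y,Z,Q$ be as in the context, and set $W:=Q(I+iQZQ)^{-1}Q$ and $P:=I-Q$ (pointwise). Then for all $u,v\in D(\mathfrak{a})$, \[ \begin{aligned} \mathfrak{a}_{\mathrm{reg}}(u,v)&=\big\langle (I+iZ+ZWZ)PA^{1/2}\nabla u,\;PA^{1/2}\nabla v\big\rangle\\ &\quad+\big\langle X^*(I-iWZ)PA^{1/2}\nabla u,\;v\big\rangle+\big\langle u,\;Y^*(I+iW^*Z)PA^{1/2}\nabla v\big\rangle\\ &\quad-\big\langle (X^*WY)u,\;v\big\rangle+\langle c_0u,v\rangle . \end{aligned} \] In particular $\mathfrak{a}_{\mathrm{reg}}$ is again a differential sectorial form.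
   Context: Notation: $\langle f,g\rangle=\int_\Omega f\overline g$ on $L^2(\Omega)$ and $\langle w_1,w_2\rangle=\int_\Omega\sum_k w_{1,k}\overline{w_{2,k}}$ on $(L^2(\Omega))^d$; for $\zeta,\eta\in\mathbb{C}^d$, $\zeta\cdot\eta=\sum_k\zeta_k\overline{\eta_k}$; for a $\mathbb{C}^d$-valued function $X$, $X^*\zeta:=\sum_k\overline{X_k}\zeta_k$ (pointwise); $\Sigma_\theta=\{z\in\mathbb{C}: z=0\text{ or }|\arg z|\le\theta\}$. Forms: a sesquilinear form $\mathfrak{b}$ with domain $D(\mathfrak{b})$ in a Hilbert space $H$ is sectorial with vertex $\gamma\in\mathbb{R}$ if $\mathfrak{b}(u,u)-\gamma\|u\|_H^2\in\Sigma_\theta$ for all $u$ and some $\theta\in[0,\pi/2)$. $(\Re\mathfrak b)(u,v)=\frac12(\mathfrak b(u,v)+\overline{\mathfrak b(v,u)})$, $(\Im\mathfrak b)(u,v)=\frac1{2i}(\mathfrak b(u,v)-\overline{\mathfrak b(v,u)})$. For sectorial $\mathfrak b$ with vertex $\gamma$, $\|u\|_{\mathfrak b}^2=\Re\mathfrak b(u,u)+(1-\gamma)\|u\|_H^2$; $\mathfrak b$ is closed if $(D(\mathfrak b),\|\cdot\|_{\mathfrak b})$ is complete, and closable if it has a closed sectorial extension. For a densely defined sectorial form $\mathfrak b$, the associated operator $B$ is defined by: $x\in D(B)$ and $Bx=f$ iff there is a sequence $(u_n)$ in $D(\mathfrak b)$ with $u_n\to x$ in $H$, $\sup_n\Re\mathfrak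 b(u_n,u_n)<\infty$ and $\mathfrak b(u_n,v)\to\langle f,v\rangle_H$ for all $v\in D(\mathfrak b)$; $B$ is m-sectorial. The regular part $\mathfrak b_{\mathrm{reg}}$ of $\mathfrak b$ is the unique closable sectorial form with $D(\mathfrak b_{\mathrm{reg}})=D(\mathfrak b)$ whose associated operator is $B$; the singular part is $\mathfrak b_{\mathrm s}=\mathfrak b-\mathfrak b_{\mathrm{reg}}$. Differential setting: $\Omega\subset\mathbb{R}^d$ open, $H=L^2(\Omega)$. $D(\mathfrak{a})$ is a linear subspace of $L^2(\Omega)$ containing $C_c^\infty(\Omega)$ with $\partial_k u\in L^1_{\mathrm{loc}}(\Omega)$ for all $u\in D(\mathfrak a)$. The functions $c_{kl},b_k,d_k,c_0\colon\Omega\to\mathbb{C}$ are measurable, $c_0\in L^\infty(\Omega)$; $C=(c_{kl})$, $b=(b_k)$, $d=(d_k)$. Assume $C\nabla u\cdot\nabla u\in L^1(\Omega)$ for $u\in D(\mathfrak a)$ and $C(x)\xi\cdot\xi\in\Sigma_\theta$ for all $\xi\in\mathbb{C}^d$, $x\in\Omega$, for some $\theta\in[0,\pi/2)$. $A=\frac12(C+C^* )$, $A^{1/2}$ its pointwise positive semi-definite square root. Assume there is $K>0$ with $|\overline{b(x)}\cdot\xi|\le K\|A^{1/2}(x)\xi\|$ and $|d(x)\cdot\xi|\le K\|A^{1/2}(x)\xi\|$ for all $\xi,x$. $\mathfrak a(u,v)=\int_\Omega\sum_{k,l}c_{kl}\partial_ku\,\overline{\partial_lv}+\int_\Omega\sum_kb_k\partial_ku\,\overline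 v+\int_\Omega\sum_kd_ku\,\overline{\partial_kv}+\int_\Omega c_0u\overline v$ on $D(\mathfrak a)$ (a densely defined sectorial form). Let $X,Y\colon\Omega\to\mathbb{C}^d$ be bounded measurable with $A^{1/2}X=\overline b$, $A^{1/2}Y=d$ pointwise, and $Z\colon\Omega\to\mathbb{C}^{d\times d}$ bounded measurable with $Z(x)$ Hermitian and $A^{1/2}(x)(I+iZ(x))A^{1/2}(x)=C(x)$ for all $x$ (such maps exist). Condition (L): (i) $D(\mathfrak a)\cap L^\infty(\Omega)$ is invariant under multiplication by $C_c^\infty(\Omega)$ functions; (ii) there is $\psi\in C^1_b(\mathbb{R})$ with $\psi(0)=0$, $\psi'(0)=1$ and $\psi\circ(\Re u)+i\,\psi\circ(\Im u)\in D(\mathfrak a)$ for all $u\in D(\mathfrak a)$; (iii) $c_{kl}+\overline{c_{lk}}$ is real valued for all $k,l$. Condition (B): (i) $D(\mathfrak a)$ is invariant under multiplication by $C_c^\infty(\Omega)$ functions; (ii) $c_{kl}\in L^\infty_{\mathrm{loc}}(\Omega)$ for all $k,l$. Let $V$ be the closure in $L^2(\Omega)\times(L^2(\Omega))^d$ of $\{(u,A^{1/2}\nabla u):u\in D(\mathfrak a)\}$ and $V_{\mathrm s}=\{w\in(L^2(\Omega))^d:(0,w)\in V\}$, a closed subspace. It is known that under (L) or (B) there is a measurable $Q\colon\Omega\to\mathbb{C}^{d\times d}$ with each $Q(x)$ an orthogonal projection matrix such that $w\mapsto Qw$ (pointwise multiplication) is the orthogonal projection of $(L^2(\Omega))^d$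 onto $V_{\mathrm s}$; $Q$ denotes such a map. Note $QZQ$ is pointwise Hermitian, so $I+iQZQ$ is invertible.
   Formalization: The principal part of the form is taken as ∫ C∇u·∇v, i.e. Σ c_{lk} ∂_k u conj(∂_l v); the index order Σ c_{kl} ∂_k u conj(∂_l v) displayed in the setting is inconsistent with A^{1/2}(I+iZ)A^{1/2}=C and makes the formula false for non-symmetric C. *)

theory Defs
  imports "HOL-Analysis.Analysis"
begin

definition cdot :: "complex^'n \<Rightarrow> complex^'n \<Rightarrow> complex" where
  "cdot \<zeta> \<eta> = (\<Sum>k\<in>UNIV. \<zeta>$k * cnj (\<eta>$k))"

definition cstar :: "complex^'n \<Rightarrow> complex^'n \<Rightarrow> complex" where
  "cstar X \<zeta> = (\<Sum>k\<in>UNIV. cnj (X$k) * \<zeta>$k)"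

definition vconj :: "complex^'n \<Rightarrow> complex^'n" where
  "vconj \<zeta> = (\<chi> k. cnj (\<zeta>$k))"

definition cscale :: "complex \<Rightarrow> complex^'n^'m \<Rightarrow> complex^'n^'m" where
  "cscale c M = (\<chi> i j. c * M$i$j)"

definition adj :: "complex^'n^'m \<Rightarrow> complex^'m^'n" where
  "adj M = (\<chi> i j. cnj (M$j$i))"

definition hermitian :: "complex^'n^'n \<Rightarrow> bool" where
  "hermitian M \<longleftrightarrow> adj M = M"

definition psd :: "complex^'n^'n \<Rightarrow> bool" where
  "psd M \<longleftrightarrow> hermitian M \<and> (\<forall>\<xi>. 0 \<le> Re (cdot (M *v \<xi>) \<xi>))"

definition msqrt :: "complex^'n^'n \<Rightarrow> complex^'n^'n" where
  "msqrt M = (THE S. psd S \<and> S ** S = M)"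

definition herm_part :: "complex^'n^'n \<Rightarrow> complex^'n^'n" where
  "herm_part M = (\<chi> i j. (M$i$j + cnj (M$j$i)) / 2)"

definition sqrtA :: "('x \<Rightarrow> complex^'n^'n) \<Rightarrow> 'x \<Rightarrow> complex^'n^'n" where
  "sqrtA C x = msqrt (herm_part (C x))"

definition sector :: "real \<Rightarrow> complex set" where
  "sector \<theta> = {z. z = 0 \<or> \<bar>Arg z\<bar> \<le> \<theta>}"

definition L2 :: "(real^'n) set \<Rightarrow> (real^'n \<Rightarrow> complex) \<Rightarrow> bool" where
  "L2 \<Omega> f \<longleftrightarrow> f \<in> borel_measurable (lebesgue_on \<Omega>) \<and>
     integrable (lebesgue_on \<Omega>) (\<lambda>x. (cmod (f x))\<^sup>2)"

definition L2v :: "(real^'n) set \<Rightarrow> (real^'n \<Rightarrow> complex^'n) \<Rightarrow> bool" where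
  "L2v \<Omega> w \<longleftrightarrow> w \<in> borel_measurable (lebesgue_on \<Omega>) \<and>
     integrable (lebesgue_on \<Omega>) (\<lambda>x. (norm (w x))\<^sup>2)"

definition linner :: "(real^'n) set \<Rightarrow> (real^'n \<Rightarrow> complex) \<Rightarrow> (real^'n \<Rightarrow> complex) \<Rightarrow> complex" where
  "linner \<Omega> f g = (LINT x|lebesgue_on \<Omega>. f x * cnj (g x))"

definition vinner :: "(real^'n) set \<Rightarrow> (real^'n \<Rightarrow> complex^'n) \<Rightarrow> (real^'n \<Rightarrow> complex^'n) \<Rightarrow> complex" where
  "vinner \<Omega> w1 w2 = (LINT x|lebesgue_on \<Omega>. cdot (w1 x) (w2 x))"

definition l2norm :: "(real^'n) set \<Rightarrow> (real^'n \<Rightarrow> complex) \<Rightarrow> real" where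
  "l2norm \<Omega> f = sqrt (LINT x|lebesgue_on \<Omega>. (cmod (f x))\<^sup>2)"

definition l2vnorm :: "(real^'n) set \<Rightarrow> (real^'n \<Rightarrow> complex^'n) \<Rightarrow> real" where
  "l2vnorm \<Omega> w = sqrt (LINT x|lebesgue_on \<Omega>. (norm (w x))\<^sup>2)"

definition ess_bounded :: "(real^'n) set \<Rightarrow> (real^'n \<Rightarrow> complex) \<Rightarrow> bool" where
  "ess_bounded \<Omega> f \<longleftrightarrow> (\<exists>M. AE x in lebesgue_on \<Omega>. cmod (f x) \<le> M)"

definition L1loc :: "(real^'n) set \<Rightarrow> (real^'n \<Rightarrow> complex) \<Rightarrow> bool" where
  "L1loc \<Omega> f \<longleftrightarrow> f \<in> borel_measurable (lebesgue_on \<Omega>) \<and>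
     (\<forall>K. compact K \<and> K \<subseteq> \<Omega> \<longrightarrow> integrable (lebesgue_on K) f)"

definition Linfloc :: "(real^'n) set \<Rightarrow> (real^'n \<Rightarrow> complex) \<Rightarrow> bool" where
  "Linfloc \<Omega> f \<longleftrightarrow> f \<in> borel_measurable (lebesgue_on \<Omega>) \<and>
     (\<forall>K. compact K \<and> K \<subseteq> \<Omega> \<longrightarrow> ess_bounded K f)"

definition partial :: "'n \<Rightarrow> (real^'n \<Rightarrow> complex) \<Rightarrow> real^'n \<Rightarrow> complex" where
  "partial k f = (\<lambda>x. frechet_derivative f (at x) (axis k 1))"

primrec iter_partial :: "'n list \<Rightarrow> (real^'n \<Rightarrow> complex) \<Rightarrow> real^'n \<Rightarrow> complex" where
  "iter_partial [] f = f"
| "iter_partial (k # ks) f = partial k (iter_partial ks f)"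

definition smooth :: "(real^'n \<Rightarrow> complex) \<Rightarrow> bool" where
  "smooth f \<longleftrightarrow> (\<forall>ks x. iter_partial ks f differentiable (at x))"

definition tsupp :: "(real^'n \<Rightarrow> complex) \<Rightarrow> (real^'n) set" where
  "tsupp f = closure {x. f x \<noteq> 0}"

definition test_fn :: "(real^'n) set \<Rightarrow> (real^'n \<Rightarrow> complex) \<Rightarrow> bool" where
  "test_fn \<Omega> \<phi> \<longleftrightarrow> smooth \<phi> \<and> compact (tsupp \<phi>) \<and> tsupp \<phi> \<subseteq> \<Omega>"

definition weak_grad :: "(real^'n) set \<Rightarrow> (real^'n \<Rightarrow> complex) \<Rightarrow> (real^'n \<Rightarrow> complex^'n) \<Rightarrow> bool" where
  "weak_grad \<Omega> u G \<longleftrightarrow> (\<forall>k. L1loc \<Omega> (\<lambda>x. G x $ k) \<and>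
     (\<forall>\<phi>. test_fn \<Omega> \<phi> \<longrightarrow>
        (LINT x|lebesgue_on \<Omega>. u x * partial k \<phi> x) = - (LINT x|lebesgue_on \<Omega>. G x $ k * \<phi> x)))"

text \<open>Elements of H are represented by functions; a form must not distinguish functions
  that agree a.e. (null condition).\<close>
definition sesq_form :: "(real^'n) set \<Rightarrow> ((real^'n \<Rightarrow> complex) \<Rightarrow> (real^'n \<Rightarrow> complex) \<Rightarrow> complex)
    \<Rightarrow> (real^'n \<Rightarrow> complex) set \<Rightarrow> bool" where
  "sesq_form \<Omega> b Db \<longleftrightarrow>
     (\<forall>u\<in>Db. L2 \<Omega> u) \<and> (\<lambda>x. 0) \<in> Db \<and>
     (\<forall>u\<in>Db. \<forall>v\<in>Db. (\<lambda>x. u x + v x) \<in> Db) \<and>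
     (\<forall>u\<in>Db. \<forall>c. (\<lambda>x. c * u x) \<in> Db) \<and>
     (\<forall>u\<in>Db. \<forall>v\<in>Db. \<forall>w\<in>Db. \<forall>c.
        b (\<lambda>x. u x + v x) w = b u w + b v w \<and> b (\<lambda>x. c * u x) w = c * b u w \<and>
        b w (\<lambda>x. u x + v x) = b w u + b w v \<and> b w (\<lambda>x. c * u x) = cnj c * b w u) \<and>
     (\<forall>u\<in>Db. l2norm \<Omega> u = 0 \<longrightarrow> (\<forall>v\<in>Db. b u v = 0 \<and> b v u = 0))"

definition sectorial_vertex :: "(real^'n) set \<Rightarrow> ((real^'n \<Rightarrow> complex) \<Rightarrow> (real^'n \<Rightarrow> complex) \<Rightarrow> complex)
    \<Rightarrow> (real^'n \<Rightarrow> complex) set \<Rightarrow> real \<Rightarrow> bool" where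
  "sectorial_vertex \<Omega> b Db \<gamma> \<longleftrightarrow> sesq_form \<Omega> b Db \<and>
     (\<exists>\<theta>. 0 \<le> \<theta> \<and> \<theta> < pi/2 \<and>
        (\<forall>u\<in>Db. b u u - complex_of_real (\<gamma> * (l2norm \<Omega> u)\<^sup>2) \<in> sector \<theta>))"

definition sectorial :: "(real^'n) set \<Rightarrow> ((real^'n \<Rightarrow> complex) \<Rightarrow> (real^'n \<Rightarrow> complex) \<Rightarrow> complex)
    \<Rightarrow> (real^'n \<Rightarrow> complex) set \<Rightarrow> bool" where
  "sectorial \<Omega> b Db \<longleftrightarrow> (\<exists>\<gamma>. sectorial_vertex \<Omega> b Db \<gamma>)"

definition form_norm :: "(real^'n) set \<Rightarrow> ((real^'n \<Rightarrow> complex) \<Rightarrow> (real^'n \<Rightarrow> complex) \<Rightarrow> complex)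
    \<Rightarrow> real \<Rightarrow> (real^'n \<Rightarrow> complex) \<Rightarrow> real" where
  "form_norm \<Omega> b \<gamma> u = sqrt (Re (b u u) + (1 - \<gamma>) * (l2norm \<Omega> u)\<^sup>2)"

definition closed_form :: "(real^'n) set \<Rightarrow> ((real^'n \<Rightarrow> complex) \<Rightarrow> (real^'n \<Rightarrow> complex) \<Rightarrow> complex)
    \<Rightarrow> (real^'n \<Rightarrow> complex) set \<Rightarrow> bool" where
  "closed_form \<Omega> b Db \<longleftrightarrow> (\<exists>\<gamma>. sectorial_vertex \<Omega> b Db \<gamma> \<and>
     (\<forall>s. (\<forall>n. s n \<in> Db) \<and>
          (\<forall>e>0. \<exists>N. \<forall>m\<ge>N. \<forall>n\<ge>N. form_norm \<Omega> b \<gamma> (\<lambda>x. s m x - s n x) < e)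
        \<longrightarrow> (\<exists>u\<in>Db. (\<lambda>n. form_norm \<Omega> b \<gamma> (\<lambda>x. s n x - u x)) \<longlonglongrightarrow> 0)))"

definition closable :: "(real^'n) set \<Rightarrow> ((real^'n \<Rightarrow> complex) \<Rightarrow> (real^'n \<Rightarrow> complex) \<Rightarrow> complex)
    \<Rightarrow> (real^'n \<Rightarrow> complex) set \<Rightarrow> bool" where
  "closable \<Omega> b Db \<longleftrightarrow> (\<exists>b' Db'. Db \<subseteq> Db' \<and> (\<forall>u\<in>Db. \<forall>v\<in>Db. b' u v = b u v) \<and>
     closed_form \<Omega> b' Db')"

definition assoc_op :: "(real^'n) set \<Rightarrow> ((real^'n \<Rightarrow> complex) \<Rightarrow> (real^'n \<Rightarrow> complex) \<Rightarrow> complex)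
    \<Rightarrow> (real^'n \<Rightarrow> complex) set \<Rightarrow> ((real^'n \<Rightarrow> complex) \<times> (real^'n \<Rightarrow> complex)) set" where
  "assoc_op \<Omega> b Db = {(x, f). L2 \<Omega> x \<and> L2 \<Omega> f \<and>
     (\<exists>s. (\<forall>n. s n \<in> Db) \<and> (\<lambda>n. l2norm \<Omega> (\<lambda>y. s n y - x y)) \<longlonglongrightarrow> 0 \<and>
          (\<exists>M. \<forall>n. Re (b (s n) (s n)) \<le> M) \<and>
          (\<forall>v\<in>Db. (\<lambda>n. b (s n) v) \<longlonglongrightarrow> linner \<Omega> f v))}"

text \<open>Regular part: the unique closable sectorial form on the same domain with the same
  associated operator (normalised to 0 outside the domain).\<close>
definition reg_part :: "(real^'n) set \<Rightarrow> ((real^'n \<Rightarrow> complex) \<Rightarrow> (real^'n \<Rightarrow> complex) \<Rightarrow> complex)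
    \<Rightarrow> (real^'n \<Rightarrow> complex) set \<Rightarrow> ((real^'n \<Rightarrow> complex) \<Rightarrow> (real^'n \<Rightarrow> complex) \<Rightarrow> complex)" where
  "reg_part \<Omega> b Db = (THE r. sectorial \<Omega> r Db \<and> closable \<Omega> r Db \<and>
      assoc_op \<Omega> r Db = assoc_op \<Omega> b Db \<and> (\<forall>u v. \<not> (u \<in> Db \<and> v \<in> Db) \<longrightarrow> r u v = 0))"

definition diff_form :: "(real^'n) set \<Rightarrow> ((real^'n \<Rightarrow> complex) \<Rightarrow> real^'n \<Rightarrow> complex^'n)
    \<Rightarrow> (real^'n \<Rightarrow> complex^'n^'n) \<Rightarrow> (real^'n \<Rightarrow> complex^'n) \<Rightarrow> (real^'n \<Rightarrow> complex^'n)
    \<Rightarrow> (real^'n \<Rightarrow> complex) \<Rightarrow> (real^'n \<Rightarrow> complex) \<Rightarrow> (real^'n \<Rightarrow> complex) \<Rightarrow> complex" where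
  "diff_form \<Omega> grad C b d c0 u v =
     (LINT x|lebesgue_on \<Omega>. cdot (C x *v grad u x) (grad v x))
   + (LINT x|lebesgue_on \<Omega>. (\<Sum>k\<in>UNIV. b x $ k * grad u x $ k) * cnj (v x))
   + (LINT x|lebesgue_on \<Omega>. (\<Sum>k\<in>UNIV. d x $ k * u x * cnj (grad v x $ k)))
   + (LINT x|lebesgue_on \<Omega>. c0 x * u x * cnj (v x))"

definition diff_setting :: "(real^'n) set \<Rightarrow> (real^'n \<Rightarrow> complex) set \<Rightarrow> ((real^'n \<Rightarrow> complex) \<Rightarrow> real^'n \<Rightarrow> complex^'n)
    \<Rightarrow> (real^'n \<Rightarrow> complex^'n^'n) \<Rightarrow> (real^'n \<Rightarrow> complex^'n) \<Rightarrow> (real^'n \<Rightarrow> complex^'n)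
    \<Rightarrow> (real^'n \<Rightarrow> complex) \<Rightarrow> bool" where
  "diff_setting \<Omega> D grad C b d c0 \<longleftrightarrow>
     open \<Omega> \<and>
     (\<forall>u\<in>D. L2 \<Omega> u) \<and>
     (\<forall>u\<in>D. \<forall>v\<in>D. (\<lambda>x. u x + v x) \<in> D) \<and>
     (\<forall>u\<in>D. \<forall>c. (\<lambda>x. c * u x) \<in> D) \<and>
     (\<forall>\<phi>. test_fn \<Omega> \<phi> \<longrightarrow> \<phi> \<in> D) \<and>
     (\<forall>u\<in>D. weak_grad \<Omega> u (grad u)) \<and>
     C \<in> borel_measurable (lebesgue_on \<Omega>) \<and>
     b \<in> borel_measurable (lebesgue_on \<Omega>) \<and>
     d \<in> borel_measurable (lebesgue_on \<Omega>) \<and>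
     c0 \<in> borel_measurable (lebesgue_on \<Omega>) \<and> ess_bounded \<Omega> c0 \<and>
     (\<forall>u\<in>D. integrable (lebesgue_on \<Omega>) (\<lambda>x. cdot (C x *v grad u x) (grad u x))) \<and>
     (\<exists>\<theta>. 0 \<le> \<theta> \<and> \<theta> < pi/2 \<and> (\<forall>x\<in>\<Omega>. \<forall>\<xi>. cdot (C x *v \<xi>) \<xi> \<in> sector \<theta>)) \<and>
     (\<exists>K>0. \<forall>x\<in>\<Omega>. \<forall>\<xi>.
        cmod (cdot (vconj (b x)) \<xi>) \<le> K * norm (sqrtA C x *v \<xi>) \<and>
        cmod (cdot (d x) \<xi>) \<le> K * norm (sqrtA C x *v \<xi>))"

definition condL :: "(real^'n) set \<Rightarrow> (real^'n \<Rightarrow> complex) set \<Rightarrow> (real^'n \<Rightarrow> complex^'n^'n) \<Rightarrow> bool" where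
  "condL \<Omega> D C \<longleftrightarrow>
     (\<forall>u\<in>D. ess_bounded \<Omega> u \<longrightarrow> (\<forall>\<phi>. test_fn \<Omega> \<phi> \<longrightarrow> (\<lambda>x. \<phi> x * u x) \<in> D)) \<and>
     (\<exists>\<psi> \<psi>' :: real \<Rightarrow> real.
        (\<forall>t. (\<psi> has_real_derivative \<psi>' t) (at t)) \<and> continuous_on UNIV \<psi>' \<and>
        bounded (range \<psi>) \<and> bounded (range \<psi>') \<and> \<psi> 0 = 0 \<and> \<psi>' 0 = 1 \<and>
        (\<forall>u\<in>D. (\<lambda>x. complex_of_real (\<psi> (Re (u x))) + \<i> * complex_of_real (\<psi> (Im (u x)))) \<in> D)) \<and>
     (\<forall>x\<in>\<Omega>. \<forall>k l. Im (C x $ k $ l + cnj (C x $ l $ k)) = 0)"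

definition condB :: "(real^'n) set \<Rightarrow> (real^'n \<Rightarrow> complex) set \<Rightarrow> (real^'n \<Rightarrow> complex^'n^'n) \<Rightarrow> bool" where
  "condB \<Omega> D C \<longleftrightarrow>
     (\<forall>u\<in>D. \<forall>\<phi>. test_fn \<Omega> \<phi> \<longrightarrow> (\<lambda>x. \<phi> x * u x) \<in> D) \<and>
     (\<forall>k l. Linfloc \<Omega> (\<lambda>x. C x $ k $ l))"

text \<open>V_s = {w in (L^2)^d : (0,w) in closure of {(u, A^(1/2) grad u) : u in D}}.\<close>
definition Vs :: "(real^'n) set \<Rightarrow> (real^'n \<Rightarrow> complex) set \<Rightarrow> ((real^'n \<Rightarrow> complex) \<Rightarrow> real^'n \<Rightarrow> complex^'n)
    \<Rightarrow> (real^'n \<Rightarrow> complex^'n^'n) \<Rightarrow> (real^'n \<Rightarrow> complex^'n) set" where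
  "Vs \<Omega> D grad C = {w. L2v \<Omega> w \<and>
     (\<exists>s. (\<forall>n. s n \<in> D) \<and> (\<lambda>n. l2norm \<Omega> (s n)) \<longlonglongrightarrow> 0 \<and>
          (\<lambda>n. l2vnorm \<Omega> (\<lambda>x. sqrtA C x *v grad (s n) x - w x)) \<longlonglongrightarrow> 0)}"

end

theory Submission
  imports Defs "HOL-Library.Function_Algebras"
begin

text \<open>
  Let $V$ be the closure of the jets $(u, A^{1/2}\nabla u)$, $u \in D(a)$. The form extends to a bounded form
  on $V$ that is coercive up to a multiple of the $L^2$-norm of the first component, and the elements of $V$
  with vanishing first component are $V_s = \operatorname{ran} Q$. Call $U \in V$ regular if $a(U, \cdot)$
  annihilates $V_s$. By the Lax--Milgram theorem every fibre of the first projection contains exactly one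
  regular element; over $u \in D(a)$, with $w = PA^{1/2}\nabla u$, it is $(u, w - W(iZw + uY))$. Evaluated on
  regular elements, $a$ becomes a closed form on the first projection of $V$, and it restricts to the asserted
  formula on $D(a)$. The operator does not change, since $a(U, \cdot) = \langle f, \cdot\rangle$ forces $U$
  to be regular.

  The regular part is unique because the operator domain of a closed sectorial form is a form core, so that two
  closable forms with the same domain and the same operator agree. That the jets of $D(a)$ form a
  subspace up to null sets is a consequence of the du Bois-Reymond lemma.
\<close>

section \<open>Semi-Hilbert spaces\<close>

instantiation "fun" :: (type, real_vector) real_vector
begin

definition scaleR_fun :: "real \<Rightarrow> ('a \<Rightarrow> 'b) \<Rightarrow> 'a \<Rightarrow> 'b" where
  "scaleR_fun r f = (\<lambda>x. r *\<^sub>R f x)"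

instance
  by standard (simp_all add: scaleR_fun_def fun_eq_iff algebra_simps)

end

locale semi_inner =
  fixes S :: "'a::real_vector set" and ip :: "'a \<Rightarrow> 'a \<Rightarrow> real"
  assumes subspace: "subspace S"
    and ip_add_left: "\<And>x y z. x \<in> S \<Longrightarrow> y \<in> S \<Longrightarrow> z \<in> S \<Longrightarrow> ip (x + y) z = ip x z + ip y z"
    and ip_scaleR_left: "\<And>r x y. x \<in> S \<Longrightarrow> y \<in> S \<Longrightarrow> ip (r *\<^sub>R x) y = r * ip x y"
    and ip_commute: "\<And>x y. x \<in> S \<Longrightarrow> y \<in> S \<Longrightarrow> ip x y = ip y x"
    and ip_nonneg: "\<And>x. x \<in> S \<Longrightarrow> 0 \<le> ip x x"
begin

definition nrm :: "'a \<Rightarrow> real" where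
  "nrm x = sqrt (ip x x)"

definition nrm_lim :: "(nat \<Rightarrow> 'a) \<Rightarrow> 'a \<Rightarrow> bool" where
  "nrm_lim s x \<longleftrightarrow> (\<lambda>n. nrm (s n - x)) \<longlonglongrightarrow> 0"

definition nrm_Cauchy :: "(nat \<Rightarrow> 'a) \<Rightarrow> bool" where
  "nrm_Cauchy s \<longleftrightarrow> (\<forall>e>0. \<exists>N. \<forall>m\<ge>N. \<forall>n\<ge>N. nrm (s m - s n) < e)"

definition nrm_closure :: "'a set \<Rightarrow> 'a set" where
  "nrm_closure T = {x \<in> S. \<forall>e>0. \<exists>y\<in>T. nrm (y - x) < e}"

lemmas add_in = subspace_add[OF subspace]
  and scaleR_in = subspace_scale[OF subspace]
  and diff_in = subspace_diff[OF subspace]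
  and zero_in = subspace_0[OF subspace]

lemma nrm_nonneg [simp]: "x \<in> S \<Longrightarrow> 0 \<le> nrm x"
  by (simp add: nrm_def ip_nonneg)

lemma nrm_power2: "x \<in> S \<Longrightarrow> (nrm x)\<^sup>2 = ip x x"
  by (simp add: nrm_def ip_nonneg)

lemma ip_add_right: "x \<in> S \<Longrightarrow> y \<in> S \<Longrightarrow> z \<in> S \<Longrightarrow> ip x (y + z) = ip x y + ip x z"
  by (metis ip_add_left ip_commute add_in)

lemma ip_scaleR_right: "x \<in> S \<Longrightarrow> y \<in> S \<Longrightarrow> ip x (r *\<^sub>R y) = r * ip x y"
  by (metis ip_scaleR_left ip_commute scaleR_in)

lemma ip_diff_left: "x \<in> S \<Longrightarrow> y \<in> S \<Longrightarrow> z \<in> S \<Longrightarrow> ip (x - y) z = ip x z - ip y z"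
  using ip_add_left[of x "(-1) *\<^sub>R y" z] ip_scaleR_left[of y z "-1"] scaleR_in[of y "-1"] by simp

lemma ip_diff_right: "x \<in> S \<Longrightarrow> y \<in> S \<Longrightarrow> z \<in> S \<Longrightarrow> ip x (y - z) = ip x y - ip x z"
  by (metis ip_diff_left ip_commute diff_in)

lemma nrm_zero [simp]: "nrm 0 = 0"
  using ip_scaleR_left[OF zero_in zero_in, of 0] by (simp add: nrm_def)

lemma nrm_scaleR: "x \<in> S \<Longrightarrow> nrm (r *\<^sub>R x) = \<bar>r\<bar> * nrm x"
  using scaleR_in[of x r]
  by (simp add: nrm_def ip_scaleR_left ip_scaleR_right real_sqrt_mult flip: mult.assoc)

lemma nrm_minus_commute: "x \<in> S \<Longrightarrow> y \<in> S \<Longrightarrow> nrm (x - y) = nrm (y - x)"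
  by (simp add: nrm_def ip_diff_left ip_diff_right diff_in)

lemma ip_add_scaleR:
  "x \<in> S \<Longrightarrow> y \<in> S \<Longrightarrow> ip (x + t *\<^sub>R y) (x + t *\<^sub>R y) = ip x x + 2 * t * ip x y + t\<^sup>2 * ip y y"
  using scaleR_in[of y t] add_in[of x "t *\<^sub>R y"] ip_commute[of y x]
  by (simp add: ip_add_left ip_add_right ip_scaleR_left ip_scaleR_right power2_eq_square algebra_simps)

lemma cauchy_schwarz:
  assumes x: "x \<in> S" and y: "y \<in> S"
  shows "\<bar>ip x y\<bar> \<le> nrm x * nrm y"
proof -
  have quadratic: "0 \<le> ip x x + 2 * t * ip x y + t\<^sup>2 * ip y y" for t
    using ip_nonneg[OF add_in[OF x scaleR_in[OF y, of t]]] by (simp add: ip_add_scaleR[OF x y])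
  have "(ip x y)\<^sup>2 \<le> ip x x * ip y y"
  proof (cases "ip y y = 0")
    case True
    have "ip x y = 0"
    proof (rule ccontr)
      assume "ip x y \<noteq> 0"
      then show False using quadratic[of "- (ip x x + 1) / (2 * ip x y)"] True by (simp add: field_simps)
    qed
    then show ?thesis using True by simp
  next
    case False
    then have pos: "ip y y > 0" using ip_nonneg[OF y] by simp
    have "0 \<le> ip x x + 2 * (- ip x y / ip y y) * ip x y + (- ip x y / ip y y)\<^sup>2 * ip y y"
      by (rule quadratic)
    also have "\<dots> = ip x x - (ip x y)\<^sup>2 / ip y y" using False by (simp add: power2_eq_square field_simps)
    finally show ?thesis using pos by (simp add: field_simps)
  qed
  then have "sqrt ((ip x y)\<^sup>2) \<le> sqrt (ip x x * ip y y)" by (rule real_sqrt_le_mono)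
  then show ?thesis by (simp add: nrm_def real_sqrt_mult)
qed

lemma ip_eq_0_if_nrm_eq_0: "x \<in> S \<Longrightarrow> y \<in> S \<Longrightarrow> nrm x = 0 \<Longrightarrow> ip x y = 0"
  using cauchy_schwarz[of x y] by simp

lemma nrm_triangle:
  assumes x: "x \<in> S" and y: "y \<in> S"
  shows "nrm (x + y) \<le> nrm x + nrm y"
proof (rule power2_le_imp_le)
  have "(nrm (x + y))\<^sup>2 = ip x x + 2 * ip x y + ip y y"
    using ip_add_scaleR[OF x y, of 1] by (simp add: nrm_power2 add_in x y)
  also have "\<dots> \<le> ip x x + 2 * (nrm x * nrm y) + ip y y"
    using cauchy_schwarz[OF x y] by linarith
  also have "\<dots> = (nrm x + nrm y)\<^sup>2"
    using x y by (simp add: power2_sum flip: nrm_power2)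
  finally show "(nrm (x + y))\<^sup>2 \<le> (nrm x + nrm y)\<^sup>2" .
qed (simp add: x y)

lemma nrm_triangle_diff: "x \<in> S \<Longrightarrow> y \<in> S \<Longrightarrow> z \<in> S \<Longrightarrow> nrm (x - z) \<le> nrm (x - y) + nrm (y - z)"
  using nrm_triangle[of "x - y" "y - z"] diff_in by simp

lemma nrm_add_eq_0: "x \<in> S \<Longrightarrow> y \<in> S \<Longrightarrow> nrm x = 0 \<Longrightarrow> nrm y = 0 \<Longrightarrow> nrm (x + y) = 0"
  using nrm_triangle[of x y] nrm_nonneg[OF add_in[of x y]] by simp

lemma nrm_diff_0_trans:
  "x \<in> S \<Longrightarrow> y \<in> S \<Longrightarrow> z \<in> S \<Longrightarrow> nrm (x - y) = 0 \<Longrightarrow> nrm (y - z) = 0 \<Longrightarrow> nrm (x - z) = 0"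
  using nrm_add_eq_0[of "x - y" "y - z"] diff_in by simp

lemma nrm_le_diff_add: "x \<in> S \<Longrightarrow> y \<in> S \<Longrightarrow> nrm x \<le> nrm (x - y) + nrm y"
  using nrm_triangle[of "x - y" y] diff_in by simp

text \<open>Both \<open>c ip + h\<close> and \<open>c ip - h\<close> are semi-inner products, and \<open>h\<close> is half their difference.\<close>

lemma symmetric_form_bound:
  assumes h_add: "\<And>x y z. x \<in> S \<Longrightarrow> y \<in> S \<Longrightarrow> z \<in> S \<Longrightarrow> h (x + y) z = h x z + h y z"
    and h_scaleR: "\<And>r x y. x \<in> S \<Longrightarrow> y \<in> S \<Longrightarrow> h (r *\<^sub>R x) y = r * h x y"
    and h_commute: "\<And>x y. x \<in> S \<Longrightarrow> y \<in> S \<Longrightarrow> h x y = h y x"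
    and h_diagonal: "\<And>x. x \<in> S \<Longrightarrow> \<bar>h x x\<bar> \<le> c * ip x x"
    and x: "x \<in> S" and y: "y \<in> S"
  shows "\<bar>h x y\<bar> \<le> c * (nrm x * nrm y)"
proof -
  define plus minus where "plus = (\<lambda>x y. c * ip x y + h x y)" and "minus = (\<lambda>x y. c * ip x y - h x y)"
  interpret plus: semi_inner S plus
    by unfold_locales
      (use h_diagonal subspace in \<open>force simp: plus_def h_add h_scaleR h_commute
         ip_add_left ip_scaleR_left ip_commute abs_le_iff algebra_simps\<close>)+
  interpret minus: semi_inner S minus
    by unfold_locales
      (use h_diagonal subspace in \<open>force simp: minus_def h_add h_scaleR h_commute
         ip_add_left ip_scaleR_left ip_commute abs_le_iff algebra_simps\<close>)+
  have "(plus.nrm z)\<^sup>2 + (minus.nrm z)\<^sup>2 = 2 * c * (nrm z)\<^sup>2" if "z \<in> S" for z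
    using that by (simp add: plus.nrm_power2 minus.nrm_power2 nrm_power2) (simp add: plus_def minus_def)
  then have norm: "norm (plus.nrm z, minus.nrm z) = sqrt (2 * c * (nrm z)\<^sup>2)" if "z \<in> S" for z
    using that by (simp add: norm_Pair)
  have "2 * \<bar>h x y\<bar> = \<bar>plus x y - minus x y\<bar>" by (simp add: plus_def minus_def)
  also have "\<dots> \<le> plus.nrm x * plus.nrm y + minus.nrm x * minus.nrm y"
    using plus.cauchy_schwarz[OF x y] minus.cauchy_schwarz[OF x y] by linarith
  also have "\<dots> = (plus.nrm x, minus.nrm x) \<bullet> (plus.nrm y, minus.nrm y)" by simp
  also have "\<dots> \<le> norm (plus.nrm x, minus.nrm x) * norm (plus.nrm y, minus.nrm y)"
    by (rule norm_cauchy_schwarz)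
  also have "\<dots> = sqrt ((2 * c * (nrm x * nrm y))\<^sup>2)"
    unfolding norm[OF x] norm[OF y] real_sqrt_mult[symmetric] by (simp add: power2_eq_square algebra_simps)
  also have "\<dots> = \<bar>2 * c * (nrm x * nrm y)\<bar>" by simp
  finally have bound: "2 * \<bar>h x y\<bar> \<le> \<bar>2 * c * (nrm x * nrm y)\<bar>" .
  have "0 \<le> c * ip z z" if "z \<in> S" for z using h_diagonal[OF that] abs_ge_zero order_trans by blast
  then have "0 \<le> c \<or> nrm x = 0"
    using x ip_nonneg[OF x] by (fastforce simp: nrm_def zero_le_mult_iff)
  then show ?thesis using bound x y by (auto simp: abs_mult)
qed

lemma nrm_lim_subst_le:
  assumes "nrm_lim s x" "\<And>n. 0 \<le> f n" "\<And>n. f n \<le> c * nrm (s n - x)"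
  shows "f \<longlonglongrightarrow> 0"
proof (rule Lim_null_comparison)
  show "(\<lambda>n. c * nrm (s n - x)) \<longlonglongrightarrow> 0"
    using assms(1) unfolding nrm_lim_def by (rule tendsto_mult_right_zero)
qed (use assms in simp)

lemma nrm_lim_imp_nrm_Cauchy:
  assumes s: "\<And>n. s n \<in> S" and x: "x \<in> S" and lim: "nrm_lim s x"
  shows "nrm_Cauchy s"
  unfolding nrm_Cauchy_def
proof (intro allI impI)
  fix e :: real assume "e > 0"
  then have "e / 2 > 0" by simp
  then obtain N where N: "\<And>n. n \<ge> N \<Longrightarrow> nrm (s n - x) < e / 2"
    using order_tendstoD(2)[OF lim[unfolded nrm_lim_def], of "e / 2"] by (auto simp: eventually_sequentially)
  have "nrm (s m - s n) < e" if "m \<ge> N" "n \<ge> N" for m n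
    using N[OF that(1)] N[OF that(2)] nrm_triangle_diff[OF s x s, of m n] nrm_minus_commute[OF x s, of n] by simp
  then show "\<exists>N. \<forall>m\<ge>N. \<forall>n\<ge>N. nrm (s m - s n) < e" by blast
qed

lemma nrm_lim_ip:
  assumes s: "\<And>n. s n \<in> S" and x: "x \<in> S" and y: "y \<in> S" and lim: "nrm_lim s x"
  shows "(\<lambda>n. ip (s n) y) \<longlonglongrightarrow> ip x y"
proof (rule LIM_zero_cancel, rule Lim_null_comparison)
  show "\<forall>\<^sub>F n in sequentially. norm (ip (s n) y - ip x y) \<le> nrm (s n - x) * nrm y"
    using cauchy_schwarz[OF diff_in[OF s x] y] by (simp add: ip_diff_left s x y)
  show "(\<lambda>n. nrm (s n - x) * nrm y) \<longlonglongrightarrow> 0"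
    using lim unfolding nrm_lim_def by (rule tendsto_mult_left_zero)
qed

lemma nrm_lim_bounded:
  assumes s: "\<And>n. s n \<in> S" and x: "x \<in> S" and lim: "nrm_lim s x"
  obtains K where "0 \<le> K" "\<And>n. nrm (s n) \<le> K"
proof -
  have "Bseq (\<lambda>n. nrm (s n - x))"
    using lim by (auto simp: nrm_lim_def intro: convergent_imp_Bseq convergentI)
  then obtain R where R: "\<And>n. nrm (s n - x) \<le> R" by (auto simp: Bseq_def abs_le_iff)
  show thesis
  proof
    show "0 \<le> \<bar>R\<bar> + nrm x" using x by simp
    show "nrm (s n) \<le> \<bar>R\<bar> + nrm x" for n using nrm_le_diff_add[OF s x, of n] R[of n] by linarith
  qed
qed

lemma subset_nrm_closure: "T \<subseteq> S \<Longrightarrow> T \<subseteq> nrm_closure T"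
  unfolding nrm_closure_def by (auto intro!: bexI)

lemma nrm_closureD: "x \<in> nrm_closure T \<Longrightarrow> e > 0 \<Longrightarrow> \<exists>y\<in>T. nrm (y - x) < e"
  by (simp add: nrm_closure_def)

lemma nrm_closure_sequence:
  assumes T: "T \<subseteq> S" and x: "x \<in> nrm_closure T"
  obtains s where "\<And>n::nat. s n \<in> T" "nrm_lim s x"
proof -
  have "\<exists>y\<in>T. nrm (y - x) < inverse (real (Suc n))" for n using x by (simp add: nrm_closure_def)
  then obtain s where s: "\<And>n. s n \<in> T" "\<And>n. nrm (s n - x) < inverse (real (Suc n))" by metis
  have "0 \<le> nrm (s n - x)" for n using s(1) T x by (intro nrm_nonneg diff_in) (auto simp: nrm_closure_def)
  then have "nrm_lim s x"
    using s(2) unfolding nrm_lim_def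
    by (intro Lim_null_comparison[OF _ LIMSEQ_inverse_real_of_nat]) (auto simp: less_imp_le)
  with s(1) show thesis by (rule that)
qed

lemma nrm_closureI_approx:
  assumes T: "T \<subseteq> S" and x: "x \<in> S" and approx: "\<And>e. e > 0 \<Longrightarrow> \<exists>y \<in> nrm_closure T. nrm (y - x) < e"
  shows "x \<in> nrm_closure T"
  unfolding nrm_closure_def
proof (intro CollectI conjI allI impI x)
  fix e :: real assume "e > 0"
  then have half_e: "e / 2 > 0" by simp
  obtain y where y: "y \<in> nrm_closure T" "nrm (y - x) < e / 2" using approx[OF half_e] by blast
  obtain z where z: "z \<in> T" "nrm (z - y) < e / 2" using nrm_closureD[OF y(1) half_e] by blast
  have "nrm (z - x) \<le> nrm (z - y) + nrm (y - x)"
    using T x y z by (intro nrm_triangle_diff) (auto simp: nrm_closure_def)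
  with y z show "\<exists>z\<in>T. nrm (z - x) < e" by (intro bexI[of _ z]) auto
qed

lemma nrm_closure_limit:
  assumes "T \<subseteq> S" "\<And>n. s n \<in> nrm_closure T" "x \<in> S" "nrm_lim s x"
  shows "x \<in> nrm_closure T"
proof (rule nrm_closureI_approx[OF assms(1,3)])
  fix e :: real assume "e > 0"
  then obtain n where "nrm (s n - x) < e"
    using order_tendstoD(2)[OF assms(4)[unfolded nrm_lim_def]] by (auto simp: eventually_sequentially)
  then show "\<exists>y \<in> nrm_closure T. nrm (y - x) < e" using assms(2) by blast
qed

lemma nrm_lim_add:
  assumes s: "\<And>n. s n \<in> S" "x \<in> S" "nrm_lim s x" and t: "\<And>n. t n \<in> S" "y \<in> S" "nrm_lim t y"
  shows "nrm_lim (\<lambda>n. s n + t n) (x + y)"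
  unfolding nrm_lim_def
proof (rule Lim_null_comparison)
  show "(\<lambda>n. nrm (s n - x) + nrm (t n - y)) \<longlonglongrightarrow> 0"
    using tendsto_add[OF s(3)[unfolded nrm_lim_def] t(3)[unfolded nrm_lim_def]] by simp
  have "0 \<le> nrm (s n + t n - (x + y))" for n by (intro nrm_nonneg diff_in add_in s t)
  moreover have "nrm (s n + t n - (x + y)) \<le> nrm (s n - x) + nrm (t n - y)" for n
    using nrm_triangle[OF diff_in[OF s(1,2)] diff_in[OF t(1,2)]] by (simp add: algebra_simps)
  ultimately show "\<forall>\<^sub>F n in sequentially. norm (nrm (s n + t n - (x + y))) \<le> nrm (s n - x) + nrm (t n - y)"
    by simp
qed

lemma nrm_lim_scaled_map:
  assumes lim: "nrm_lim s x" and f: "\<And>n. nrm (f (s n) - f x) = c * nrm (s n - x)"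
  shows "nrm_lim (\<lambda>n. f (s n)) (f x)"
  using tendsto_mult_right_zero[OF lim[unfolded nrm_lim_def]] by (simp add: nrm_lim_def f)

lemma nrm_closure_add:
  assumes T: "subspace T" "T \<subseteq> S" and x: "x \<in> nrm_closure T" and y: "y \<in> nrm_closure T"
  shows "x + y \<in> nrm_closure T"
proof -
  obtain s t where s: "\<And>n. s n \<in> T" "nrm_lim s x" and t: "\<And>n. t n \<in> T" "nrm_lim t y"
    using nrm_closure_sequence[OF T(2) x] nrm_closure_sequence[OF T(2) y] by metis
  have in_S: "x \<in> S" "y \<in> S" using x y by (auto simp: nrm_closure_def)
  show ?thesis
  proof (rule nrm_closure_limit[OF T(2)])
    show "s n + t n \<in> nrm_closure T" for n
      using subspace_add[OF T(1) s(1) t(1)] subset_nrm_closure[OF T(2)] by blast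
    show "nrm_lim (\<lambda>n. s n + t n) (x + y)"
      using s t T(2) in_S by (intro nrm_lim_add) auto
  qed (rule add_in[OF in_S])
qed

lemma nrm_closure_scaled_map:
  assumes T: "T \<subseteq> S" "\<And>y. y \<in> T \<Longrightarrow> f y \<in> T" and x: "x \<in> nrm_closure T" and fx_in_S: "f x \<in> S"
    and f: "\<And>y. y \<in> T \<Longrightarrow> nrm (f y - f x) = c * nrm (y - x)"
  shows "f x \<in> nrm_closure T"
proof -
  obtain s where s: "\<And>n. s n \<in> T" "nrm_lim s x" using nrm_closure_sequence[OF T(1) x] by blast
  have "nrm_lim (\<lambda>n. f (s n)) (f x)" by (rule nrm_lim_scaled_map[OF s(2) f[OF s(1)]])
  moreover have "f (s n) \<in> nrm_closure T" for n using T s(1) subset_nrm_closure by blast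
  ultimately show ?thesis by (intro nrm_closure_limit[OF T(1) _ fx_in_S])
qed

lemma subspace_nrm_closure:
  assumes T: "subspace T" "T \<subseteq> S"
  shows "subspace (nrm_closure T)"
proof -
  have "r *\<^sub>R x \<in> nrm_closure T" if x: "x \<in> nrm_closure T" for r x
  proof (rule nrm_closure_scaled_map[OF T(2) _ x])
    have x_in_S: "x \<in> S" using x by (simp add: nrm_closure_def)
    then show "r *\<^sub>R x \<in> S" by (rule scaleR_in)
    show "nrm (r *\<^sub>R y - r *\<^sub>R x) = \<bar>r\<bar> * nrm (y - x)" if "y \<in> T" for y
      using nrm_scaleR[OF diff_in[of y x], of r] that T(2) x_in_S by (simp add: subset_iff scaleR_diff_right)
  qed (rule subspace_scale[OF T(1)])
  then show ?thesis
    using nrm_closure_add[OF T] subspace_0[OF T(1)] subset_nrm_closure[OF T(2)] by (auto simp: subspace_def)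
qed

lemma semi_inner_subspace: "subspace T \<Longrightarrow> T \<subseteq> S \<Longrightarrow> semi_inner T ip"
  by unfold_locales (auto simp: subset_iff ip_add_left ip_scaleR_left ip_nonneg intro: ip_commute)

end

locale semi_hilbert = semi_inner +
  assumes complete: "\<And>s. (\<And>n. s n \<in> S) \<Longrightarrow> nrm_Cauchy s \<Longrightarrow> \<exists>x\<in>S. nrm_lim s x"
begin

lemma semi_hilbert_closed_subspace:
  assumes T: "subspace T" "T \<subseteq> S"
    and closed: "\<And>s x. (\<And>n. s n \<in> T) \<Longrightarrow> x \<in> S \<Longrightarrow> nrm_lim s x \<Longrightarrow> x \<in> T"
  shows "semi_hilbert T ip"
proof -
  interpret T: semi_inner T ip by (rule semi_inner_subspace[OF T])
  show ?thesis
  proof unfold_locales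
    fix s assume s: "\<And>n. s n \<in> T" and "nrm_Cauchy s"
    then obtain x where "x \<in> S" "nrm_lim s x" using complete[of s] T(2) by blast
    with s show "\<exists>x\<in>T. nrm_lim s x" using closed[of s x] by blast
  qed
qed

lemma semi_hilbert_nrm_closure: "subspace T \<Longrightarrow> T \<subseteq> S \<Longrightarrow> semi_hilbert (nrm_closure T) ip"
  by (rule semi_hilbert_closed_subspace)
    (auto intro: subspace_nrm_closure nrm_closure_limit, simp add: nrm_closure_def)

end

lemma nonneg_quadratic_imp_linear_term_0:
  fixes a p :: real
  assumes "\<And>t. 0 \<le> 2 * t * a + t\<^sup>2 * p"
  shows "a = 0"
proof -
  define P where "P = \<bar>p\<bar> + 1"
  have P: "P > 0" "p \<le> P" by (auto simp: P_def)
  have "0 \<le> 2 * (- a / P) * a + (- a / P)\<^sup>2 * p" by (rule assms)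
  also have "\<dots> \<le> 2 * (- a / P) * a + (- a / P)\<^sup>2 * P" using P by (intro add_left_mono mult_left_mono) auto
  also have "\<dots> = - (a\<^sup>2 / P)" using P by (simp add: power2_eq_square field_simps)
  finally have "a\<^sup>2 / P \<le> 0" by simp
  then show ?thesis using P by (simp add: divide_le_0_iff power2_less_0 not_less)
qed

locale bounded_functional = semi_hilbert +
  fixes F :: "'a \<Rightarrow> real" and K :: real
  assumes F_add: "\<And>x y. x \<in> S \<Longrightarrow> y \<in> S \<Longrightarrow> F (x + y) = F x + F y"
    and F_scaleR: "\<And>r x. x \<in> S \<Longrightarrow> F (r *\<^sub>R x) = r * F x"
    and F_bounded: "\<And>x. x \<in> S \<Longrightarrow> \<bar>F x\<bar> \<le> K * nrm x"
begin

definition energy :: "'a \<Rightarrow> real" where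
  "energy x = ip x x - 2 * F x"

lemma energy_add_scaleR:
  "x \<in> S \<Longrightarrow> y \<in> S \<Longrightarrow> energy (x + t *\<^sub>R y) = energy x + 2 * t * (ip x y - F y) + t\<^sup>2 * ip y y"
  by (simp add: energy_def ip_add_scaleR F_add F_scaleR scaleR_in algebra_simps)

lemma energy_bounded_below: "x \<in> S \<Longrightarrow> - K\<^sup>2 \<le> energy x"
proof -
  assume x: "x \<in> S"
  have "F x \<le> K * nrm x" using F_bounded[OF x] by linarith
  moreover have "0 \<le> (nrm x - K)\<^sup>2" by simp
  ultimately show ?thesis using nrm_power2[OF x] by (simp add: energy_def power2_eq_square algebra_simps)
qed

lemma energy_parallelogram:
  assumes x: "x \<in> S" and y: "y \<in> S"
  shows "(nrm (x - y))\<^sup>2 = 2 * energy x + 2 * energy y - 4 * energy ((1/2) *\<^sub>R (x + y))"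
proof -
  have "energy ((1/2) *\<^sub>R (x + y)) = (ip x x + 2 * ip x y + ip y y) / 4 - (F x + F y)"
    using add_in[OF x y] ip_add_scaleR[OF x y, of 1] x y
    by (simp add: energy_def ip_scaleR_left ip_scaleR_right F_scaleR F_add scaleR_in del: scaleR_add_right)
      (simp add: field_simps)
  moreover have "(nrm (x - y))\<^sup>2 = ip x x - 2 * ip x y + ip y y"
    using x y diff_in[OF x y] ip_commute[OF y x] by (simp add: nrm_power2 ip_diff_left ip_diff_right)
  ultimately show ?thesis by (simp add: energy_def field_simps)
qed

lemma minimizing_sequence_nrm_Cauchy:
  assumes v: "\<And>n. v n \<in> S" and m_lower: "\<And>x. x \<in> S \<Longrightarrow> m \<le> energy x"
    and min: "\<And>n. energy (v n) < m + inverse (real (Suc n))"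
  shows "nrm_Cauchy v"
  unfolding nrm_Cauchy_def
proof (intro allI impI)
  fix e :: real assume e: "e > 0"
  then obtain N where N: "inverse (real (Suc N)) < e\<^sup>2 / 4" using reals_Archimedean[of "e\<^sup>2 / 4"] by auto
  have "nrm (v k - v n) < e" if "k \<ge> N" "n \<ge> N" for k n
  proof (rule power2_less_imp_less)
    have "inverse (real (Suc k)) \<le> inverse (real (Suc N))" "inverse (real (Suc n)) \<le> inverse (real (Suc N))"
      using that by (auto intro!: le_imp_inverse_le)
    moreover have "m \<le> energy ((1/2) *\<^sub>R (v k + v n))" by (intro m_lower scaleR_in add_in v)
    ultimately show "(nrm (v k - v n))\<^sup>2 < e\<^sup>2"
      using energy_parallelogram[OF v v, of k n] min[of k] min[of n] N by argo
  qed (use e in simp)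
  then show "\<exists>N. \<forall>m\<ge>N. \<forall>n\<ge>N. nrm (v m - v n) < e" by blast
qed

theorem riesz_representation: "\<exists>z\<in>S. \<forall>y\<in>S. ip z y = F y"
proof -
  define m where "m = Inf (energy ` S)"
  have bdd: "bdd_below (energy ` S)" using energy_bounded_below by (intro bdd_belowI[of _ "- K\<^sup>2"]) auto
  then have m_le: "m \<le> energy x" if "x \<in> S" for x unfolding m_def using that by (intro cInf_lower) auto
  have "\<exists>v\<in>S. energy v < m + inverse (real (Suc n))" for n
  proof -
    have "Inf (energy ` S) < m + inverse (real (Suc n))" by (simp add: m_def)
    then show ?thesis using zero_in bdd by (subst (asm) cInf_less_iff) auto
  qed
  then obtain v where v: "\<And>n. v n \<in> S" and min: "\<And>n. energy (v n) < m + inverse (real (Suc n))" by metis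
  then obtain z where z: "z \<in> S" and lim: "nrm_lim v z"
    using complete[OF v minimizing_sequence_nrm_Cauchy[OF v m_le min]] by blast
  have "ip z y = F y" if y: "y \<in> S" for y
  proof -
    have "0 \<le> 2 * t * (ip z y - F y) + t\<^sup>2 * ip y y" for t
    proof (rule LIMSEQ_le_const)
      show "(\<lambda>n. inverse (real (Suc n)) + (2 * t * (ip (v n) y - F y) + t\<^sup>2 * ip y y))
          \<longlonglongrightarrow> 2 * t * (ip z y - F y) + t\<^sup>2 * ip y y"
        using tendsto_add[OF LIMSEQ_inverse_real_of_nat tendsto_add[OF tendsto_mult_left[OF
            tendsto_diff[OF nrm_lim_ip[OF v z y lim] tendsto_const]] tendsto_const]] by simp
      have "0 \<le> inverse (real (Suc n)) + (2 * t * (ip (v n) y - F y) + t\<^sup>2 * ip y y)" for n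
        using m_le[OF add_in[OF v scaleR_in[OF y]], of n t] min[of n] by (simp add: energy_add_scaleR v y)
      then show "\<exists>N. \<forall>n\<ge>N. 0 \<le> inverse (real (Suc n)) + (2 * t * (ip (v n) y - F y) + t\<^sup>2 * ip y y)" by blast
    qed
    then have "ip z y - F y = 0" by (rule nonneg_quadratic_imp_linear_term_0)
    then show ?thesis by simp
  qed
  then show ?thesis using z by blast
qed

end

locale complex_semi_inner = semi_inner +
  fixes smult :: "complex \<Rightarrow> 'a \<Rightarrow> 'a"
  assumes smult_in: "\<And>c x. x \<in> S \<Longrightarrow> smult c x \<in> S"
    and smult_of_real: "\<And>r x. x \<in> S \<Longrightarrow> smult (complex_of_real r) x = r *\<^sub>R x"
    and smult_add: "\<And>c x y. x \<in> S \<Longrightarrow> y \<in> S \<Longrightarrow> smult c (x + y) = smult c x + smult c y"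
    and nrm_smult: "\<And>c x. x \<in> S \<Longrightarrow> nrm (smult c x) = cmod c * nrm x"
begin

definition complex_subspace :: "'a set \<Rightarrow> bool" where
  "complex_subspace T \<longleftrightarrow> subspace T \<and> (\<forall>c. \<forall>x\<in>T. smult c x \<in> T)"

lemma smult_diff: "x \<in> S \<Longrightarrow> y \<in> S \<Longrightarrow> smult c (x - y) = smult c x - smult c y"
  using smult_add[of "x - y" y c] diff_in[of x y] by simp

lemma complex_subspace_nrm_closure:
  assumes T: "complex_subspace T" "T \<subseteq> S"
  shows "complex_subspace (nrm_closure T)"
  unfolding complex_subspace_def
proof (intro conjI allI ballI)
  show "subspace (nrm_closure T)" using T by (intro subspace_nrm_closure) (auto simp: complex_subspace_def)
  fix c x assume x: "x \<in> nrm_closure T"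
  then have x_in_S: "x \<in> S" by (simp add: nrm_closure_def)
  show "smult c x \<in> nrm_closure T"
  proof (rule nrm_closure_scaled_map[where f = "smult c", OF T(2) _ x smult_in[OF x_in_S]])
    show "nrm (smult c y - smult c x) = cmod c * nrm (y - x)" if "y \<in> T" for y
      using that T(2) x_in_S nrm_smult[OF diff_in[of y x], of c] by (simp add: subset_iff smult_diff)
  qed (use T(1) in \<open>simp add: complex_subspace_def\<close>)
qed

lemma complex_semi_inner_subspace:
  assumes "complex_subspace T" "T \<subseteq> S"
  shows "complex_semi_inner T ip smult"
proof -
  interpret T: semi_inner T ip using assms by (intro semi_inner_subspace) (auto simp: complex_subspace_def)
  show ?thesis
    using assms by unfold_locales (auto simp: complex_subspace_def subset_iff smult_of_real smult_add nrm_smult)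
qed

end

locale bounded_sesquilinear = complex_semi_inner +
  fixes B :: "'a \<Rightarrow> 'a \<Rightarrow> complex" and K :: real
  assumes add_left: "\<And>x y z. x \<in> S \<Longrightarrow> y \<in> S \<Longrightarrow> z \<in> S \<Longrightarrow> B (x + y) z = B x z + B y z"
    and smult_left: "\<And>c x y. x \<in> S \<Longrightarrow> y \<in> S \<Longrightarrow> B (smult c x) y = c * B x y"
    and add_right: "\<And>x y z. x \<in> S \<Longrightarrow> y \<in> S \<Longrightarrow> z \<in> S \<Longrightarrow> B x (y + z) = B x y + B x z"
    and smult_right: "\<And>c x y. x \<in> S \<Longrightarrow> y \<in> S \<Longrightarrow> B x (smult c y) = cnj c * B x y"
    and bounded: "\<And>x y. x \<in> S \<Longrightarrow> y \<in> S \<Longrightarrow> cmod (B x y) \<le> K * (nrm x * nrm y)"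
    and bound_nonneg: "0 \<le> K"
begin

lemma diff_left: "x \<in> S \<Longrightarrow> y \<in> S \<Longrightarrow> z \<in> S \<Longrightarrow> B (x - y) z = B x z - B y z"
  using add_left[of "x - y" y z] diff_in[of x y] by simp

lemma diff_right: "x \<in> S \<Longrightarrow> y \<in> S \<Longrightarrow> z \<in> S \<Longrightarrow> B x (y - z) = B x y - B x z"
  using add_right[of x "y - z" z] diff_in[of y z] by simp

lemma scaleR_left: "x \<in> S \<Longrightarrow> y \<in> S \<Longrightarrow> B (r *\<^sub>R x) y = of_real r * B x y"
  by (simp add: smult_left flip: smult_of_real)

lemma scaleR_right: "x \<in> S \<Longrightarrow> y \<in> S \<Longrightarrow> B x (r *\<^sub>R y) = of_real r * B x y"
  by (simp add: smult_right flip: smult_of_real)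

lemma null_left: "x \<in> S \<Longrightarrow> y \<in> S \<Longrightarrow> nrm x = 0 \<Longrightarrow> B x y = 0"
  using bounded[of x y] by simp

lemma null_right: "x \<in> S \<Longrightarrow> y \<in> S \<Longrightarrow> nrm y = 0 \<Longrightarrow> B x y = 0"
  using bounded[of x y] by simp

lemma nrm_lim_left:
  assumes s: "\<And>n. s n \<in> S" and x: "x \<in> S" and y: "y \<in> S" and lim: "nrm_lim s x"
  shows "(\<lambda>n. B (s n) y) \<longlonglongrightarrow> B x y"
proof (rule LIM_zero_cancel, rule Lim_null_comparison)
  show "\<forall>\<^sub>F n in sequentially. norm (B (s n) y - B x y) \<le> K * (nrm (s n - x) * nrm y)"
    using bounded[OF diff_in[OF s x] y] by (simp add: diff_left s x y)
  show "(\<lambda>n. K * (nrm (s n - x) * nrm y)) \<longlonglongrightarrow> 0"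
    using tendsto_mult_right_zero[OF tendsto_mult_left_zero[OF lim[unfolded nrm_lim_def]]] .
qed

lemma tendsto_0_on_closure:
  assumes T: "T \<subseteq> S" and w: "w \<in> nrm_closure T" and s: "\<And>n::nat. s n \<in> S" and R: "\<And>n. nrm (s n) \<le> R"
    and lim: "\<And>y. y \<in> T \<Longrightarrow> (\<lambda>n. B (s n) y) \<longlonglongrightarrow> 0"
  shows "(\<lambda>n. B (s n) w) \<longlonglongrightarrow> 0"
proof (rule LIMSEQ_I)
  fix e :: real assume e: "0 < e"
  have w_in_S: "w \<in> S" using w by (simp add: nrm_closure_def)
  have R_nonneg: "0 \<le> R" using order_trans[OF nrm_nonneg[OF s] R[of 0]] .
  define d where "d = e / (2 * (K * R + 1))"
  have denominator_pos: "0 < 2 * (K * R + 1)" using bound_nonneg R_nonneg by (simp add: add_nonneg_pos)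
  then have d: "0 < d" "d * (2 * (K * R + 1)) = e" using e by (simp_all add: d_def)
  obtain y where y: "y \<in> T" "nrm (y - w) < d" using nrm_closureD[OF w d(1)] by blast
  have y_in_S: "y \<in> S" using y(1) T by blast
  obtain N where N: "\<And>n. n \<ge> N \<Longrightarrow> cmod (B (s n) y) < e / 2"
    using LIMSEQ_D[OF lim[OF y(1)] half_gt_zero[OF e]] by auto
  have "norm (B (s n) w - 0) < e" if "n \<ge> N" for n
  proof -
    have "cmod (B (s n) (y - w)) \<le> K * (R * d)"
      using y(2) R_nonneg bound_nonneg
      by (intro order_trans[OF bounded[OF s diff_in[OF y_in_S w_in_S]]] mult_left_mono mult_mono R)
        (auto simp: diff_in y_in_S w_in_S)
    moreover have "K * (R * d) \<le> e / 2" using d by (simp add: algebra_simps)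
    moreover have "B (s n) w = B (s n) y - B (s n) (y - w)" by (simp add: diff_right s y_in_S w_in_S)
    ultimately show ?thesis using N[OF that] norm_triangle_ineq4[of "B (s n) y" "B (s n) (y - w)"] by simp
  qed
  then show "\<exists>N. \<forall>n\<ge>N. norm (B (s n) w - 0) < e" by blast
qed

lemma adjoint_form: "bounded_sesquilinear S ip smult (\<lambda>x y. cnj (B y x)) K"
proof unfold_locales
  show "cmod (cnj (B y x)) \<le> K * (nrm x * nrm y)" if "x \<in> S" "y \<in> S" for x y
    using bounded[OF that(2,1)] by (simp add: mult.commute)
qed (simp_all add: add_left add_right smult_left smult_right bound_nonneg)

lemma bounded_sesquilinear_subspace:
  assumes "complex_subspace T" "T \<subseteq> S"
  shows "bounded_sesquilinear T ip smult B K"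
proof -
  interpret T: complex_semi_inner T ip smult by (rule complex_semi_inner_subspace[OF assms])
  show ?thesis
    using assms(2)
    by unfold_locales (auto simp: subset_iff add_left add_right smult_left smult_right bounded bound_nonneg)
qed

end

locale coercive_sesquilinear = bounded_sesquilinear + semi_hilbert +
  fixes c :: real
  assumes c_pos: "0 < c"
    and coercive: "\<And>x. x \<in> S \<Longrightarrow> c * (nrm x)\<^sup>2 \<le> Re (B x x)"
begin

lemma nrm_eq_0_if_diagonal: "x \<in> S \<Longrightarrow> Re (B x x) = 0 \<Longrightarrow> nrm x = 0"
  using coercive[of x] c_pos by (simp add: mult_le_0_iff)

definition representing_range :: "'a set" where
  "representing_range = {z \<in> S. \<exists>x\<in>S. \<forall>y\<in>S. ip z y = Re (B x y)}"

lemma representing_range_subset: "representing_range \<subseteq> S"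
  by (auto simp: representing_range_def)

lemma representing_range_onto: "x \<in> S \<Longrightarrow> \<exists>z\<in>representing_range. \<forall>y\<in>S. ip z y = Re (B x y)"
proof -
  assume x: "x \<in> S"
  interpret Bx: bounded_functional S ip "\<lambda>y. Re (B x y)" "K * nrm x"
  proof unfold_locales
    show "\<bar>Re (B x y)\<bar> \<le> K * nrm x * nrm y" if "y \<in> S" for y
      using bounded[OF x that] abs_Re_le_cmod[of "B x y"] by (simp add: mult.assoc)
  qed (simp_all add: x add_right scaleR_right)
  from Bx.riesz_representation x show ?thesis by (auto simp: representing_range_def)
qed

lemma subspace_representing_range: "subspace representing_range"
  unfolding subspace_def
proof (intro conjI ballI allI)
  show "0 \<in> representing_range"
    using scaleR_left[OF zero_in, of _ 0] ip_scaleR_left[OF zero_in, of _ 0] zero_in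
    by (auto simp: representing_range_def intro!: bexI[of _ 0])
next
  fix z z' assume "z \<in> representing_range" "z' \<in> representing_range"
  then obtain x x' where "x \<in> S" "x' \<in> S" "\<forall>y\<in>S. ip (z + z') y = Re (B (x + x') y)" "z + z' \<in> S"
    by (auto simp: representing_range_def ip_add_left add_left add_in)
  then show "z + z' \<in> representing_range" by (auto simp: representing_range_def intro: add_in)
next
  fix r z assume "z \<in> representing_range"
  then obtain x where "x \<in> S" "\<forall>y\<in>S. ip (r *\<^sub>R z) y = Re (B (r *\<^sub>R x) y)" "r *\<^sub>R z \<in> S"
    by (auto simp: representing_range_def ip_scaleR_left scaleR_left scaleR_in)
  then show "r *\<^sub>R z \<in> representing_range" by (auto simp: representing_range_def intro: scaleR_in)
qed

lemma representing_range_bounded_below: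
  assumes x: "x \<in> S" and z: "z \<in> S" and rep: "\<And>y. y \<in> S \<Longrightarrow> ip z y = Re (B x y)"
  shows "c * nrm x \<le> nrm z"
proof -
  have "c * nrm x * nrm x \<le> nrm z * nrm x"
    using coercive[OF x] cauchy_schwarz[OF z x] rep[OF x] by (simp add: power2_eq_square mult.assoc)
  then show ?thesis using x z by (cases "nrm x = 0") (auto simp: mult_le_cancel_right less_le)
qed

lemma semi_hilbert_representing_range: "semi_hilbert representing_range ip"
proof (rule semi_hilbert_closed_subspace[OF subspace_representing_range representing_range_subset])
  fix s z assume s_in_range: "\<And>n. s n \<in> representing_range" and z: "z \<in> S" and lim: "nrm_lim s z"
  have s: "s n \<in> S" for n using s_in_range representing_range_subset by blast
  have "\<exists>x\<in>S. \<forall>y\<in>S. ip (s n) y = Re (B x y)" for n using s_in_range[of n] by (simp add: representing_range_def)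
  then obtain x where x: "\<And>n. x n \<in> S" and rep: "\<And>n y. y \<in> S \<Longrightarrow> ip (s n) y = Re (B (x n) y)" by metis
  have contract: "c * nrm (x m - x n) \<le> nrm (s m - s n)" for m n
    by (rule representing_range_bounded_below) (simp_all add: diff_in x s ip_diff_left diff_left rep)
  have "nrm_Cauchy x"
    unfolding nrm_Cauchy_def
  proof (intro allI impI)
    fix e :: real assume "e > 0"
    then have "c * e > 0" using c_pos by simp
    then obtain N where N: "\<forall>m\<ge>N. \<forall>n\<ge>N. nrm (s m - s n) < c * e"
      using nrm_lim_imp_nrm_Cauchy[OF s z lim] unfolding nrm_Cauchy_def by blast
    have "nrm (x m - x n) < e" if "m \<ge> N" "n \<ge> N" for m n
      using le_less_trans[OF contract N[rule_format, OF that]] c_pos by simp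
    then show "\<exists>N. \<forall>m\<ge>N. \<forall>n\<ge>N. nrm (x m - x n) < e" by blast
  qed
  then obtain x0 where x0: "x0 \<in> S" "nrm_lim x x0" using complete x by blast
  have "ip z y = Re (B x0 y)" if y: "y \<in> S" for y
    using nrm_lim_ip[OF s z y lim] tendsto_Re[OF nrm_lim_left[OF x x0(1) y x0(2)]]
    by (simp add: rep[OF y] LIMSEQ_unique)
  then show "z \<in> representing_range" using z x0(1) by (auto simp: representing_range_def)
qed

text \<open>The component \<open>x\<close> of \<open>z\<close> orthogonal to the closed range satisfies \<open>Re (B x x) = 0\<close>.\<close>

lemma representing_range_exhausts:
  assumes z: "z \<in> S"
  shows "\<exists>x\<in>S. \<forall>y\<in>S. Re (B x y) = ip z y"
proof -
  interpret range: semi_hilbert representing_range ip by (rule semi_hilbert_representing_range)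
  interpret projection: bounded_functional representing_range ip "ip z" "nrm z"
    by unfold_locales
      (use representing_range_subset z in \<open>auto simp: subset_iff ip_add_right ip_scaleR_right cauchy_schwarz\<close>)
  obtain z' where z': "z' \<in> representing_range" and proj: "\<And>y. y \<in> representing_range \<Longrightarrow> ip z' y = ip z y"
    using projection.riesz_representation by blast
  have z'_in_S: "z' \<in> S" using z' representing_range_subset by blast
  define x where "x = z - z'"
  have x: "x \<in> S" by (simp add: x_def diff_in z z'_in_S)
  obtain t where t: "t \<in> representing_range" "\<And>y. y \<in> S \<Longrightarrow> ip t y = Re (B x y)"
    using representing_range_onto[OF x] by blast
  have "Re (B x x) = ip x t" using t x representing_range_subset ip_commute[of t x] by auto
  also have "\<dots> = 0" using proj[OF t(1)] t(1) representing_range_subset z z'_in_S by (auto simp: x_def ip_diff_left)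
  finally have "nrm x = 0" by (rule nrm_eq_0_if_diagonal[OF x])
  then have "ip z y = ip z' y" if "y \<in> S" for y
    using ip_eq_0_if_nrm_eq_0[OF x that] by (simp add: x_def ip_diff_left that z z'_in_S)
  moreover obtain x' where "x' \<in> S" "\<forall>y\<in>S. ip z' y = Re (B x' y)"
    using z' by (auto simp: representing_range_def)
  ultimately show ?thesis by auto
qed

theorem lax_milgram:
  assumes F_add: "\<And>x y. x \<in> S \<Longrightarrow> y \<in> S \<Longrightarrow> F (x + y) = F x + F y"
    and F_smult: "\<And>c x. x \<in> S \<Longrightarrow> F (smult c x) = cnj c * F x"
    and F_bounded: "\<And>x. x \<in> S \<Longrightarrow> cmod (F x) \<le> L * nrm x"
  shows "\<exists>x\<in>S. \<forall>y\<in>S. B x y = F y"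
proof -
  interpret ReF: bounded_functional S ip "\<lambda>y. Re (F y)" L
  proof unfold_locales
    show "Re (F (r *\<^sub>R x)) = r * Re (F x)" if "x \<in> S" for r x
      using F_smult[OF that, of "of_real r"] by (simp add: smult_of_real that)
    show "\<bar>Re (F x)\<bar> \<le> L * nrm x" if "x \<in> S" for x
      using F_bounded[OF that] abs_Re_le_cmod[of "F x"] by simp
  qed (simp add: F_add)
  obtain z where "z \<in> S" "\<forall>y\<in>S. ip z y = Re (F y)" using ReF.riesz_representation by blast
  then obtain x where x: "x \<in> S" and re: "\<And>y. y \<in> S \<Longrightarrow> Re (B x y) = Re (F y)"
    using representing_range_exhausts by metis
  have "B x y = F y" if y: "y \<in> S" for y
    using re[OF y] re[OF smult_in[OF y, of \<i>]] by (simp add: complex_eq_iff smult_right F_smult x y)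
  then show ?thesis using x by blast
qed

lemma coercive_sesquilinear_adjoint: "coercive_sesquilinear S ip smult (\<lambda>x y. cnj (B y x)) K c"
proof -
  interpret adjoint: bounded_sesquilinear S ip smult "\<lambda>x y. cnj (B y x)" K by (rule adjoint_form)
  show ?thesis by unfold_locales (use c_pos coercive in auto)
qed

corollary lax_milgram_adjoint:
  assumes F_add: "\<And>x y. x \<in> S \<Longrightarrow> y \<in> S \<Longrightarrow> F (x + y) = F x + F y"
    and F_smult: "\<And>c x. x \<in> S \<Longrightarrow> F (smult c x) = c * F x"
    and F_bounded: "\<And>x. x \<in> S \<Longrightarrow> cmod (F x) \<le> L * nrm x"
  shows "\<exists>x\<in>S. \<forall>y\<in>S. B y x = F y"
proof -
  interpret adjoint: coercive_sesquilinear S ip smult "\<lambda>x y. cnj (B y x)" K c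
    by (rule coercive_sesquilinear_adjoint)
  have "\<exists>x\<in>S. \<forall>y\<in>S. cnj (B y x) = cnj (F y)"
    by (rule adjoint.lax_milgram[where L = L]) (simp_all add: F_add F_smult F_bounded)
  then show ?thesis by simp
qed

lemma coercive_sesquilinear_closed_subspace:
  assumes T: "complex_subspace T" "T \<subseteq> S" and hilbert: "semi_hilbert T ip"
  shows "coercive_sesquilinear T ip smult B K c"
proof -
  interpret T: semi_hilbert T ip by (rule hilbert)
  interpret T: bounded_sesquilinear T ip smult B K by (rule bounded_sesquilinear_subspace[OF T])
  show ?thesis by unfold_locales (use T(2) c_pos coercive in auto)
qed

lemma dense_if_annihilator_null:
  assumes T: "complex_subspace T" "T \<subseteq> S"
    and null: "\<And>w. w \<in> S \<Longrightarrow> (\<And>y. y \<in> T \<Longrightarrow> B y w = 0) \<Longrightarrow> nrm w = 0"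
  shows "S \<subseteq> nrm_closure T"
proof
  fix u assume u: "u \<in> S"
  have closure_subset: "nrm_closure T \<subseteq> S" by (auto simp: nrm_closure_def)
  interpret closure: coercive_sesquilinear "nrm_closure T" ip smult B K c
    by (intro coercive_sesquilinear_closed_subspace complex_subspace_nrm_closure semi_hilbert_nrm_closure closure_subset T)
      (use T in \<open>simp add: complex_subspace_def\<close>)
  have "\<exists>w\<in>nrm_closure T. \<forall>y\<in>nrm_closure T. B y w = B y u"
    by (rule closure.lax_milgram_adjoint[where L = "K * nrm u"])
      (use closure_subset u bounded in \<open>auto simp: subset_iff add_left smult_left mult_ac\<close>)
  then obtain w where w: "w \<in> nrm_closure T" "\<And>y. y \<in> T \<Longrightarrow> B y w = B y u"
    using subset_nrm_closure[OF T(2)] by blast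
  have "nrm (w - u) = 0"
    using w closure_subset u T(2) by (intro null diff_in) (auto simp: subset_iff diff_right)
  then show "u \<in> nrm_closure T" using w(1) by (intro nrm_closureI_approx[OF T(2) u] bexI[of _ w]) auto
qed

end

section \<open>Complex vectors and matrices\<close>

lemma cdot_add_left: "cdot (x + y) z = cdot x z + cdot y z"
  by (simp add: cdot_def sum.distrib algebra_simps)

lemma cdot_add_right: "cdot x (y + z) = cdot x y + cdot x z"
  by (simp add: cdot_def sum.distrib algebra_simps)

lemma cdot_diff_left: "cdot (x - y) z = cdot x z - cdot y z"
  by (simp add: cdot_def sum_subtractf algebra_simps)

lemma cdot_zero [simp]: "cdot 0 x = 0" "cdot x 0 = 0"
  by (simp_all add: cdot_def)

lemma cdot_smult_left: "cdot (c *s x) y = c * cdot x y"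
  by (simp add: cdot_def sum_distrib_left mult.assoc)

lemma cdot_smult_right: "cdot x (c *s y) = cnj c * cdot x y"
  by (simp add: cdot_def sum_distrib_left algebra_simps)

lemma cnj_cdot: "cnj (cdot x y) = cdot y x"
  by (simp add: cdot_def mult.commute)

lemma Re_cdot: "Re (cdot x y) = x \<bullet> y"
  by (simp add: cdot_def inner_vec_def inner_complex_def)

lemma cdot_self: "cdot x x = of_real ((norm x)\<^sup>2)"
proof (rule complex_eqI)
  show "Re (cdot x x) = Re (of_real ((norm x)\<^sup>2))"
    by (simp add: Re_cdot power2_norm_eq_inner)
  have "cnj (cdot x x) = cdot x x" by (rule cnj_cdot)
  then have "Im (cdot x x) = 0" by (metis complex_cnj_cancel_iff cnj.simps(2) neg_equal_zero)
  then show "Im (cdot x x) = Im (of_real ((norm x)\<^sup>2))" by simp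
qed

lemma norm_smult_vec: "norm (c *s (x :: complex^'n)) = cmod c * norm x"
proof -
  have "complex_of_real ((norm (c *s x))\<^sup>2) = of_real ((cmod c * norm x)\<^sup>2)"
    by (simp only: cdot_self [symmetric] cdot_smult_left cdot_smult_right)
       (simp add: cdot_self power_mult_distrib complex_norm_square mult.assoc del: of_real_power)
  then have "(norm (c *s x))\<^sup>2 = (cmod c * norm x)\<^sup>2" by (simp only: of_real_eq_iff)
  then show ?thesis by (simp add: power2_eq_iff_nonneg)
qed

lemma norm_cdot_le: "cmod (cdot x y) \<le> norm x * norm y"
proof -
  let ?c = "cdot x y"
  have "(cmod ?c)\<^sup>2 = Re (cdot x (?c *s y))"
    using cmod_power2[of ?c] by (simp add: cdot_smult_right power2_eq_square)
  also have "\<dots> \<le> norm x * norm (?c *s y)"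
    by (simp add: Re_cdot norm_cauchy_schwarz)
  also have "\<dots> = cmod ?c * (norm x * norm y)" by (simp add: norm_smult_vec)
  finally show ?thesis
    by (cases "cmod ?c = 0") (auto simp: power2_eq_square)
qed

lemma cstar_eq_cdot: "cstar X \<zeta> = cdot \<zeta> X"
  by (simp add: cstar_def cdot_def mult.commute)

lemma cdot_adj: "cdot (M *v x) y = cdot x (adj M *v y)"
proof -
  have "cdot (M *v x) y = (\<Sum>i\<in>UNIV. \<Sum>j\<in>UNIV. M$i$j * x$j * cnj (y$i))"
    by (simp add: cdot_def matrix_vector_mult_def sum_distrib_right)
  also have "\<dots> = (\<Sum>j\<in>UNIV. \<Sum>i\<in>UNIV. M$i$j * x$j * cnj (y$i))" by (rule sum.swap)
  also have "\<dots> = cdot x (adj M *v y)"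
    by (simp add: cdot_def matrix_vector_mult_def adj_def sum_distrib_left algebra_simps)
  finally show ?thesis .
qed

lemma adj_adj [simp]: "adj (adj M) = M"
  by (simp add: adj_def vec_eq_iff)

lemma adj_mult: "adj (M ** N) = adj N ** adj M"
  by (simp add: adj_def matrix_matrix_mult_def vec_eq_iff mult.commute)

lemma adj_diff: "adj (M - N) = adj M - adj N"
  by (simp add: adj_def vec_eq_iff)

lemma adj_cscale: "adj (cscale c M) = cscale (cnj c) (adj M)"
  by (simp add: adj_def cscale_def vec_eq_iff)

lemma adj_mat1 [simp]: "adj (mat 1) = mat 1"
  by (auto simp: adj_def mat_def vec_eq_iff)

lemma cdot_adj_left: "cdot (adj M *v x) y = cdot x (M *v y)"
  by (simp add: cdot_adj)

lemma cdot_factored: "cdot ((adj T ** N ** T) *v \<xi>) \<eta> = cdot (N *v (T *v \<xi>)) (T *v \<eta>)"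
  by (simp add: cdot_adj_left flip: matrix_vector_mul_assoc)

lemma vconj_vconj [simp]: "vconj (vconj \<xi>) = \<xi>"
  by (simp add: vconj_def vec_eq_iff)

lemma cdot_hermitian: "hermitian M \<Longrightarrow> cdot (M *v x) y = cdot x (M *v y)"
  by (simp add: cdot_adj hermitian_def)

lemma cscale_mult_vec: "cscale c M *v x = c *s (M *v x)"
  by (simp add: cscale_def matrix_vector_mult_def vec_eq_iff sum_distrib_left mult.assoc)

lemma scaleR_eq_smult: "r *\<^sub>R (x :: complex^'n) = complex_of_real r *s x"
  by (simp add: vec_eq_iff scaleR_conv_of_real[where 'a=complex])

lemma mult_vec_scaleR: "(M :: complex^'n^'m) *v (r *\<^sub>R x) = r *\<^sub>R (M *v x)"
  by (simp add: scaleR_eq_smult vector_scalar_commute)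

lemma mult_vec_axis: "((M :: complex^'n^'m) *v axis j 1) $ i = M $ i $ j"
proof -
  have "(M *v axis j 1) $ i = (\<Sum>k\<in>UNIV. if k = j then M $ i $ k else 0)"
    unfolding matrix_vector_mult_def vec_lambda_beta by (rule sum.cong) (auto simp: axis_def)
  then show ?thesis by simp
qed

lemma norm_mult_vec_le: "norm ((M :: complex^'n^'m) *v x) \<le> norm M * norm x"
proof -
  have "norm ((M *v x) $ i) \<le> norm (M $ i) * norm x" for i
  proof -
    have "(M *v x) $ i = cdot (M $ i) (vconj x)"
      by (simp add: matrix_vector_mult_def cdot_def vconj_def)
    moreover have "norm (vconj x) = norm x"
      by (simp add: norm_vec_def vconj_def)
    ultimately show ?thesis using norm_cdot_le[of "M $ i" "vconj x"] by simp
  qed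
  then have "norm (M *v x) \<le> L2_set (\<lambda>i. norm (M $ i) * norm x) UNIV"
    by (auto simp: norm_vec_def intro: L2_set_mono)
  also have "\<dots> = norm M * norm x"
    by (simp add: norm_vec_def L2_set_left_distrib)
  finally show ?thesis .
qed

lemma norm_adj_mult_vec_le:
  assumes "\<And>y. norm (M *v y) \<le> c * norm y"
  shows "norm (adj M *v x) \<le> c * norm x"
proof -
  have "(norm (adj M *v x))\<^sup>2 = Re (cdot (M *v (adj M *v x)) x)"
    using cdot_self[of "adj M *v x"] cdot_adj[of M "adj M *v x" x] by simp
  also have "\<dots> \<le> norm (M *v (adj M *v x)) * norm x" by (simp add: Re_cdot norm_cauchy_schwarz)
  also have "\<dots> \<le> (c * norm (adj M *v x)) * norm x" by (intro mult_right_mono assms) simp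
  finally have "norm (adj M *v x) * norm (adj M *v x) \<le> norm (adj M *v x) * (c * norm x)"
    by (simp add: power2_eq_square mult_ac)
  moreover have "0 \<le> c" using order_trans[OF norm_ge_zero assms[of "axis undefined 1"]] by simp
  then have "0 \<le> c * norm x" by simp
  ultimately show ?thesis by (cases "norm (adj M *v x) = 0") (auto simp: mult_le_cancel_left)
qed

lemma matrix_inv_cancel:
  fixes A :: "'a::semiring_1^'n^'m"
  assumes "invertible A"
  shows "A ** matrix_inv A = mat 1" "matrix_inv A ** A = mat 1"
  using someI_ex[OF assms[unfolded invertible_def]] by (simp_all add: matrix_inv_def)

lemma hermitian_Im_0: "hermitian M \<Longrightarrow> Im (cdot (M *v x) x) = 0"
  by (metis cdot_hermitian cnj_cdot cnj.simps(2) neg_equal_zero)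

lemma matrix_eqI_spanning:
  fixes A B :: "complex^'n^'m"
  assumes span: "vec.span E = UNIV" and eq: "\<And>e. e \<in> E \<Longrightarrow> A *v e = B *v e"
  shows "A = B"
proof -
  have "vec.span E \<subseteq> {x. A *v x = B *v x}"
    by (rule vec.span_minimal)
      (auto simp: eq vec.subspace_def matrix_vector_right_distrib vector_scalar_commute)
  then show ?thesis by (auto simp: span matrix_eq)
qed

lemma cdot_eq_0_spanning:
  assumes span: "vec.span E = UNIV" and orth: "\<And>e. e \<in> E \<Longrightarrow> cdot x e = 0"
  shows "x = 0"
proof -
  have "vec.span E \<subseteq> {y. cdot x y = 0}"
    by (rule vec.span_minimal) (auto simp: orth vec.subspace_def cdot_add_right cdot_smult_right)
  then have "cdot x x = 0" by (auto simp: span)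
  then show ?thesis by (simp add: cdot_self)
qed

lemma hermitianI_spanning:
  assumes span: "vec.span E = UNIV" and sym: "\<And>e f. e \<in> E \<Longrightarrow> f \<in> E \<Longrightarrow> cdot (A *v e) f = cdot e (A *v f)"
  shows "hermitian A"
  unfolding hermitian_def
proof (rule matrix_eqI_spanning[OF span])
  fix e assume e: "e \<in> E"
  have "adj A *v e - A *v e = 0"
    by (rule cdot_eq_0_spanning[OF span]) (simp add: cdot_diff_left cdot_adj[of "adj A"] sym[OF e])
  then show "adj A *v e = A *v e" by simp
qed

section \<open>Square roots of positive semidefinite matrices\<close>

lemma hermitian_semidefinite_kernel:
  assumes G: "hermitian G" and S: "subspace S" "\<And>x. x \<in> S \<Longrightarrow> G *v x \<in> S"
    and pos: "\<And>x. x \<in> S \<Longrightarrow> 0 \<le> Re (cdot (G *v x) x)"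
    and v: "v \<in> S" "Re (cdot (G *v v) v) = 0"
  shows "G *v v = 0"
proof -
  have "(G *v x) \<bullet> y = (G *v y) \<bullet> x" for x y
    using cdot_hermitian[OF G, of x y] by (metis Re_cdot inner_commute)
  then interpret semi_inner S "\<lambda>x y. (G *v x) \<bullet> y"
    using S(1) pos
    by unfold_locales (simp_all add: Re_cdot matrix_vector_right_distrib mult_vec_scaleR inner_add_left)
  have "nrm v = 0" using v(2) by (simp add: nrm_def Re_cdot)
  then show ?thesis using ip_eq_0_if_nrm_eq_0[OF v(1) S(2)[OF v(1)]] by simp
qed

definition real_eigenvectors :: "complex^'n^'n \<Rightarrow> (complex^'n) set" where
  "real_eigenvectors H = {v. \<exists>l. H *v v = complex_of_real l *s v}"

lemma rayleigh_quotient_maximum: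
  fixes H :: "complex^'n^'n"
  assumes S: "subspace S" and x0: "x0 \<in> S" "x0 \<noteq> 0"
  obtains v where "v \<in> S" "norm v = 1" "\<And>x. x \<in> S \<Longrightarrow> (H *v x) \<bullet> x \<le> ((H *v v) \<bullet> v) * (norm x)\<^sup>2"
proof -
  let ?K = "S \<inter> sphere 0 1"
  have "compact ?K" using closed_subspace[OF S] by (simp add: closed_Int_compact)
  moreover have "(1 / norm x0) *\<^sub>R x0 \<in> ?K" using x0 by (simp add: subspace_scale[OF S])
  moreover have "linear (\<lambda>x. H *v x)"
    by (rule linearI) (simp_all add: matrix_vector_right_distrib mult_vec_scaleR)
  then have "continuous_on ?K (\<lambda>x. (H *v x) \<bullet> x)"
    by (intro continuous_intros linear_continuous_on linear_conv_bounded_linear[THEN iffD1])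
  ultimately have "\<exists>v\<in>?K. \<forall>x\<in>?K. (H *v x) \<bullet> x \<le> (H *v v) \<bullet> v"
    by (intro continuous_attains_sup) auto
  then obtain v where v: "v \<in> S" "norm v = 1" and max: "\<And>x. x \<in> ?K \<Longrightarrow> (H *v x) \<bullet> x \<le> (H *v v) \<bullet> v"
    by auto
  have "(H *v x) \<bullet> x \<le> ((H *v v) \<bullet> v) * (norm x)\<^sup>2" if x: "x \<in> S" for x
  proof (cases "x = 0")
    case False
    define y where "y = (1 / norm x) *\<^sub>R x"
    have "y \<in> ?K" using x False subspace_scale[OF S] by (simp add: y_def)
    from max[OF this] show ?thesis
      using False by (simp add: y_def mult_vec_scaleR field_simps power2_eq_square)
  qed simp
  with v show thesis by (rule that)
qed

lemma hermitian_eigenvector_exists: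
  assumes H: "hermitian H" and S: "subspace S" "\<And>x. x \<in> S \<Longrightarrow> H *v x \<in> S" and x0: "x0 \<in> S" "x0 \<noteq> 0"
  shows "\<exists>v \<in> S \<inter> real_eigenvectors H. v \<noteq> 0"
proof -
  obtain v where v: "v \<in> S" "norm v = 1"
    and max: "\<And>x. x \<in> S \<Longrightarrow> (H *v x) \<bullet> x \<le> ((H *v v) \<bullet> v) * (norm x)\<^sup>2"
    by (rule rayleigh_quotient_maximum[OF S(1) x0]) blast
  define m where "m = (H *v v) \<bullet> v"
  define G where "G = cscale (of_real m) (mat 1) - H"
  have G_vec: "G *v x = m *\<^sub>R x - H *v x" for x
    by (simp add: G_def matrix_vector_mult_diff_rdistrib cscale_mult_vec scaleR_eq_smult)
  have "G *v v = 0"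
  proof (rule hermitian_semidefinite_kernel)
    show "hermitian G" using H by (simp add: G_def hermitian_def adj_diff adj_cscale)
    show "G *v x \<in> S" if "x \<in> S" for x
      unfolding G_vec using that by (intro subspace_diff subspace_scale S)
    show "0 \<le> Re (cdot (G *v x) x)" if x: "x \<in> S" for x
      using max[OF x] by (simp add: Re_cdot G_vec inner_diff_left power2_norm_eq_inner m_def)
    show "Re (cdot (G *v v) v) = 0"
      using v(2) by (simp add: Re_cdot G_vec m_def inner_diff_left flip: power2_norm_eq_inner)
  qed (use S v in auto)
  then have "H *v v = complex_of_real m *s v" by (simp add: G_vec scaleR_eq_smult)
  then have "v \<in> real_eigenvectors H" by (auto simp: real_eigenvectors_def)
  then show ?thesis using v by (intro bexI[of _ v]) auto
qed

lemma cdot_eq_0_if_orthogonal: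
  assumes "orthogonal z v" "orthogonal z (\<i> *s v)"
  shows "cdot z v = 0"
proof -
  have "Re (cdot z v) = 0" "Re (cdot z (\<i> *s v)) = 0" using assms by (simp_all add: Re_cdot orthogonal_def)
  then show ?thesis by (simp add: complex_eq_iff cdot_smult_right)
qed

lemma hermitian_span_real_eigenvectors:
  fixes H :: "complex^'n^'n"
  assumes H: "hermitian H"
  shows "vec.span (real_eigenvectors H) = UNIV"
proof -
  define S where "S = {x. \<forall>v\<in>real_eigenvectors H. cdot x v = 0}"
  have "subspace S" by (auto simp: S_def subspace_def cdot_add_left scaleR_eq_smult cdot_smult_left)
  moreover have "H *v x \<in> S" if "x \<in> S" for x
    using that by (auto simp: S_def real_eigenvectors_def cdot_hermitian[OF H] cdot_smult_right)
  ultimately have S_trivial: "x = 0" if "x \<in> S" for x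
    using hermitian_eigenvector_exists[OF H _ _ that] by (fastforce simp: S_def cdot_self)
  have span: "span (vec.span (real_eigenvectors H)) = vec.span (real_eigenvectors H)"
    by (rule span_eq_iff[THEN iffD2])
      (simp add: subspace_def scaleR_eq_smult vec.span_zero vec.span_add vec.span_scale)
  have "x \<in> vec.span (real_eigenvectors H)" for x
  proof -
    obtain y z where y: "y \<in> vec.span (real_eigenvectors H)" and x: "x = y + z"
      and orth: "\<And>w. w \<in> vec.span (real_eigenvectors H) \<Longrightarrow> orthogonal z w"
      using orthogonal_subspace_decomp_exists[of "vec.span (real_eigenvectors H)" x] unfolding span by blast
    have "z \<in> S"
      using orth[OF vec.span_base] orth[OF vec.span_scale[OF vec.span_base]]
      by (auto simp: S_def intro: cdot_eq_0_if_orthogonal)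
    then have "z = 0" by (rule S_trivial)
    then show ?thesis using x y by simp
  qed
  then show ?thesis by blast
qed

lemma psd_sqrt_unique:
  fixes S T :: "complex^'n^'n"
  assumes S: "psd S" and T: "psd T" and eq: "S ** S = T ** T"
  shows "S = T"
proof (rule matrix_eqI_spanning[OF hermitian_span_real_eigenvectors])
  show "hermitian T" using T by (simp add: psd_def)
  fix v assume "v \<in> real_eigenvectors T"
  then obtain l where l: "T *v v = complex_of_real l *s v" by (auto simp: real_eigenvectors_def)
  define w where "w = S *v v - complex_of_real l *s v"
  have S_S_v: "S *v (S *v v) = complex_of_real l *s (complex_of_real l *s v)"
    by (simp add: matrix_vector_mul_assoc eq) (simp add: l vector_scalar_commute flip: matrix_vector_mul_assoc)
  have "S *v w = complex_of_real (- l) *s w"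
    by (simp add: w_def matrix_vector_mult_diff_distrib vector_scalar_commute S_S_v vector_ssub_ldistrib)
  then have "cdot (S *v w) w = complex_of_real (- l * (norm w)\<^sup>2)"
    by (simp only: cdot_smult_left cdot_self of_real_mult)
  then have "Re (cdot (S *v w) w) = - l * (norm w)\<^sup>2" by (simp only: Re_complex_of_real)
  then have "l * (norm w)\<^sup>2 \<le> 0" using S by (simp add: psd_def) (metis neg_0_le_iff_le)
  moreover have "0 \<le> l * (norm v)\<^sup>2"
    using T unfolding psd_def by (metis Re_complex_of_real cdot_self cdot_smult_left l of_real_mult)
  ultimately have "w = 0 \<or> v = 0 \<or> l = 0" by (auto simp: zero_le_mult_iff mult_le_0_iff)
  moreover have "w = 0" if "l = 0"
  proof -
    have "cdot (S *v v) (S *v v) = cdot (S *v (S *v v)) v"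
      using S by (simp add: psd_def cdot_hermitian)
    then show ?thesis by (simp add: S_S_v that w_def cdot_self)
  qed
  ultimately show "S *v v = T *v v" by (auto simp: w_def l)
qed

lemma hermitian_functional_calculus:
  fixes H :: "complex^'n^'n"
  assumes H: "hermitian H"
  obtains B l and F :: "(real \<Rightarrow> real) \<Rightarrow> complex^'n^'n"
  where "vec.span B = UNIV" "0 \<notin> B" "\<And>e. e \<in> B \<Longrightarrow> H *v e = complex_of_real (l e) *s e"
    "\<And>\<phi> e. e \<in> B \<Longrightarrow> F \<phi> *v e = complex_of_real (\<phi> (l e)) *s e" "\<And>\<phi>. hermitian (F \<phi>)"
proof -
  obtain B where B: "B \<subseteq> real_eigenvectors H" "vec.independent B" "real_eigenvectors H \<subseteq> vec.span B"
    by (rule vec.maximal_independent_subset)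
  have "vec.span (real_eigenvectors H) \<subseteq> vec.span B" by (rule vec.span_minimal[OF B(3) vec.subspace_span])
  then have span: "vec.span B = UNIV" using hermitian_span_real_eigenvectors[OF H] by blast
  have "\<forall>e\<in>B. \<exists>l. H *v e = complex_of_real l *s e" using B(1) by (auto simp: real_eigenvectors_def)
  then obtain l where l: "\<And>e. e \<in> B \<Longrightarrow> H *v e = complex_of_real (l e) *s e" by metis
  define F where "F \<phi> = matrix (vec.construct B (\<lambda>e. complex_of_real (\<phi> (l e)) *s e))" for \<phi>
  have F: "F \<phi> *v e = complex_of_real (\<phi> (l e)) *s e" if "e \<in> B" for \<phi> e
    by (simp add: F_def matrix_works[OF vec.linear_construct[OF B(2)]] vec.construct_basis[OF B(2) that])
  have herm: "hermitian (F \<phi>)" for \<phi>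
  proof (rule hermitianI_spanning[OF span])
    fix e f assume e: "e \<in> B" and f: "f \<in> B"
    have "l e = l f \<or> cdot e f = 0"
      using cdot_hermitian[OF H, of e f] by (auto simp: l e f cdot_smult_left cdot_smult_right)
    then show "cdot (F \<phi> *v e) f = cdot e (F \<phi> *v f)"
      by (auto simp: F e f cdot_smult_left cdot_smult_right)
  qed
  show thesis
  proof (rule that[OF span _ l F herm])
    show "0 \<notin> B" using B(2) vec.dependent_zero by blast
  qed
qed

lemma psd_sqrt_exists:
  fixes M :: "complex^'n^'n"
  assumes M: "psd M"
  shows "\<exists>S. psd S \<and> S ** S = M"
proof -
  have "hermitian M" using M by (simp add: psd_def)
  then obtain B l and F :: "(real \<Rightarrow> real) \<Rightarrow> complex^'n^'n" where span: "vec.span B = UNIV" and nonzero: "0 \<notin> B"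
    and l: "\<And>e. e \<in> B \<Longrightarrow> M *v e = complex_of_real (l e) *s e"
    and F: "\<And>\<phi> e. e \<in> B \<Longrightarrow> F \<phi> *v e = complex_of_real (\<phi> (l e)) *s e" and herm: "\<And>\<phi>. hermitian (F \<phi>)"
    by (rule hermitian_functional_calculus) blast
  have l_nonneg: "0 \<le> l e" if "e \<in> B" for e
  proof -
    have "0 \<le> Re (cdot (M *v e) e)" using M by (simp add: psd_def)
    then have "0 \<le> l e * (norm e)\<^sup>2" by (simp add: l that cdot_smult_left cdot_self)
    then show ?thesis using nonzero that by (auto simp: zero_le_mult_iff)
  qed
  have root: "F \<phi> ** F \<phi> = N"
    if "\<And>e. e \<in> B \<Longrightarrow> N *v e = complex_of_real ((\<phi> (l e))\<^sup>2) *s e" for \<phi> and N :: "complex^'n^'n"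
    by (rule matrix_eqI_spanning[OF span])
      (simp add: F that vector_scalar_commute power2_eq_square flip: matrix_vector_mul_assoc)
  have sq: "F sqrt ** F sqrt = M" by (rule root) (simp add: l l_nonneg)
  have "F (sqrt \<circ> sqrt) ** F (sqrt \<circ> sqrt) = F sqrt" by (rule root) (simp add: F l_nonneg)
  then have "cdot (F sqrt *v x) x = cdot (F (sqrt \<circ> sqrt) *v x) (F (sqrt \<circ> sqrt) *v x)" for x
    by (metis cdot_hermitian herm matrix_vector_mul_assoc)
  then have "psd (F sqrt)" using herm by (simp add: psd_def cdot_self)
  then show ?thesis using sq by blast
qed

lemma msqrt_unique: "psd S \<Longrightarrow> S ** S = M \<Longrightarrow> msqrt M = S"
  unfolding msqrt_def by (rule the_equality) (auto intro: psd_sqrt_unique)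

lemma msqrt:
  assumes "psd M" shows "psd (msqrt M)" "msqrt M ** msqrt M = M"
  using psd_sqrt_exists[OF assms] msqrt_unique by metis+

lemma cdot_herm_part: "cdot (herm_part M *v \<xi>) \<xi> = of_real (Re (cdot (M *v \<xi>) \<xi>))"
proof -
  have "herm_part M = cscale (1/2) (M + adj M)"
    by (simp add: herm_part_def cscale_def adj_def vec_eq_iff)
  then have "cdot (herm_part M *v \<xi>) \<xi> = (cdot (M *v \<xi>) \<xi> + cdot (adj M *v \<xi>) \<xi>) / 2"
    by (simp add: cscale_mult_vec cdot_smult_left matrix_vector_mult_add_rdistrib cdot_add_left)
  also have "cdot (adj M *v \<xi>) \<xi> = cnj (cdot (M *v \<xi>) \<xi>)"
    by (simp add: cdot_adj cnj_cdot)
  finally show ?thesis by (simp add: complex_add_cnj)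
qed

lemma msqrt_herm_part:
  assumes "\<And>\<xi>. 0 \<le> Re (cdot (M *v \<xi>) \<xi>)"
  shows "psd (herm_part M)" "hermitian (msqrt (herm_part M))"
    "(norm (msqrt (herm_part M) *v \<xi>))\<^sup>2 = Re (cdot (M *v \<xi>) \<xi>)"
proof -
  have "adj (herm_part M) = herm_part M" by (simp add: adj_def herm_part_def vec_eq_iff add.commute)
  then show is_psd: "psd (herm_part M)" using assms by (simp add: psd_def hermitian_def cdot_herm_part)
  show is_hermitian: "hermitian (msqrt (herm_part M))" using msqrt(1)[OF is_psd] by (simp add: psd_def)
  have "complex_of_real ((norm (msqrt (herm_part M) *v \<xi>))\<^sup>2)
      = cdot (msqrt (herm_part M) *v (msqrt (herm_part M) *v \<xi>)) \<xi>"
    by (simp only: cdot_self[symmetric] cdot_hermitian[OF is_hermitian])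
  also have "\<dots> = of_real (Re (cdot (M *v \<xi>) \<xi>))"
    by (simp only: matrix_vector_mul_assoc msqrt(2)[OF is_psd] cdot_herm_part)
  finally show "(norm (msqrt (herm_part M) *v \<xi>))\<^sup>2 = Re (cdot (M *v \<xi>) \<xi>)" by (simp only: of_real_eq_iff)
qed

section \<open>Square-integrable functions\<close>

definition sq_integrable :: "'a measure \<Rightarrow> ('a \<Rightarrow> 'b::euclidean_space) \<Rightarrow> bool" where
  "sq_integrable M f \<longleftrightarrow> f \<in> borel_measurable M \<and> integrable M (\<lambda>x. (norm (f x))\<^sup>2)"

definition inner_L2 :: "'a measure \<Rightarrow> ('a \<Rightarrow> 'b::euclidean_space) \<Rightarrow> ('a \<Rightarrow> 'b) \<Rightarrow> real" where
  "inner_L2 M f g = (LINT x|M. f x \<bullet> g x)"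

definition norm_L2 :: "'a measure \<Rightarrow> ('a \<Rightarrow> 'b::euclidean_space) \<Rightarrow> real" where
  "norm_L2 M f = sqrt (LINT x|M. (norm (f x))\<^sup>2)"

lemma sq_integrable_measurable: "sq_integrable M f \<Longrightarrow> f \<in> borel_measurable M"
  and sq_integrable_integrable: "sq_integrable M f \<Longrightarrow> integrable M (\<lambda>x. (norm (f x))\<^sup>2)"
  by (auto simp: sq_integrable_def)

lemma norm_L2_power2: "(norm_L2 M f)\<^sup>2 = (LINT x|M. (norm (f x))\<^sup>2)"
  by (simp add: norm_L2_def)

lemma norm_L2_nonneg [simp]: "0 \<le> norm_L2 M f"
  by (simp add: norm_L2_def)

lemma sq_integrable_inner:
  assumes f: "sq_integrable M f" and g: "sq_integrable M g"
  shows "integrable M (\<lambda>x. f x \<bullet> g x)"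
proof (rule Bochner_Integration.integrable_bound)
  show "integrable M (\<lambda>x. (norm (f x))\<^sup>2 + (norm (g x))\<^sup>2)" using f g by (simp add: sq_integrable_def)
  have "\<bar>f x \<bullet> g x\<bar> \<le> (norm (f x))\<^sup>2 + (norm (g x))\<^sup>2" for x
    using Cauchy_Schwarz_ineq2[of "f x" "g x"] sum_squares_bound[of "norm (f x)" "norm (g x)"]
      mult_nonneg_nonneg[OF norm_ge_zero norm_ge_zero, of "f x" "g x"] by linarith
  then show "AE x in M. norm (f x \<bullet> g x) \<le> norm ((norm (f x))\<^sup>2 + (norm (g x))\<^sup>2)" by simp
qed (use f g in \<open>simp add: sq_integrable_def borel_measurable_inner\<close>)

lemma sq_integrable_add:
  assumes f: "sq_integrable M f" and g: "sq_integrable M g"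
  shows "sq_integrable M (f + g)"
proof -
  have "(norm (f x + g x))\<^sup>2 = (norm (f x))\<^sup>2 + 2 * (f x \<bullet> g x) + (norm (g x))\<^sup>2" for x
    by (simp add: power2_norm_eq_inner inner_add_left inner_add_right inner_commute)
  then show ?thesis
    using f g sq_integrable_inner[OF f g]
    by (auto simp: sq_integrable_def plus_fun_def intro: borel_measurable_add)
qed

lemma sq_integrable_scaleR: "sq_integrable M f \<Longrightarrow> sq_integrable M (r *\<^sub>R f)"
  by (auto simp: sq_integrable_def scaleR_fun_def power_mult_distrib intro: borel_measurable_scaleR)

lemma sq_integrable_zero [simp]: "sq_integrable M 0" "sq_integrable M (\<lambda>x. 0)"
  by (simp_all add: sq_integrable_def zero_fun_def)

lemma semi_inner_L2: "semi_inner (Collect (sq_integrable M)) (inner_L2 M)"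
proof
  show "subspace (Collect (sq_integrable M))"
    by (simp add: subspace_def sq_integrable_add sq_integrable_scaleR)
qed (simp_all add: inner_L2_def inner_add_left scaleR_fun_def sq_integrable_inner, simp add: inner_commute)

lemma nrm_inner_L2: "semi_inner.nrm (inner_L2 M) = norm_L2 M"
  by (simp add: fun_eq_iff semi_inner.nrm_def[OF semi_inner_L2] norm_L2_def inner_L2_def power2_norm_eq_inner)

interpretation L2: semi_inner "Collect (sq_integrable M)" "inner_L2 M"
  rewrites "f \<in> Collect (sq_integrable M) \<longleftrightarrow> sq_integrable M f"
    and "semi_inner.nrm (inner_L2 M) = norm_L2 M"
  for M :: "'a measure"
  by (simp_all add: semi_inner_L2 nrm_inner_L2)

lemma sq_integrable_diff: "sq_integrable M f \<Longrightarrow> sq_integrable M g \<Longrightarrow> sq_integrable M (f - g)"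
  by (rule L2.diff_in)

lemma norm_L2_cong_AE:
  assumes "f \<in> borel_measurable M" "g \<in> borel_measurable M" "AE x in M. f x = g x"
  shows "norm_L2 M f = norm_L2 M g"
  unfolding norm_L2_def using assms by (intro arg_cong[of _ _ sqrt] integral_cong_AE) auto

lemma norm_L2_eq_0_iff: "sq_integrable M f \<Longrightarrow> norm_L2 M f = 0 \<longleftrightarrow> (AE x in M. f x = 0)"
  using integral_nonneg_eq_0_iff_AE[of M "\<lambda>x. (norm (f x))\<^sup>2"] by (simp add: norm_L2_def sq_integrable_def)

lemma nn_integral_norm_L2:
  "sq_integrable M f \<Longrightarrow> (\<integral>\<^sup>+x. ennreal ((norm (f x))\<^sup>2) \<partial>M) = ennreal ((norm_L2 M f)\<^sup>2)"
  by (simp add: norm_L2_power2 sq_integrable_def nn_integral_eq_integral)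

lemma sq_integrable_dominated:
  assumes f: "sq_integrable M f" and g: "g \<in> borel_measurable M" and c_nonneg: "0 \<le> c"
    and bound: "AE x in M. norm (g x) \<le> c * norm (f x)"
  shows "sq_integrable M g" "norm_L2 M g \<le> c * norm_L2 M f"
proof -
  have sq: "AE x in M. (norm (g x))\<^sup>2 \<le> c\<^sup>2 * (norm (f x))\<^sup>2"
    using bound by eventually_elim (metis norm_ge_zero power_mono power_mult_distrib)
  have int: "integrable M (\<lambda>x. c\<^sup>2 * (norm (f x))\<^sup>2)" using f by (simp add: sq_integrable_def)
  show sq_g: "sq_integrable M g" unfolding sq_integrable_def
    using g sq by (auto intro!: Bochner_Integration.integrable_bound[OF int])
  have "(LINT x|M. (norm (g x))\<^sup>2) \<le> (LINT x|M. c\<^sup>2 * (norm (f x))\<^sup>2)"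
    using sq_g sq by (intro integral_mono_AE int) (auto simp: sq_integrable_def)
  then have "(norm_L2 M g)\<^sup>2 \<le> (c * norm_L2 M f)\<^sup>2"
    by (simp add: norm_L2_power2 power_mult_distrib)
  then show "norm_L2 M g \<le> c * norm_L2 M f" by (rule power2_le_imp_le) (simp add: c_nonneg)
qed

lemma norm_fst_snd_le: "norm (fst p) \<le> norm p" "norm (snd p) \<le> norm p"
  by (metis norm_fst_le prod.collapse) (metis norm_snd_le prod.collapse)

lemma sq_integrable_fst_snd:
  fixes U :: "'a \<Rightarrow> 'b::euclidean_space \<times> 'c::euclidean_space"
  assumes U: "sq_integrable M U"
  shows "sq_integrable M (\<lambda>x. fst (U x))" "norm_L2 M (\<lambda>x. fst (U x)) \<le> norm_L2 M U"
    "sq_integrable M (\<lambda>x. snd (U x))" "norm_L2 M (\<lambda>x. snd (U x)) \<le> norm_L2 M U"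
proof -
  have measurable: "(\<lambda>x. fst (U x)) \<in> borel_measurable M" "(\<lambda>x. snd (U x)) \<in> borel_measurable M"
    by (rule borel_measurable_continuous_on[OF _ sq_integrable_measurable[OF U]], intro continuous_intros)+
  show "sq_integrable M (\<lambda>x. fst (U x))" "norm_L2 M (\<lambda>x. fst (U x)) \<le> norm_L2 M U"
    using sq_integrable_dominated[OF U measurable(1), of 1] by (simp_all add: norm_fst_snd_le)
  show "sq_integrable M (\<lambda>x. snd (U x))" "norm_L2 M (\<lambda>x. snd (U x)) \<le> norm_L2 M U"
    using sq_integrable_dominated[OF U measurable(2), of 1] by (simp_all add: norm_fst_snd_le)
qed

lemma sq_integrable_Pair:
  assumes u: "sq_integrable M u" and w: "sq_integrable M w"
  shows "sq_integrable M (\<lambda>x. (u x, w x))" "(norm_L2 M (\<lambda>x. (u x, w x)))\<^sup>2 = (norm_L2 M u)\<^sup>2 + (norm_L2 M w)\<^sup>2"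
  using u w by (simp_all add: sq_integrable_def norm_L2_power2 norm_Pair borel_measurable_Pair)

lemma integral_norm_product_le:
  assumes f: "sq_integrable M f" and g: "sq_integrable M g"
  shows "integrable M (\<lambda>x. norm (f x) * norm (g x))"
    "(LINT x|M. norm (f x) * norm (g x)) \<le> norm_L2 M f * norm_L2 M g"
proof -
  have sq: "sq_integrable M (\<lambda>x. norm (f x))" "sq_integrable M (\<lambda>x. norm (g x))"
    using f g by (auto simp: sq_integrable_def)
  show "integrable M (\<lambda>x. norm (f x) * norm (g x))" using sq_integrable_inner[OF sq] by simp
  show "(LINT x|M. norm (f x) * norm (g x)) \<le> norm_L2 M f * norm_L2 M g"
    using L2.cauchy_schwarz[OF sq] by (simp add: inner_L2_def norm_L2_def)
qed

lemma integral_norm_le_product: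
  fixes h :: "'a \<Rightarrow> 'c::{banach, second_countable_topology}"
  assumes f: "sq_integrable M f" and g: "sq_integrable M g" and h: "h \<in> borel_measurable M" and c_nonneg: "0 \<le> c"
    and bound: "AE x in M. norm (h x) \<le> c * (norm (f x) * norm (g x))"
  shows "integrable M h" "norm (LINT x|M. h x) \<le> c * (norm_L2 M f * norm_L2 M g)"
proof -
  have int: "integrable M (\<lambda>x. c * (norm (f x) * norm (g x)))"
    using integral_norm_product_le[OF f g] by simp
  show int_h: "integrable M h"
    by (rule Bochner_Integration.integrable_bound[OF int h]) (use bound c_nonneg in auto)
  have "norm (LINT x|M. h x) \<le> (LINT x|M. norm (h x))" by (rule integral_norm_bound)
  also have "\<dots> \<le> (LINT x|M. c * (norm (f x) * norm (g x)))"
    using bound by (intro integral_mono_AE int) (auto simp: int_h)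
  also have "\<dots> \<le> c * (norm_L2 M f * norm_L2 M g)"
    using integral_norm_product_le[OF f g] c_nonneg by (simp add: mult_left_mono)
  finally show "norm (LINT x|M. h x) \<le> c * (norm_L2 M f * norm_L2 M g)" .
qed

lemma convergent_if_weighted_square_sum_finite:
  fixes s :: "nat \<Rightarrow> 'b::banach"
  assumes finite: "(\<Sum>k. ennreal (4 ^ k * (norm (s (Suc k) - s k))\<^sup>2)) \<noteq> \<infinity>"
  shows "convergent s"
proof -
  let ?a = "\<lambda>k. 4 ^ k * (norm (s (Suc k) - s k))\<^sup>2"
  define T where "T = enn2real (\<Sum>k. ennreal (?a k))"
  have T: "0 \<le> T" "(\<Sum>k. ennreal (?a k)) = ennreal T"
    unfolding T_def using finite by (simp_all add: less_top)
  have bound: "norm (s (Suc k) - s k) \<le> sqrt T * (1/2) ^ k" for k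
  proof -
    have "ennreal (?a k) \<le> ennreal T"
      using sum_le_suminf[of "\<lambda>k. ennreal (?a k)" "{k}"] by (simp add: T(2))
    moreover have "(4::real) ^ k = (2 ^ k)\<^sup>2" by (simp add: power2_eq_square flip: power_mult_distrib)
    ultimately have "(2 ^ k * norm (s (Suc k) - s k))\<^sup>2 \<le> T"
      using T(1) by (simp add: ennreal_le_iff power_mult_distrib)
    then have "2 ^ k * norm (s (Suc k) - s k) \<le> sqrt T" by (simp add: real_le_rsqrt)
    then show ?thesis by (simp add: field_simps)
  qed
  have "summable (\<lambda>k. s (Suc k) - s k)"
    by (rule summable_comparison_test'[OF summable_mult[OF summable_geometric[of "1/2"]], of 0]) (use bound in auto)
  then have "convergent (\<lambda>n. s 0 + (\<Sum>k<n. s (Suc k) - s k))"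
    by (intro convergent_add convergent_const) (simp add: summable_iff_convergent)
  then show ?thesis by (simp add: sum_lessThan_telescope)
qed

lemma AE_convergent_if_norm_L2_summable:
  fixes g :: "nat \<Rightarrow> 'a \<Rightarrow> 'b::euclidean_space"
  assumes g: "\<And>k. sq_integrable M (g k)" and fast: "\<And>k. norm_L2 M (g (Suc k) - g k) \<le> (1/4) ^ k"
  shows "AE x in M. convergent (\<lambda>k. g k x)"
proof -
  let ?h = "\<lambda>k. g (Suc k) - g k"
  have h: "sq_integrable M (?h k)" for k by (intro sq_integrable_diff g)
  have [measurable]: "g k \<in> borel_measurable M" for k by (rule sq_integrable_measurable[OF g])
  have "(\<integral>\<^sup>+x. (\<Sum>k. ennreal (4 ^ k * (norm (?h k x))\<^sup>2)) \<partial>M)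
      = (\<Sum>k. \<integral>\<^sup>+x. ennreal (4 ^ k * (norm (?h k x))\<^sup>2) \<partial>M)"
    by (rule nn_integral_suminf) simp
  also have "\<dots> = (\<Sum>k. ennreal (4 ^ k * (norm_L2 M (?h k))\<^sup>2))"
    using h by (subst ennreal_mult', simp, subst nn_integral_cmult)
      (auto simp: nn_integral_norm_L2[OF h, simplified] ennreal_mult')
  also have "\<dots> \<le> (\<Sum>k. ennreal ((1/4) ^ k))"
  proof (intro suminf_le ennreal_leI)
    fix k :: nat
    have "4 ^ k * (norm_L2 M (?h k))\<^sup>2 \<le> 4 ^ k * ((1/4) ^ k)\<^sup>2"
      by (intro mult_left_mono power_mono fast) simp_all
    also have "\<dots> = (1/4) ^ k" by (simp add: power2_eq_square power_one_over)
    finally show "4 ^ k * (norm_L2 M (?h k))\<^sup>2 \<le> (1/4) ^ k" .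
  qed auto
  also have "\<dots> = ennreal (\<Sum>k. (1/4) ^ k)"
    by (intro suminf_ennreal2) (auto intro: summable_geometric)
  finally have "(\<integral>\<^sup>+x. (\<Sum>k. ennreal (4 ^ k * (norm (?h k x))\<^sup>2)) \<partial>M) \<noteq> \<infinity>"
    by (auto simp: top_unique)
  then have "AE x in M. (\<Sum>k. ennreal (4 ^ k * (norm (?h k x))\<^sup>2)) \<noteq> \<infinity>"
    by (intro nn_integral_noteq_infinite) auto
  then show ?thesis
    by eventually_elim (rule convergent_if_weighted_square_sum_finite, simp)
qed

lemma norm_L2_limit_le:
  fixes g :: "nat \<Rightarrow> 'a \<Rightarrow> 'b::euclidean_space"
  assumes f: "sq_integrable M f" and g: "\<And>k. sq_integrable M (g k)" and h: "h \<in> borel_measurable M"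
    and lim: "AE x in M. (\<lambda>k. g k x) \<longlonglongrightarrow> h x" and e: "0 \<le> e"
    and close: "\<forall>\<^sub>F k in sequentially. norm_L2 M (f - g k) \<le> e"
  shows "sq_integrable M (f - h)" "norm_L2 M (f - h) \<le> e"
proof -
  have [measurable]: "f \<in> borel_measurable M" "g k \<in> borel_measurable M" for k
    by (rule sq_integrable_measurable[OF f] sq_integrable_measurable[OF g])+
  note h [measurable]
  have "(\<integral>\<^sup>+x. ennreal ((norm (f x - h x))\<^sup>2) \<partial>M)
      = (\<integral>\<^sup>+x. liminf (\<lambda>k. ennreal ((norm (f x - g k x))\<^sup>2)) \<partial>M)"
  proof (rule nn_integral_cong_AE)
    show "AE x in M. ennreal ((norm (f x - h x))\<^sup>2) = liminf (\<lambda>k. ennreal ((norm (f x - g k x))\<^sup>2))"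
      using lim
    proof eventually_elim
      fix x assume "(\<lambda>k. g k x) \<longlonglongrightarrow> h x"
      then have "(\<lambda>k. ennreal ((norm (f x - g k x))\<^sup>2)) \<longlonglongrightarrow> ennreal ((norm (f x - h x))\<^sup>2)"
        by (intro tendsto_intros)
      from lim_imp_Liminf[OF sequentially_bot this]
      show "ennreal ((norm (f x - h x))\<^sup>2) = liminf (\<lambda>k. ennreal ((norm (f x - g k x))\<^sup>2))" ..
    qed
  qed
  also have "\<dots> \<le> liminf (\<lambda>k. \<integral>\<^sup>+x. ennreal ((norm (f x - g k x))\<^sup>2) \<partial>M)"
    by (rule nn_integral_liminf) auto
  also have "\<dots> \<le> ennreal (e\<^sup>2)"
  proof (rule Liminf_le)
    show "\<forall>\<^sub>F k in sequentially. (\<integral>\<^sup>+x. ennreal ((norm (f x - g k x))\<^sup>2) \<partial>M) \<le> ennreal (e\<^sup>2)"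
      using close by eventually_elim
        (use nn_integral_norm_L2[OF sq_integrable_diff[OF f g]] in \<open>auto intro!: ennreal_leI power_mono\<close>)
  qed simp
  finally have bound: "(\<integral>\<^sup>+x. ennreal ((norm ((f - h) x))\<^sup>2) \<partial>M) \<le> ennreal (e\<^sup>2)" by simp
  then have "integrable M (\<lambda>x. (norm ((f - h) x))\<^sup>2)"
    by (intro integrableI_bounded) (auto simp: le_less_trans[OF _ ennreal_less_top])
  then show sq: "sq_integrable M (f - h)" by (simp add: sq_integrable_def fun_diff_def)
  have "(norm_L2 M (f - h))\<^sup>2 \<le> e\<^sup>2"
    using bound unfolding nn_integral_norm_L2[OF sq] by (simp add: ennreal_le_iff)
  then show "norm_L2 M (f - h) \<le> e" using e by (rule power2_le_imp_le)
qed

lemma nrm_Cauchy_fast_subsequence: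
  assumes "L2.nrm_Cauchy M f"
  obtains r :: "nat \<Rightarrow> nat" where "\<And>k. k \<le> r k" "\<And>k. norm_L2 M (f (r (Suc k)) - f (r k)) \<le> (1/4) ^ k"
proof -
  have "\<exists>N. \<forall>m\<ge>N. \<forall>n\<ge>N. norm_L2 M (f m - f n) < (1/4) ^ k" for k :: nat
    using assms by (simp add: L2.nrm_Cauchy_def)
  then obtain N where N: "\<And>k m n. m \<ge> N k \<Longrightarrow> n \<ge> N k \<Longrightarrow> norm_L2 M (f m - f n) < (1/4) ^ k" by metis
  define r where "r k = Max (N ` {..k}) + k" for k
  have "N j \<le> r k" if "j \<le> k" for j k using that by (auto simp: r_def intro!: trans_le_add1 Max_ge)
  then have "norm_L2 M (f (r (Suc k)) - f (r k)) \<le> (1/4) ^ k" for k by (simp add: N less_imp_le)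
  moreover have "k \<le> r k" for k by (simp add: r_def)
  ultimately show thesis using that by blast
qed

lemma norm_L2_tail_le:
  fixes f :: "nat \<Rightarrow> 'a \<Rightarrow> 'b::euclidean_space"
  assumes f: "\<And>n. sq_integrable M (f n)" and Cauchy: "L2.nrm_Cauchy M f"
    and h: "h \<in> borel_measurable M" and r: "\<And>k. k \<le> r k" and lim: "AE x in M. (\<lambda>k. f (r k) x) \<longlonglongrightarrow> h x"
    and e: "e > 0"
  shows "\<exists>N. \<forall>n\<ge>N. sq_integrable M (f n - h) \<and> norm_L2 M (f n - h) \<le> e"
proof -
  obtain N where N: "\<And>m n. m \<ge> N \<Longrightarrow> n \<ge> N \<Longrightarrow> norm_L2 M (f m - f n) < e"
    using Cauchy e unfolding L2.nrm_Cauchy_def by blast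
  have "\<forall>\<^sub>F k in sequentially. norm_L2 M (f n - f (r k)) \<le> e" if "n \<ge> N" for n
    using eventually_ge_at_top[of N]
  proof eventually_elim
    case (elim k)
    then show ?case using N[OF that, of "r k"] r[of k] by simp
  qed
  then have "sq_integrable M (f n - h) \<and> norm_L2 M (f n - h) \<le> e" if "n \<ge> N" for n
    using norm_L2_limit_le[OF f f h lim, of e] e that by (simp add: less_imp_le)
  then show ?thesis by blast
qed

theorem L2_complete:
  fixes f :: "nat \<Rightarrow> 'a \<Rightarrow> 'b::euclidean_space"
  assumes f: "\<And>n. sq_integrable M (f n)" and Cauchy: "L2.nrm_Cauchy M f"
  shows "\<exists>h. sq_integrable M h \<and> L2.nrm_lim M f h"
proof -
  obtain r :: "nat \<Rightarrow> nat" where r: "\<And>k. k \<le> r k" and fast: "\<And>k. norm_L2 M (f (r (Suc k)) - f (r k)) \<le> (1/4) ^ k"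
    using nrm_Cauchy_fast_subsequence[OF Cauchy] by blast
  have [measurable]: "f n \<in> borel_measurable M" for n by (rule sq_integrable_measurable[OF f])
  define h where "h x = lim (\<lambda>k. f (r k) x)" for x
  have h: "h \<in> borel_measurable M" unfolding h_def by measurable
  have lim: "AE x in M. (\<lambda>k. f (r k) x) \<longlonglongrightarrow> h x"
    using AE_convergent_if_norm_L2_summable[OF f fast]
    by eventually_elim (simp add: h_def convergent_LIMSEQ_iff)
  note tail = norm_L2_tail_le[OF f Cauchy h r lim]
  obtain n where "sq_integrable M (f n - h)" using tail[OF zero_less_one] by blast
  then have "sq_integrable M (f n - (f n - h))" by (rule sq_integrable_diff[OF f])
  then have "sq_integrable M h" by simp
  moreover have "L2.nrm_lim M f h"
    unfolding L2.nrm_lim_def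
  proof (rule LIMSEQ_I)
    fix e :: real assume "0 < e"
    then obtain N where N: "\<And>n. n \<ge> N \<Longrightarrow> norm_L2 M (f n - h) \<le> e / 2"
      using tail[of "e / 2"] half_gt_zero by blast
    have "norm (norm_L2 M (f n - h) - 0) < e" if "n \<ge> N" for n using N[OF that] \<open>0 < e\<close> by simp
    then show "\<exists>N. \<forall>n\<ge>N. norm (norm_L2 M (f n - h) - 0) < e" by blast
  qed
  ultimately show ?thesis by blast
qed

lemma semi_hilbert_L2: "semi_hilbert (Collect (sq_integrable M)) (inner_L2 M)"
  by unfold_locales (simp add: Bex_def L2_complete)

interpretation L2: semi_hilbert "Collect (sq_integrable M)" "inner_L2 M"
  rewrites "f \<in> Collect (sq_integrable M) \<longleftrightarrow> sq_integrable M f"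
    and "semi_inner.nrm (inner_L2 M) = norm_L2 M"
  for M :: "'a measure"
  by (simp_all add: semi_hilbert_L2 nrm_inner_L2)

section \<open>Measurable matrix-valued functions\<close>

lemma continuous_on_matrix_mult:
  fixes f :: "'a::topological_space \<Rightarrow> complex^'k^'m" and g :: "'a \<Rightarrow> complex^'n^'k"
  assumes "continuous_on S f" "continuous_on S g"
  shows "continuous_on S (\<lambda>x. f x ** g x)"
  unfolding matrix_matrix_mult_def using assms
  by (intro continuous_intros)

lemma continuous_on_mult_vec:
  fixes f :: "'a::topological_space \<Rightarrow> complex^'n^'m" and g :: "'a \<Rightarrow> complex^'n"
  assumes "continuous_on S f" "continuous_on S g"
  shows "continuous_on S (\<lambda>x. f x *v g x)"
  unfolding matrix_vector_mult_def using assms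
  by (intro continuous_intros)

lemma continuous_on_cdot:
  assumes "continuous_on S f" "continuous_on S g"
  shows "continuous_on S (\<lambda>x. cdot (f x) (g x))"
  unfolding cdot_def using assms by (intro continuous_intros)

lemma borel_measurable_vec_iff:
  fixes f :: "'a \<Rightarrow> 'b::euclidean_space^'n"
  shows "f \<in> borel_measurable M \<longleftrightarrow> (\<forall>i. (\<lambda>x. f x $ i) \<in> borel_measurable M)"
proof
  assume f: "f \<in> borel_measurable M"
  have "continuous_on UNIV (\<lambda>y :: 'b^'n. y $ i)" for i by (intro continuous_intros)
  then show "\<forall>i. (\<lambda>x. f x $ i) \<in> borel_measurable M"
    using borel_measurable_continuous_on[OF _ f] by blast
next
  assume f: "\<forall>i. (\<lambda>x. f x $ i) \<in> borel_measurable M"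
  show "f \<in> borel_measurable M"
  proof (rule borel_measurable_euclidean_space[THEN iffD2], rule)
    fix b :: "'b^'n" assume "b \<in> Basis"
    then obtain i u where "b = axis i u" unfolding Basis_vec_def by blast
    then have "(\<lambda>x. f x \<bullet> b) = (\<lambda>x. f x $ i \<bullet> u)" by (simp add: inner_axis)
    then show "(\<lambda>x. f x \<bullet> b) \<in> borel_measurable M" using f by (simp add: borel_measurable_inner)
  qed
qed

lemma borel_measurable_matrix_mult:
  fixes f :: "'a \<Rightarrow> complex^'k^'m" and g :: "'a \<Rightarrow> complex^'n^'k"
  assumes "f \<in> borel_measurable M" "g \<in> borel_measurable M"
  shows "(\<lambda>x. f x ** g x) \<in> borel_measurable M"
  by (rule borel_measurable_continuous_Pair[OF assms])
     (intro continuous_on_matrix_mult continuous_intros)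

lemma borel_measurable_mult_vec:
  fixes f :: "'a \<Rightarrow> complex^'n^'m" and g :: "'a \<Rightarrow> complex^'n"
  assumes "f \<in> borel_measurable M" "g \<in> borel_measurable M"
  shows "(\<lambda>x. f x *v g x) \<in> borel_measurable M"
  by (rule borel_measurable_continuous_Pair[OF assms])
     (intro continuous_on_mult_vec continuous_intros)

lemma borel_measurable_cdot:
  assumes "f \<in> borel_measurable M" "g \<in> borel_measurable M"
  shows "(\<lambda>x. cdot (f x) (g x)) \<in> borel_measurable M"
  by (rule borel_measurable_continuous_Pair[OF assms])
     (intro continuous_on_cdot continuous_intros)

lemma borel_measurable_cnj: "f \<in> borel_measurable M \<Longrightarrow> (\<lambda>x. cnj (f x)) \<in> borel_measurable M"
  by (rule borel_measurable_continuous_on[of cnj]) (intro continuous_intros)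

lemma borel_measurable_smult:
  fixes g :: "'a \<Rightarrow> complex^'n"
  assumes "f \<in> borel_measurable M" "g \<in> borel_measurable M"
  shows "(\<lambda>x. f x *s g x) \<in> borel_measurable M"
  using assms unfolding borel_measurable_vec_iff by (auto intro!: borel_measurable_times)

lemma borel_measurable_adj:
  fixes f :: "'a \<Rightarrow> complex^'n^'m"
  assumes "f \<in> borel_measurable M"
  shows "(\<lambda>x. adj (f x)) \<in> borel_measurable M"
  by (rule borel_measurable_continuous_on[OF _ assms]) (unfold adj_def, intro continuous_intros)

lemma borel_measurable_vconj:
  assumes "f \<in> borel_measurable M"
  shows "(\<lambda>x. vconj (f x)) \<in> borel_measurable M"
  by (rule borel_measurable_continuous_on[OF _ assms]) (unfold vconj_def, intro continuous_intros)

lemma borel_measurable_cscale: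
  fixes f :: "'a \<Rightarrow> complex^'n^'m"
  assumes "f \<in> borel_measurable M"
  shows "(\<lambda>x. cscale c (f x)) \<in> borel_measurable M"
  by (rule borel_measurable_continuous_on[OF _ assms]) (unfold cscale_def, intro continuous_intros)

lemma borel_measurable_herm_part:
  fixes f :: "'a \<Rightarrow> complex^'n^'n"
  assumes "f \<in> borel_measurable M"
  shows "(\<lambda>x. herm_part (f x)) \<in> borel_measurable M"
  by (rule borel_measurable_continuous_on[OF _ assms]) (unfold herm_part_def, intro continuous_intros, simp)

lemma borel_measurable_matrix_inv:
  fixes f :: "'a \<Rightarrow> complex^'n^'n"
  assumes f: "f \<in> borel_measurable M" and inv: "\<And>x. x \<in> space M \<Longrightarrow> invertible (f x)"
  shows "(\<lambda>x. matrix_inv (f x)) \<in> borel_measurable M"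
  unfolding borel_measurable_vec_iff
proof (intro allI)
  fix i j :: 'n
  let ?N = "\<lambda>x. \<chi> k l. if l = i then axis j 1 $ k else f x $ k $ l"
  have entry: "(\<lambda>x. g x $ k $ l) \<in> borel_measurable M" if "g \<in> borel_measurable M" for g :: "'a \<Rightarrow> complex^'n^'n" and k l
    using that by (simp add: borel_measurable_vec_iff)
  have det: "(\<lambda>x. det (g x)) \<in> borel_measurable M" if "g \<in> borel_measurable M" for g :: "'a \<Rightarrow> complex^'n^'n"
    unfolding det_def using entry[OF that]
    by (intro borel_measurable_sum borel_measurable_times borel_measurable_prod borel_measurable_const)
  have "?N \<in> borel_measurable M" using entry[OF f] by (auto simp: borel_measurable_vec_iff)
  then have "(\<lambda>x. det (?N x) / det (f x)) \<in> borel_measurable M"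
    using f by (intro borel_measurable_divide det)
  moreover have "matrix_inv (f x) $ i $ j = det (?N x) / det (f x)" if "x \<in> space M" for x
  proof -
    have "f x *v (matrix_inv (f x) *v axis j 1) = axis j 1"
      by (simp add: matrix_vector_mul_assoc matrix_inv_cancel inv that)
    moreover have "det (f x) \<noteq> 0" using inv[OF that] by (simp add: invertible_det_nz)
    ultimately have "matrix_inv (f x) *v axis j 1
        = (\<chi> i. det (\<chi> k l. if l = i then axis j 1 $ k else f x $ k $ l) / det (f x))"
      by (simp add: cramer)
    then show ?thesis using mult_vec_axis[of "matrix_inv (f x)" j i] by simp
  qed
  ultimately show "(\<lambda>x. matrix_inv (f x) $ i $ j) \<in> borel_measurable M"
    by (subst measurable_cong[of M _ "\<lambda>x. det (?N x) / det (f x)"])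
qed

lemma closed_psd: "closed {M :: complex^'n^'n. psd M}"
proof -
  have "continuous_on UNIV (\<lambda>M :: complex^'n^'n. adj M)"
    unfolding adj_def by (intro continuous_intros)
  then have "closed {M :: complex^'n^'n. adj M = M}"
    by (intro closed_Collect_eq continuous_intros)
  moreover have "closed {M :: complex^'n^'n. 0 \<le> Re (cdot (M *v \<xi>) \<xi>)}" for \<xi>
    by (intro closed_Collect_le continuous_intros continuous_on_cdot continuous_on_mult_vec)
  ultimately have "closed ({M :: complex^'n^'n. adj M = M} \<inter> (\<Inter>\<xi>. {M. 0 \<le> Re (cdot (M *v \<xi>) \<xi>)}))"
    by (intro closed_Int closed_INT) auto
  moreover have "{M :: complex^'n^'n. psd M} = {M. adj M = M} \<inter> (\<Inter>\<xi>. {M. 0 \<le> Re (cdot (M *v \<xi>) \<xi>)})"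
    by (auto simp: psd_def hermitian_def)
  ultimately show ?thesis by simp
qed

lemma borel_measurable_msqrt:
  fixes F :: "'a \<Rightarrow> complex^'n^'n"
  assumes F: "F \<in> borel_measurable M" and psd: "\<And>x. x \<in> space M \<Longrightarrow> psd (F x)"
  shows "(\<lambda>x. msqrt (F x)) \<in> borel_measurable M"
  unfolding borel_eq_closed
proof (rule measurable_measure_of)
  fix K :: "(complex^'n^'n) set" assume "K \<in> Collect closed"
  then have K: "closed K" by simp
  let ?P = "\<lambda>n. K \<inter> {S. psd S} \<inter> cball 0 (real n)"
  let ?sq = "\<lambda>S :: complex^'n^'n. S ** S"
  have "compact (?sq ` ?P n)" for n
    by (intro compact_continuous_image continuous_on_matrix_mult continuous_on_id
        closed_Int_compact closed_Int K closed_psd compact_cball)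
  then have "(\<Union>n. ?sq ` ?P n) \<in> sets borel"
    by (intro sets.countable_UN) (auto intro: borel_compact)
  then have "F -` (\<Union>n. ?sq ` ?P n) \<inter> space M \<in> sets M" by (rule measurable_sets[OF F])
  moreover have "(\<lambda>x. msqrt (F x)) -` K \<inter> space M = F -` (\<Union>n. ?sq ` ?P n) \<inter> space M"
  proof (intro set_eqI iffI)
    fix x assume x: "x \<in> (\<lambda>x. msqrt (F x)) -` K \<inter> space M"
    then have p: "psd (F x)" using psd by auto
    obtain n where "norm (msqrt (F x)) \<le> real n" using real_arch_simple by blast
    then show "x \<in> F -` (\<Union>n. ?sq ` ?P n) \<inter> space M"
      using x msqrt[OF p] by (auto intro!: image_eqI[of _ _ "msqrt (F x)"])
  next
    fix x assume "x \<in> F -` (\<Union>n. ?sq ` ?P n) \<inter> space M"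
    then obtain S where "S \<in> K" "psd S" "F x = S ** S" "x \<in> space M" by auto
    then show "x \<in> (\<lambda>x. msqrt (F x)) -` K \<inter> space M" using msqrt_unique[of S "F x"] by auto
  qed
  ultimately show "(\<lambda>x. msqrt (F x)) -` K \<inter> space M \<in> sets M" by simp
qed auto

section \<open>Test functions and weak gradients\<close>

definition bump :: "nat \<Rightarrow> real \<Rightarrow> real" where
  "bump k t = (if 0 < t then exp (- inverse t) * inverse t ^ k else 0)"

lemma bump_tendsto_0: "((\<lambda>t. bump k t) \<longlongrightarrow> 0) (at 0)"
proof (rule filterlim_split_at)
  have "((\<lambda>t. inverse t ^ k / exp (inverse t)) \<longlongrightarrow> (0::real)) (at_right 0)"
    by (rule filterlim_compose[OF tendsto_power_div_exp_0 filterlim_inverse_at_top_right])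
  moreover have "\<forall>\<^sub>F t in at_right 0. inverse t ^ k / exp (inverse t) = bump k t"
    by (auto simp: eventually_at_filter bump_def exp_minus field_simps)
  ultimately show "((\<lambda>t. bump k t) \<longlongrightarrow> 0) (at_right 0)" by (rule Lim_transform_eventually)
  have "\<forall>\<^sub>F t in at_left 0. 0 = bump k t"
    by (auto simp: eventually_at_filter bump_def)
  then show "((\<lambda>t. bump k t) \<longlongrightarrow> 0) (at_left 0)"
    by (rule Lim_transform_eventually[OF tendsto_const])
qed

lemma bump_has_derivative:
  "(bump k has_real_derivative bump (k + 2) t - real k * bump (k + 1) t) (at t)"
proof -
  consider (pos) "t > 0" | (neg) "t < 0" | (zero) "t = 0" by linarith
  then show ?thesis
  proof cases
    case pos
    have powers: "inverse t ^ (k + 2) = inverse t ^ k * (inverse t)\<^sup>2" "inverse t ^ (k + 1) = inverse t ^ k * inverse t"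
      by (simp_all add: power_add power2_eq_square)
    have derivative_term: "real k * inverse t ^ (k - Suc 0) * (inverse t)\<^sup>2 = real k * (inverse t ^ k * inverse t)"
      by (cases k) (auto simp: power2_eq_square)
    have "((\<lambda>t. exp (- inverse t) * inverse t ^ k) has_real_derivative bump (k + 2) t - real k * bump (k + 1) t) (at t)"
      using pos derivative_term by (auto intro!: derivative_eq_intros simp: bump_def powers power2_eq_square algebra_simps)
    then show ?thesis
    proof (rule DERIV_cong_ev[THEN iffD1, rotated 3])
      show "\<forall>\<^sub>F x in nhds t. exp (- inverse x) * inverse x ^ k = bump k x"
        using eventually_nhds_in_open[of "{0<..}" t] pos by (auto simp: bump_def elim!: eventually_mono)
    qed auto
  next
    case neg
    have "((\<lambda>t. 0) has_real_derivative bump (k + 2) t - real k * bump (k + 1) t) (at t)"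
      using neg by (simp add: bump_def)
    then show ?thesis
    proof (rule DERIV_cong_ev[THEN iffD1, rotated 3])
      show "\<forall>\<^sub>F x in nhds t. 0 = bump k x"
        using eventually_nhds_in_open[of "{..<0}" t] neg by (auto simp: bump_def elim!: eventually_mono)
    qed auto
  next
    case zero
    have "(\<lambda>y. (bump k y - bump k 0) / (y - 0)) = bump (Suc k)"
      by (auto simp: bump_def fun_eq_iff field_simps)
    moreover have "bump j 0 = 0" for j by (simp add: bump_def)
    ultimately show ?thesis using bump_tendsto_0[of "Suc k"] zero
      by (simp add: has_field_derivative_iff)
  qed
qed

inductive_set bump_algebra :: "(real^'n \<Rightarrow> complex) set" where
  const: "(\<lambda>x. c) \<in> bump_algebra"
| affine: "(\<lambda>x. complex_of_real (bump k (\<alpha> * x $ i + \<beta>))) \<in> bump_algebra"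
| add: "f \<in> bump_algebra \<Longrightarrow> g \<in> bump_algebra \<Longrightarrow> (\<lambda>x. f x + g x) \<in> bump_algebra"
| mult: "f \<in> bump_algebra \<Longrightarrow> g \<in> bump_algebra \<Longrightarrow> (\<lambda>x. f x * g x) \<in> bump_algebra"

lemma partial_eqI:
  assumes "\<And>x. (f has_derivative f' x) (at x)"
  shows "partial k f = (\<lambda>x. f' x (axis k 1))"
  using frechet_derivative_at[OF assms] by (simp add: partial_def fun_eq_iff)

lemma bump_affine_has_derivative:
  fixes x :: "real^'n"
  shows "((\<lambda>x. complex_of_real (bump k (\<alpha> * x $ i + \<beta>))) has_derivative
    (\<lambda>h. of_real ((\<alpha> * h $ i) * (bump (k + 2) (\<alpha> * x $ i + \<beta>) - real k * bump (k + 1) (\<alpha> * x $ i + \<beta>))))) (at x)"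
proof -
  have "((\<lambda>x::real^'n. x $ i) has_derivative (\<lambda>h. h $ i)) (at x)"
    by (intro bounded_linear_imp_has_derivative bounded_linear_vec_nth)
  then have "((\<lambda>x::real^'n. \<alpha> * x $ i + \<beta>) has_derivative (\<lambda>h. \<alpha> * h $ i)) (at x)"
    by (auto intro!: derivative_eq_intros)
  from has_derivative_compose[OF this bump_has_derivative[of k "\<alpha> * x $ i + \<beta>", unfolded has_field_derivative_def]]
  have "((\<lambda>x. bump k (\<alpha> * x $ i + \<beta>)) has_derivative
     (\<lambda>h. (\<alpha> * h $ i) * (bump (k + 2) (\<alpha> * x $ i + \<beta>) - real k * bump (k + 1) (\<alpha> * x $ i + \<beta>)))) (at x)"
    by (simp add: mult.commute)
  then show ?thesis by (rule has_derivative_of_real)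
qed

lemma bump_algebra_partial:
  "f \<in> (bump_algebra :: (real^'n \<Rightarrow> complex) set) \<Longrightarrow> (\<forall>x. f differentiable (at x)) \<and> (\<forall>k. partial k f \<in> bump_algebra)"
proof (induction rule: bump_algebra.induct)
  case (const c)
  have "((\<lambda>x. c) has_derivative (\<lambda>h. 0)) (at x)" for x :: "real^'n" by simp
  from partial_eqI[OF this] show ?case
    by (auto intro: bump_algebra.const)
next
  case (affine k \<alpha> i \<beta>)
  have "partial j (\<lambda>x. complex_of_real (bump k (\<alpha> * x $ i + \<beta>)))
      = (\<lambda>x. complex_of_real (\<alpha> * axis j 1 $ i) * (of_real (bump (k + 2) (\<alpha> * x $ i + \<beta>))
           + of_real (- real k) * of_real (bump (k + 1) (\<alpha> * x $ i + \<beta>))))" for j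
    unfolding partial_eqI[OF bump_affine_has_derivative] by (simp add: fun_eq_iff)
  moreover have "\<dots> j \<in> bump_algebra" for j
    by (intro bump_algebra.intros)
  ultimately show ?case by (auto intro: differentiableI[OF bump_affine_has_derivative])
next
  case (add f g)
  then have d: "(f has_derivative frechet_derivative f (at x)) (at x)"
      "(g has_derivative frechet_derivative g (at x)) (at x)" for x
    by (auto simp: frechet_derivative_works)
  have "partial k (\<lambda>x. f x + g x) = (\<lambda>x. partial k f x + partial k g x)" for k
    unfolding partial_eqI[OF has_derivative_add[OF d]] by (simp add: partial_def)
  then show ?case using add by (auto intro: bump_algebra.intros)
next
  case (mult f g)
  then have d: "(f has_derivative frechet_derivative f (at x)) (at x)"
      "(g has_derivative frechet_derivative g (at x)) (at x)" for x
    by (auto simp: frechet_derivative_works)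
  have "partial k (\<lambda>x. f x * g x) = (\<lambda>x. f x * partial k g x + partial k f x * g x)" for k
    unfolding partial_eqI[OF has_derivative_mult[OF d]] by (simp add: partial_def)
  moreover have "(\<lambda>x. f x * partial k g x + partial k f x * g x) \<in> bump_algebra" for k
    using mult by (intro bump_algebra.add bump_algebra.mult) auto
  ultimately show ?case using mult by auto
qed

lemma bump_algebra_smooth: "f \<in> bump_algebra \<Longrightarrow> smooth f"
proof -
  assume f: "f \<in> bump_algebra"
  have "iter_partial ks f \<in> bump_algebra" for ks
    by (induction ks) (auto simp: f bump_algebra_partial)
  then show ?thesis unfolding smooth_def using bump_algebra_partial by blast
qed

lemma bump_algebra_prod:
  "finite I \<Longrightarrow> (\<And>i. i \<in> I \<Longrightarrow> f i \<in> bump_algebra) \<Longrightarrow> (\<lambda>x. \<Prod>i\<in>I. f i x) \<in> bump_algebra"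
  by (induction I rule: finite_induct) (auto intro: bump_algebra.intros)

definition soft_step :: "nat \<Rightarrow> real \<Rightarrow> real" where
  "soft_step m t = bump 0 (real (Suc m) * t)"

lemma soft_step_eq_0: "t \<le> 0 \<Longrightarrow> soft_step m t = 0"
  by (simp add: soft_step_def bump_def mult_le_0_iff not_less)

lemma soft_step_bounds: "0 \<le> soft_step m t" "soft_step m t \<le> 1"
  by (auto simp: soft_step_def bump_def simp del: inverse_mult_distrib of_nat_Suc)

lemma soft_step_tendsto_1:
  assumes "t > 0" shows "(\<lambda>m. soft_step m t) \<longlonglongrightarrow> 1"
proof -
  have "(\<lambda>m. exp (- (inverse (real (Suc m)) * inverse t))) \<longlonglongrightarrow> exp (- (0 * inverse t))"
    by (intro tendsto_intros LIMSEQ_inverse_real_of_nat)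
  moreover have "soft_step m t = exp (- (inverse (real (Suc m)) * inverse t))" for m
    using assms by (simp add: soft_step_def bump_def inverse_mult_distrib del: of_nat_Suc)
  ultimately show ?thesis by simp
qed

definition box_cutoff :: "real^'n \<Rightarrow> real^'n \<Rightarrow> nat \<Rightarrow> real^'n \<Rightarrow> complex" where
  "box_cutoff a b m x = (\<Prod>i\<in>UNIV. complex_of_real (soft_step m (x $ i - a $ i)) * complex_of_real (soft_step m (b $ i - x $ i)))"

lemma box_cutoff_eq_0:
  assumes "x \<notin> box a b" shows "box_cutoff a b m x = 0"
proof -
  obtain i where "x $ i \<le> a $ i \<or> b $ i \<le> x $ i" using assms by (auto simp: mem_box_cart not_less)
  then have "complex_of_real (soft_step m (x $ i - a $ i)) * complex_of_real (soft_step m (b $ i - x $ i)) = 0"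
    by (auto simp: soft_step_eq_0)
  then show ?thesis unfolding box_cutoff_def by (meson UNIV_I finite prod_zero)
qed

lemma norm_box_cutoff_le_1: "cmod (box_cutoff a b m x) \<le> 1"
  unfolding box_cutoff_def norm_mult prod_norm[symmetric]
  by (intro prod_le_1) (auto simp: soft_step_bounds mult_le_one)

lemma box_cutoff_tendsto_indicator:
  fixes x :: "real^'n"
  shows "(\<lambda>m. box_cutoff a b m x) \<longlonglongrightarrow> indicator (box a b) x"
proof (cases "x \<in> box a b")
  case True
  then have "x $ i - a $ i > 0" "b $ i - x $ i > 0" for i by (auto simp: mem_box_cart)
  then have "(\<lambda>m. box_cutoff a b m x) \<longlonglongrightarrow> (\<Prod>i\<in>(UNIV :: 'n set). complex_of_real 1 * complex_of_real 1)"
    unfolding box_cutoff_def by (intro tendsto_intros soft_step_tendsto_1)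
  then show ?thesis using True by simp
qed (simp add: box_cutoff_eq_0)

lemma smooth_box_cutoff: "smooth (box_cutoff a b m)"
proof -
  have "(\<lambda>x. complex_of_real (soft_step m (x $ i - a $ i))) \<in> bump_algebra" for i
    using bump_algebra.affine[of 0 "real (Suc m)" i "- real (Suc m) * a $ i"]
    by (simp add: soft_step_def algebra_simps)
  moreover have "(\<lambda>x. complex_of_real (soft_step m (b $ i - x $ i))) \<in> bump_algebra" for i
    using bump_algebra.affine[of 0 "- real (Suc m)" i "real (Suc m) * b $ i"]
    by (simp add: soft_step_def algebra_simps)
  ultimately show ?thesis
    unfolding box_cutoff_def by (intro bump_algebra_smooth bump_algebra_prod bump_algebra.mult) auto
qed

lemma test_fn_box_cutoff:
  assumes "cbox a b \<subseteq> \<Omega>" shows "test_fn \<Omega> (box_cutoff a b m)"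
proof -
  have "{x. box_cutoff a b m x \<noteq> 0} \<subseteq> cbox a b" using box_cutoff_eq_0 box_subset_cbox by blast
  then have supp: "tsupp (box_cutoff a b m) \<subseteq> cbox a b" unfolding tsupp_def by (intro closure_minimal) auto
  then have "compact (tsupp (box_cutoff a b m))"
    using bounded_subset[OF bounded_cbox supp] by (simp add: compact_eq_bounded_closed tsupp_def)
  then show ?thesis using supp assms by (auto simp: test_fn_def smooth_box_cutoff)
qed

lemma sigma_finite_lebesgue: "sigma_finite_measure (lebesgue :: 'a::euclidean_space measure)"
proof -
  obtain \<A> :: "'a set set" where "countable \<A>" "\<A> \<subseteq> sets lborel" "\<Union>\<A> = UNIV" "\<forall>A\<in>\<A>. emeasure lborel A \<noteq> \<infinity>"
    using lborel.sigma_finite_countable by auto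
  then show ?thesis by (intro sigma_finite_measure.intro exI[of _ \<A>]) auto
qed

lemma integral_eq_0_if_box_integrals_0:
  fixes f :: "'a::euclidean_space \<Rightarrow> 'b::{banach, second_countable_topology}"
  assumes f: "integrable lebesgue f"
    and box: "\<And>c d. (LINT x|lebesgue. indicator (box c d) x *\<^sub>R f x) = 0"
  shows "(LINT x|lebesgue. f x) = 0"
proof -
  let ?B = "\<lambda>n::nat. box (- real n *\<^sub>R One) (real n *\<^sub>R One) :: 'a set"
  have "(\<lambda>n. LINT x|lebesgue. indicator (?B n) x *\<^sub>R f x) \<longlonglongrightarrow> (LINT x|lebesgue. f x)"
  proof (rule integral_dominated_convergence[where w = "\<lambda>x. norm (f x)"])
    show "AE x in lebesgue. (\<lambda>n. indicator (?B n) x *\<^sub>R f x) \<longlonglongrightarrow> f x"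
    proof (rule AE_I2)
      fix x :: 'a
      obtain N :: nat where N: "norm x < real N" using reals_Archimedean2 by blast
      have "indicator (?B n) x *\<^sub>R f x = f x" if "n \<ge> N" for n
      proof -
        have "\<bar>x \<bullet> i\<bar> < real n" if "i \<in> Basis" for i
          using Basis_le_norm[OF that, of x] N \<open>n \<ge> N\<close> by linarith
        then have "x \<in> ?B n" by (auto simp: mem_box abs_less_iff) (metis minus_less_iff)
        then show ?thesis by simp
      qed
      then show "(\<lambda>n. indicator (?B n) x *\<^sub>R f x) \<longlonglongrightarrow> f x"
        by (intro tendsto_eventually) (auto simp: eventually_sequentially)
    qed
    show "(\<lambda>x. indicator (?B n) x *\<^sub>R f x) \<in> borel_measurable lebesgue" for n
      by (intro borel_measurable_integrable integrable_mult_indicator[OF _ f]) simp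
  qed (use f in \<open>auto simp: indicator_def\<close>)
  then show ?thesis by (simp add: box LIMSEQ_const_iff)
qed

lemma integral_indicator_eq_0_if_box_integrals_0:
  fixes f :: "'a::euclidean_space \<Rightarrow> 'b::{banach, second_countable_topology}"
  assumes f: "integrable lebesgue f"
    and box: "\<And>c d. (LINT x|lebesgue. indicator (box c d) x *\<^sub>R f x) = 0"
    and A: "A \<in> sets borel"
  shows "(LINT x|lebesgue. indicator A x *\<^sub>R f x) = 0"
proof -
  let ?G = "range (\<lambda>(a, b). box a b :: 'a set)"
  have borel_eq: "sets (borel :: 'a measure) = sigma_sets UNIV ?G"
    by (subst borel_eq_box) simp
  have int: "integrable lebesgue (\<lambda>x. indicator A x *\<^sub>R f x)" if "A \<in> sets lebesgue" for A
    by (rule integrable_mult_indicator[OF that f])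
  have "Int_stable ?G" by (auto simp: Int_stable_def box_Int_box)
  then show ?thesis
    using subset_UNIV[of ?G, folded Pow_UNIV] A[unfolded borel_eq]
  proof (induction rule: sigma_sets_induct_disjoint)
    case (basic A)
    then show ?case using box by auto
  next
    case empty
    then show ?case by simp
  next
    case (compl A)
    have A: "A \<in> sets lebesgue" using compl(1) unfolding borel_eq[symmetric] by simp
    have "(LINT x|lebesgue. indicator (UNIV - A) x *\<^sub>R f x) = (LINT x|lebesgue. f x - indicator A x *\<^sub>R f x)"
      by (rule Bochner_Integration.integral_cong) (auto simp: indicator_def)
    also have "\<dots> = 0"
      using int[OF A] f compl integral_eq_0_if_box_integrals_0[OF f box] by simp
    finally show ?case .
  next
    case (union A)
    have A: "A i \<in> sets lebesgue" for i using union(2) unfolding borel_eq[symmetric] by auto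
    have "(LINT x:(\<Union>i. A i)|lebesgue. f x) = (\<Sum>i. LINT x:A i|lebesgue. f x)"
      using A union(1) int[of "\<Union>i. A i"]
      by (intro lebesgue_integral_countable_add) (auto simp: disjoint_family_on_def set_integrable_def)
    then show ?case using union(3) by (simp add: set_lebesgue_integral_def)
  qed
qed

lemma AE_eq_0_if_box_integrals_0:
  fixes f :: "'a::euclidean_space \<Rightarrow> 'b::{banach, second_countable_topology}"
  assumes f: "integrable lebesgue f"
    and box: "\<And>c d. (LINT x|lebesgue. indicator (box c d) x *\<^sub>R f x) = 0"
  shows "AE x in lebesgue. f x = 0"
proof (rule sigma_finite_measure.density_zero[OF sigma_finite_lebesgue f])
  fix A :: "'a set" assume A: "A \<in> sets lebesgue"
  then obtain B N N' where "A = B \<union> N" "N \<subseteq> N'" "N' \<in> null_sets lborel" and B: "B \<in> sets borel"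
    by (rule sets_completionE) auto
  from AE_not_in[OF null_sets_completionI[OF this(3)]]
  have "AE x in lebesgue. indicator A x *\<^sub>R f x = indicator B x *\<^sub>R f x"
    by eventually_elim (use \<open>A = B \<union> N\<close> \<open>N \<subseteq> N'\<close> in \<open>auto simp: indicator_def\<close>)
  then have "set_lebesgue_integral lebesgue A f = (LINT x|lebesgue. indicator B x *\<^sub>R f x)"
    unfolding set_lebesgue_integral_def
    using A B by (intro integral_cong_AE borel_measurable_integrable integrable_mult_indicator[OF _ f]) auto
  then show "set_lebesgue_integral lebesgue A f = 0"
    by (simp add: integral_indicator_eq_0_if_box_integrals_0[OF f box B])
qed

lemma AE_on_open_if_AE_on_boxes:
  fixes \<Omega> :: "'a::euclidean_space set"
  assumes \<Omega>: "open \<Omega>" and loc: "\<And>a b. cbox a b \<subseteq> \<Omega> \<Longrightarrow> AE x in lebesgue. x \<in> box a b \<longrightarrow> P x"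
  shows "AE x in lebesgue_on \<Omega>. P x"
proof -
  define F where "F = {S. \<exists>a b. S = box a b \<and> cbox a b \<subseteq> \<Omega>}"
  have "\<And>S. S \<in> F \<Longrightarrow> open S" by (auto simp: F_def)
  then obtain F' where F': "F' \<subseteq> F" "countable F'" "\<Union>F' = \<Union>F" by (rule Lindelof)
  have "\<Omega> \<subseteq> \<Union>F"
  proof
    fix x assume "x \<in> \<Omega>"
    then obtain a b where "cbox a b \<subseteq> \<Omega>" "x \<in> box a b"
      using open_contains_cbox[OF \<Omega>] by metis
    then show "x \<in> \<Union>F" by (auto simp: F_def)
  qed
  then have cover: "\<Omega> \<subseteq> \<Union>F'" using F'(3) by simp
  have "AE x in lebesgue. \<forall>S\<in>F'. x \<in> S \<longrightarrow> P x"
    unfolding AE_ball_countable[OF F'(2)] using F'(1) loc by (auto simp: F_def)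
  then have "AE x in lebesgue. x \<in> \<Omega> \<longrightarrow> P x"
    by eventually_elim (use cover in blast)
  then show ?thesis using \<Omega> by (simp add: AE_restrict_space_iff borel_open)
qed

lemma L1loc_mult_integrable:
  fixes \<Omega> K :: "(real^'n) set"
  assumes \<Omega>: "open \<Omega>" and g: "L1loc \<Omega> g" and K: "compact K" "K \<subseteq> \<Omega>"
    and \<psi>: "\<psi> \<in> borel_measurable borel" "\<And>x. cmod (\<psi> x) \<le> c" and out: "\<And>x. x \<notin> K \<Longrightarrow> \<psi> x = 0"
  shows "integrable (lebesgue_on \<Omega>) (\<lambda>x. g x * \<psi> x)"
proof -
  have integrable_K: "integrable (lebesgue_on K) g" using g K by (simp add: L1loc_def)
  have "\<psi> \<in> borel_measurable (lebesgue_on K)"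
    using \<psi>(1) by (simp add: measurable_restrict_space1 measurable_completion)
  moreover have "c \<ge> 0" using \<psi>(2)[of undefined] norm_ge_zero order_trans by blast
  then have "norm (g x * \<psi> x) \<le> norm (norm (g x) * c)" for x
    using \<psi>(2)[of x] by (simp add: norm_mult mult_left_mono)
  moreover have "integrable (lebesgue_on K) (\<lambda>x. norm (g x) * c)" using integrable_K by simp
  moreover have "g \<in> borel_measurable (lebesgue_on K)" using integrable_K by simp
  ultimately have "integrable (lebesgue_on K) (\<lambda>x. g x * \<psi> x)"
    by (blast intro: Bochner_Integration.integrable_bound[OF _ borel_measurable_times AE_I2])
  moreover have "K \<in> sets lebesgue" using K(1) by (simp add: compact_imp_closed)
  moreover have "(\<lambda>x. indicator \<Omega> x *\<^sub>R (g x * \<psi> x)) = (\<lambda>x. indicator K x *\<^sub>R (g x * \<psi> x))"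
    using K(2) out by (auto simp: indicator_def fun_eq_iff)
  ultimately show ?thesis using \<Omega> by (simp add: integrable_restrict_space borel_open)
qed

lemma test_fn_borel: "test_fn \<Omega> \<phi> \<Longrightarrow> \<phi> \<in> borel_measurable borel" "test_fn \<Omega> \<phi> \<Longrightarrow> continuous_on UNIV \<phi>"
proof -
  assume "test_fn \<Omega> \<phi>"
  then have "iter_partial [] \<phi> differentiable (at x)" for x by (simp only: test_fn_def smooth_def)
  then show continuous: "continuous_on UNIV \<phi>"
    by (auto intro!: continuous_at_imp_continuous_on differentiable_imp_continuous_within)
  then show "\<phi> \<in> borel_measurable borel" by (rule borel_measurable_continuous_onI)
qed

lemma du_Bois_Reymond_box:
  fixes \<Omega> :: "(real^'n) set"
  assumes \<Omega>: "open \<Omega>" and f: "L1loc \<Omega> f"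
    and weak: "\<And>\<phi>. test_fn \<Omega> \<phi> \<Longrightarrow> (LINT x|lebesgue_on \<Omega>. f x * \<phi> x) = 0"
    and ab: "cbox a b \<subseteq> \<Omega>"
  shows "(LINT x|lebesgue. indicator (box a b) x *\<^sub>R f x) = 0"
proof -
  note outside = box_cutoff_eq_0[OF contra_subsetD[OF box_subset_cbox]]
  have int_box: "integrable (lebesgue_on \<Omega>) (\<lambda>x. f x * indicator (box a b) x)"
    by (rule L1loc_mult_integrable[OF \<Omega> f compact_cbox ab, of _ 1])
      (use box_subset_cbox in \<open>auto simp: indicator_def\<close>)
  have int_cutoff: "integrable (lebesgue_on \<Omega>) (\<lambda>x. f x * box_cutoff a b m x)" for m
    by (rule L1loc_mult_integrable[OF \<Omega> f compact_cbox ab test_fn_borel(1)[OF test_fn_box_cutoff[OF ab]]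
        norm_box_cutoff_le_1 outside])
  have "(\<lambda>m. LINT x|lebesgue_on \<Omega>. f x * box_cutoff a b m x) \<longlonglongrightarrow> (LINT x|lebesgue_on \<Omega>. f x * indicator (box a b) x)"
  proof (rule integral_dominated_convergence[where w = "\<lambda>x. norm (f x * indicator (box a b) x)"])
    show "AE x in lebesgue_on \<Omega>. (\<lambda>m. f x * box_cutoff a b m x) \<longlonglongrightarrow> f x * indicator (box a b) x"
      by (intro AE_I2 tendsto_intros box_cutoff_tendsto_indicator)
    show "AE x in lebesgue_on \<Omega>. norm (f x * box_cutoff a b m x) \<le> norm (f x * indicator (box a b) x)" for m
      by (intro AE_I2) (auto simp: norm_mult indicator_def mult_left_le norm_box_cutoff_le_1 box_cutoff_eq_0)
  qed (use int_box int_cutoff in auto)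
  then have "(LINT x|lebesgue_on \<Omega>. f x * indicator (box a b) x) = 0"
    using weak[OF test_fn_box_cutoff[OF ab]] by (simp add: LIMSEQ_const_iff)
  moreover have "(LINT x|lebesgue_on \<Omega>. f x * indicator (box a b) x)
      = (LINT x|lebesgue. indicator \<Omega> x *\<^sub>R (f x * indicator (box a b) x))"
    using \<Omega> by (subst integral_restrict_space) (auto simp: borel_open)
  moreover have "(\<lambda>x. indicator \<Omega> x *\<^sub>R (f x * indicator (box a b) x)) = (\<lambda>x. indicator (box a b) x *\<^sub>R f x)"
    using ab box_subset_cbox[of a b] by (auto simp: indicator_def fun_eq_iff)
  ultimately show ?thesis by simp
qed

theorem du_Bois_Reymond:
  fixes \<Omega> :: "(real^'n) set"
  assumes \<Omega>: "open \<Omega>" and f: "L1loc \<Omega> f"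
    and weak: "\<And>\<phi>. test_fn \<Omega> \<phi> \<Longrightarrow> (LINT x|lebesgue_on \<Omega>. f x * \<phi> x) = 0"
  shows "AE x in lebesgue_on \<Omega>. f x = 0"
proof (rule AE_on_open_if_AE_on_boxes[OF \<Omega>])
  fix a b :: "real^'n" assume ab: "cbox a b \<subseteq> \<Omega>"
  define h where "h x = indicator (box a b) x *\<^sub>R f x" for x
  have "integrable (lebesgue_on (cbox a b)) f" using f ab by (simp add: L1loc_def)
  then have "integrable lebesgue (\<lambda>x. indicator (cbox a b) x *\<^sub>R f x)"
    by (simp add: integrable_restrict_space)
  then have "integrable lebesgue (\<lambda>x. indicator (box a b) x *\<^sub>R (indicator (cbox a b) x *\<^sub>R f x))"
    by (rule integrable_mult_indicator[rotated]) simp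
  also have "(\<lambda>x. indicator (box a b) x *\<^sub>R (indicator (cbox a b) x *\<^sub>R f x)) = h"
    using box_subset_cbox[of a b] by (auto simp: h_def indicator_def fun_eq_iff)
  finally have "integrable lebesgue h" .
  moreover have "(LINT x|lebesgue. indicator (box c d) x *\<^sub>R h x) = 0" for c d
  proof -
    obtain p q where pq: "box c d \<inter> box a b = box p q" by (rule that[OF box_Int_box])
    have eq: "(\<lambda>x. indicator (box c d) x *\<^sub>R h x) = (\<lambda>x. indicator (box p q) x *\<^sub>R f x)"
      by (auto simp: h_def indicator_def fun_eq_iff simp flip: pq)
    show ?thesis
    proof (cases "box p q = {}")
      case False
      then have "cbox p q = closure (box c d \<inter> box a b)" using pq by simp
      also have "\<dots> \<subseteq> cbox a b"
        by (intro closure_minimal) (use box_subset_cbox[of a b] in auto)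
      finally show ?thesis unfolding eq using du_Bois_Reymond_box[OF \<Omega> f weak] ab by blast
    qed (simp add: eq)
  qed
  ultimately have "AE x in lebesgue. h x = 0" by (rule AE_eq_0_if_box_integrals_0)
  then show "AE x in lebesgue. x \<in> box a b \<longrightarrow> f x = 0" by eventually_elim (auto simp: h_def)
qed

lemma L2_imp_L1loc:
  fixes \<Omega> :: "(real^'n) set"
  assumes \<Omega>: "open \<Omega>" and u: "L2 \<Omega> u"
  shows "L1loc \<Omega> u"
  unfolding L1loc_def
proof (intro conjI allI impI)
  show "u \<in> borel_measurable (lebesgue_on \<Omega>)" using u by (simp add: L2_def)
  fix K assume K: "compact K \<and> K \<subseteq> \<Omega>"
  then have K_measurable: "K \<in> sets lebesgue" by (simp add: compact_imp_closed)
  have "set_integrable lebesgue \<Omega> (\<lambda>x. (cmod (u x))\<^sup>2)"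
    using u \<Omega> by (simp add: L2_def set_integrable_def integrable_restrict_space borel_open)
  then have "set_integrable lebesgue K (\<lambda>x. (cmod (u x))\<^sup>2)"
    by (rule set_integrable_subset) (use K K_measurable in auto)
  moreover have "set_integrable lebesgue K (\<lambda>x. 1 :: real)"
    using K K_measurable fmeasurableD2[OF lmeasurable_compact[of K]]
    by (simp add: set_integrable_def integrable_real_indicator less_top)
  ultimately have int: "integrable (lebesgue_on K) (\<lambda>x. 1 + (cmod (u x))\<^sup>2)"
    using K_measurable by (simp add: set_integrable_def integrable_restrict_space)
  have "cmod (u x) \<le> 1 + (cmod (u x))\<^sup>2" for x
    using sum_squares_bound[of 1 "cmod (u x)"] norm_ge_zero[of "u x"] unfolding one_power2 mult_1_right by linarith
  then have "norm (u x) \<le> norm (1 + (cmod (u x))\<^sup>2)" for x by (smt (verit) real_norm_def)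
  moreover have "u \<in> borel_measurable (lebesgue_on K)"
    using u K by (auto simp: L2_def intro: measurable_restrict_mono)
  ultimately show "integrable (lebesgue_on K) u"
    by (intro Bochner_Integration.integrable_bound[OF int]) auto
qed

lemma test_fn_partial:
  assumes "test_fn \<Omega> \<phi>"
  shows "continuous_on UNIV (partial k \<phi>)" "\<And>x. x \<notin> tsupp \<phi> \<Longrightarrow> partial k \<phi> x = 0"
proof -
  have "iter_partial [k] \<phi> differentiable (at x)" for x using assms unfolding test_fn_def smooth_def by blast
  then show "continuous_on UNIV (partial k \<phi>)"
    by (auto intro!: continuous_at_imp_continuous_on differentiable_imp_continuous_within)
  fix x assume x: "x \<notin> tsupp \<phi>"
  have "open (- tsupp \<phi>)" by (simp add: tsupp_def open_Compl)
  then have "(\<phi> has_derivative (\<lambda>h. 0)) (at x)"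
  proof (rule has_derivative_transform_within_open[of "\<lambda>x. 0", rotated])
    show "\<And>y. y \<in> - tsupp \<phi> \<Longrightarrow> 0 = \<phi> y" using closure_subset by (force simp: tsupp_def)
  qed (use x in auto)
  then show "partial k \<phi> x = 0" by (simp add: partial_def frechet_derivative_at[symmetric])
qed

lemma L1loc_mult_continuous_integrable:
  assumes \<Omega>: "open \<Omega>" and g: "L1loc \<Omega> g" and K: "compact K" "K \<subseteq> \<Omega>"
    and \<psi>: "continuous_on UNIV \<psi>" "\<And>x. x \<notin> K \<Longrightarrow> \<psi> x = 0"
  shows "integrable (lebesgue_on \<Omega>) (\<lambda>x. g x * \<psi> x)"
proof -
  have "bounded (\<psi> ` K)"
    using \<psi>(1) K(1) by (intro compact_imp_bounded compact_continuous_image) (auto intro: continuous_on_subset)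
  then obtain c where "\<And>x. x \<in> K \<Longrightarrow> cmod (\<psi> x) \<le> c" by (auto simp: bounded_iff)
  then have "cmod (\<psi> x) \<le> max c 0" for x using \<psi>(2)[of x] by (cases "x \<in> K") (auto simp: le_max_iff_disj)
  with borel_measurable_continuous_onI[OF \<psi>(1)] show ?thesis
    by (rule L1loc_mult_integrable[OF \<Omega> g K _ _ \<psi>(2)])
qed

lemma test_fn_mult_integrable:
  assumes \<Omega>: "open \<Omega>" and g: "L1loc \<Omega> g" and \<phi>: "test_fn \<Omega> \<phi>"
  shows "integrable (lebesgue_on \<Omega>) (\<lambda>x. g x * \<phi> x)" "integrable (lebesgue_on \<Omega>) (\<lambda>x. g x * partial k \<phi> x)"
proof -
  have supp: "compact (tsupp \<phi>)" "tsupp \<phi> \<subseteq> \<Omega>" using \<phi> by (auto simp: test_fn_def)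
  have "\<phi> x = 0" if "x \<notin> tsupp \<phi>" for x using that closure_subset by (force simp: tsupp_def)
  then show "integrable (lebesgue_on \<Omega>) (\<lambda>x. g x * \<phi> x)"
    by (rule L1loc_mult_continuous_integrable[OF \<Omega> g supp test_fn_borel(2)[OF \<phi>]])
  show "integrable (lebesgue_on \<Omega>) (\<lambda>x. g x * partial k \<phi> x)"
    by (rule L1loc_mult_continuous_integrable[OF \<Omega> g supp test_fn_partial[OF \<phi>]])
qed

lemma weak_grad_linear:
  fixes \<Omega> :: "(real^'n) set"
  assumes \<Omega>: "open \<Omega>" and u: "L2 \<Omega> u" and v: "L2 \<Omega> v"
    and G: "weak_grad \<Omega> u G" and H: "weak_grad \<Omega> v H"
    and K: "weak_grad \<Omega> (\<lambda>x. u x + c * v x) K"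
  shows "AE x in lebesgue_on \<Omega>. K x = G x + c *s H x"
proof -
  have "AE x in lebesgue_on \<Omega>. K x $ k - (G x $ k + c * H x $ k) = 0" for k
  proof (rule du_Bois_Reymond[OF \<Omega>])
    have L1loc: "L1loc \<Omega> (\<lambda>x. G x $ k)" "L1loc \<Omega> (\<lambda>x. H x $ k)" "L1loc \<Omega> (\<lambda>x. K x $ k)"
      using G H K by (auto simp: weak_grad_def)
    then show "L1loc \<Omega> (\<lambda>x. K x $ k - (G x $ k + c * H x $ k))"
      by (auto simp: L1loc_def)
    fix \<phi> assume \<phi>: "test_fn \<Omega> \<phi>"
    note int = test_fn_mult_integrable(1)[OF \<Omega> _ \<phi>] and int' = test_fn_mult_integrable(2)[OF \<Omega> L2_imp_L1loc[OF \<Omega>] \<phi>]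
    have "(LINT x|lebesgue_on \<Omega>. (K x $ k - (G x $ k + c * H x $ k)) * \<phi> x)
       = (LINT x|lebesgue_on \<Omega>. K x $ k * \<phi> x - (G x $ k * \<phi> x + c * (H x $ k * \<phi> x)))"
      by (rule Bochner_Integration.integral_cong) (auto simp: algebra_simps)
    also have "\<dots> = (LINT x|lebesgue_on \<Omega>. K x $ k * \<phi> x) - ((LINT x|lebesgue_on \<Omega>. G x $ k * \<phi> x)
        + c * (LINT x|lebesgue_on \<Omega>. H x $ k * \<phi> x))"
      using L1loc[THEN int] by simp
    also have "\<dots> = - (LINT x|lebesgue_on \<Omega>. (u x + c * v x) * partial k \<phi> x)
       + ((LINT x|lebesgue_on \<Omega>. u x * partial k \<phi> x) + c * (LINT x|lebesgue_on \<Omega>. v x * partial k \<phi> x))"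
      using G H K \<phi> by (simp add: weak_grad_def)
    also have "(LINT x|lebesgue_on \<Omega>. (u x + c * v x) * partial k \<phi> x)
       = (LINT x|lebesgue_on \<Omega>. u x * partial k \<phi> x + c * (v x * partial k \<phi> x))"
      by (rule Bochner_Integration.integral_cong) (auto simp: algebra_simps)
    also have "\<dots> = (LINT x|lebesgue_on \<Omega>. u x * partial k \<phi> x) + c * (LINT x|lebesgue_on \<Omega>. v x * partial k \<phi> x)"
      using int'[OF u] int'[OF v] by simp
    finally show "(LINT x|lebesgue_on \<Omega>. (K x $ k - (G x $ k + c * H x $ k)) * \<phi> x) = 0" by simp
  qed
  then have "AE x in lebesgue_on \<Omega>. \<forall>k. K x $ k - (G x $ k + c * H x $ k) = 0"
    by (subst AE_all_countable) auto
  then show ?thesis by eventually_elim (simp add: vec_eq_iff)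
qed

section \<open>Sectorial forms\<close>

lemma sectorD:
  assumes z: "z \<in> sector \<theta>" and \<theta>: "0 \<le> \<theta>" "\<theta> < pi / 2"
  shows "0 \<le> Re z" "\<bar>Im z\<bar> \<le> tan \<theta> * Re z"
proof -
  have "0 \<le> Re z \<and> \<bar>Im z\<bar> \<le> tan \<theta> * Re z"
  proof (cases "z = 0")
    case False
    define \<alpha> where "\<alpha> = Arg z"
    have \<alpha>: "\<bar>\<alpha>\<bar> \<le> \<theta>" using z False by (simp add: sector_def \<alpha>_def)
    have polar: "Re z = cmod z * cos \<alpha>" "Im z = cmod z * sin \<alpha>"
      using Arg_eq[OF False] by (metis \<alpha>_def rcis_cmod_Arg Re_rcis, metis \<alpha>_def rcis_cmod_Arg Im_rcis)
    have cos_pos: "0 < cos \<alpha>" using \<alpha> \<theta> by (intro cos_gt_zero_pi) auto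
    have "\<bar>sin \<alpha>\<bar> = sin \<bar>\<alpha>\<bar>"
      using \<alpha> \<theta> sin_ge_zero[of "\<bar>\<alpha>\<bar>"] by (cases "\<alpha> \<ge> 0") auto
    then have "\<bar>sin \<alpha>\<bar> / cos \<alpha> = tan \<bar>\<alpha>\<bar>" by (simp add: tan_def)
    also have "\<dots> \<le> tan \<theta>" using \<alpha> \<theta> by (intro tan_mono_le) auto
    finally have "\<bar>sin \<alpha>\<bar> \<le> tan \<theta> * cos \<alpha>" using cos_pos by (simp add: field_simps)
    then have "cmod z * \<bar>sin \<alpha>\<bar> \<le> cmod z * (tan \<theta> * cos \<alpha>)" by (rule mult_left_mono) simp
    then show ?thesis using cos_pos by (simp add: polar abs_mult mult.left_commute)
  qed simp
  then show "0 \<le> Re z" "\<bar>Im z\<bar> \<le> tan \<theta> * Re z" by auto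
qed

lemma sectorI:
  assumes re: "0 \<le> Re z" and z: "\<bar>Im z\<bar> \<le> c * Re z"
  shows "z \<in> sector (arctan c)"
proof (cases "Re z = 0")
  case True
  then have "z = 0" using z by (simp add: complex_eq_iff)
  then show ?thesis by (simp add: sector_def)
next
  case False
  then have pos: "Re z > 0" using re by simp
  then have "\<bar>Im z / Re z\<bar> \<le> c" using z by (simp add: field_simps)
  then have "arctan \<bar>Im z / Re z\<bar> \<le> arctan c" by (rule arctan_monotone')
  moreover have "\<bar>arctan t\<bar> = arctan \<bar>t\<bar>" for t by (cases "t \<ge> 0") (auto simp: arctan_minus abs_if)
  moreover have "Arg z = arctan (Im z / Re z)" using pos by (simp add: arg_conv_arctan)
  ultimately show ?thesis by (simp add: sector_def)
qed

lemma L2_eq_sq_integrable: "L2 \<Omega> = sq_integrable (lebesgue_on \<Omega>)" "L2v \<Omega> = sq_integrable (lebesgue_on \<Omega>)"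
  by (simp_all add: fun_eq_iff L2_def L2v_def sq_integrable_def)

lemma l2norm_eq_norm_L2: "l2norm \<Omega> = norm_L2 (lebesgue_on \<Omega>)" "l2vnorm \<Omega> = norm_L2 (lebesgue_on \<Omega>)"
  by (simp_all add: fun_eq_iff l2norm_def l2vnorm_def norm_L2_def)

lemma l2norm_nonneg [simp]: "0 \<le> l2norm \<Omega> u"
  by (simp add: l2norm_eq_norm_L2)

lemma scaleR_eq_cmult: "r *\<^sub>R u = (\<lambda>x. complex_of_real r * u x)"
  by (simp add: scaleR_fun_def scaleR_conv_of_real[where 'a=complex])

lemma linner_self: "linner \<Omega> u u = of_real ((l2norm \<Omega> u)\<^sup>2)"
  by (simp add: linner_def l2norm_def complex_norm_square[symmetric] del: of_real_power)

lemma cnj_linner: "cnj (linner \<Omega> u v) = linner \<Omega> v u"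
proof -
  have "cnj (LINT x|lebesgue_on \<Omega>. u x * cnj (v x)) = (LINT x|lebesgue_on \<Omega>. cnj (u x * cnj (v x)))"
    by (rule integral_bounded_linear'[OF bounded_linear_cnj bounded_linear_cnj, symmetric]) simp
  then show ?thesis by (simp add: linner_def mult.commute)
qed

lemma linner_bounded:
  assumes "L2 \<Omega> u" "L2 \<Omega> v"
  shows "integrable (lebesgue_on \<Omega>) (\<lambda>x. u x * cnj (v x))" "cmod (linner \<Omega> u v) \<le> l2norm \<Omega> u * l2norm \<Omega> v"
proof -
  have measurable: "(\<lambda>x. u x * cnj (v x)) \<in> borel_measurable (lebesgue_on \<Omega>)"
    using assms
    by (intro borel_measurable_times borel_measurable_continuous_on[of cnj])
      (auto simp: L2_def intro: continuous_on_cnj continuous_on_id)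
  show "integrable (lebesgue_on \<Omega>) (\<lambda>x. u x * cnj (v x))" "cmod (linner \<Omega> u v) \<le> l2norm \<Omega> u * l2norm \<Omega> v"
    using integral_norm_le_product[OF assms[unfolded L2_eq_sq_integrable] measurable, of 1]
    by (auto simp: norm_mult linner_def l2norm_eq_norm_L2)
qed

lemma linner_bounded_sesquilinear:
  "bounded_sesquilinear (Collect (L2 \<Omega>)) (inner_L2 (lebesgue_on \<Omega>)) (\<lambda>c u x. c * u x) (linner \<Omega>) 1"
proof -
  interpret semi_inner "Collect (L2 \<Omega>)" "inner_L2 (lebesgue_on \<Omega>)"
    unfolding L2_eq_sq_integrable by (rule semi_inner_L2)
  have add: "linner \<Omega> (u + v) w = linner \<Omega> u w + linner \<Omega> v w" if "L2 \<Omega> u" "L2 \<Omega> v" "L2 \<Omega> w" for u v w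
    using linner_bounded(1)[OF that(1,3)] linner_bounded(1)[OF that(2,3)]
    by (simp add: linner_def distrib_right)
  have mult: "linner \<Omega> (\<lambda>x. c * u x) w = c * linner \<Omega> u w" for c u w by (simp add: linner_def mult.assoc)
  show ?thesis
  proof unfold_locales
    fix x y z :: "real^'a \<Rightarrow> complex" and c
    assume x: "x \<in> Collect (L2 \<Omega>)" and y: "y \<in> Collect (L2 \<Omega>)"
    show "(\<lambda>a. c * x a) \<in> Collect (L2 \<Omega>)"
      using x by (auto simp: L2_def norm_mult power_mult_distrib intro: borel_measurable_times borel_measurable_const)
    show "nrm (\<lambda>a. c * x a) = cmod c * nrm x"
      by (simp add: nrm_inner_L2 norm_L2_def norm_mult power_mult_distrib real_sqrt_mult)
    show "linner \<Omega> x (\<lambda>a. c * y a) = cnj c * linner \<Omega> x y"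
      by (metis cnj_linner complex_cnj_mult mult)
    show "cmod (linner \<Omega> x y) \<le> 1 * (nrm x * nrm y)"
      using linner_bounded(2)[of \<Omega> x y] x y by (simp add: nrm_inner_L2 l2norm_eq_norm_L2)
    assume z: "z \<in> Collect (L2 \<Omega>)"
    show "linner \<Omega> x (y + z) = linner \<Omega> x y + linner \<Omega> x z"
      using x y z by (metis add cnj_linner complex_cnj_add mem_Collect_eq)
  qed (auto simp: add mult scaleR_eq_cmult fun_eq_iff algebra_simps)
qed

interpretation linner: bounded_sesquilinear "Collect (L2 \<Omega>)" "inner_L2 (lebesgue_on \<Omega>)" "\<lambda>c u x. c * u x" "linner \<Omega>" 1
  rewrites "u \<in> Collect (L2 \<Omega>) \<longleftrightarrow> L2 \<Omega> u"
    and "semi_inner.nrm (inner_L2 (lebesgue_on \<Omega>)) = l2norm \<Omega>"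
  for \<Omega> :: "(real^'n) set"
  by (simp_all add: linner_bounded_sesquilinear nrm_inner_L2 l2norm_eq_norm_L2)

lemmas L2_diff = linner.diff_in and L2_add = linner.add_in and L2_cmult = linner.smult_in

lemma linner_eq_if_null:
  assumes "L2 \<Omega> u" "L2 \<Omega> v" "L2 \<Omega> w" "l2norm \<Omega> (u - v) = 0"
  shows "linner \<Omega> u w = linner \<Omega> v w" "linner \<Omega> w u = linner \<Omega> w v"
  using assms linner.null_left[OF L2_diff[OF assms(1,2)] assms(3)] linner.null_right[OF assms(3) L2_diff[OF assms(1,2)]]
  by (simp_all add: linner.diff_left linner.diff_right)

locale sectorial_form =
  fixes \<Omega> :: "(real^'n) set" and b :: "(real^'n \<Rightarrow> complex) \<Rightarrow> (real^'n \<Rightarrow> complex) \<Rightarrow> complex"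
    and V :: "(real^'n \<Rightarrow> complex) set" and \<gamma> \<theta> :: real
  assumes sesq: "sesq_form \<Omega> b V"
    and \<theta>: "0 \<le> \<theta>" "\<theta> < pi / 2"
    and sector: "\<And>u. u \<in> V \<Longrightarrow> b u u - complex_of_real (\<gamma> * (l2norm \<Omega> u)\<^sup>2) \<in> sector \<theta>"
begin

definition shifted :: "(real^'n \<Rightarrow> complex) \<Rightarrow> (real^'n \<Rightarrow> complex) \<Rightarrow> complex" where
  "shifted u v = b u v + of_real (1 - \<gamma>) * linner \<Omega> u v"

definition form_ip :: "(real^'n \<Rightarrow> complex) \<Rightarrow> (real^'n \<Rightarrow> complex) \<Rightarrow> real" where
  "form_ip u v = (Re (shifted u v) + Re (shifted v u)) / 2"

lemma V_L2: "u \<in> V \<Longrightarrow> L2 \<Omega> u"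
  and V_0: "0 \<in> V"
  and V_add: "u \<in> V \<Longrightarrow> v \<in> V \<Longrightarrow> u + v \<in> V"
  and V_cmult: "u \<in> V \<Longrightarrow> (\<lambda>x. c * u x) \<in> V"
  using sesq unfolding sesq_form_def zero_fun_def plus_fun_def by blast+

lemma subspace_V: "subspace V"
  unfolding subspace_def scaleR_eq_cmult using V_0 V_add V_cmult by blast

lemma b_sesquilinear:
  assumes "u \<in> V" "v \<in> V" "w \<in> V"
  shows "b (u + v) w = b u w + b v w" "b w (u + v) = b w u + b w v"
  using sesq assms unfolding sesq_form_def plus_fun_def by blast+

lemma b_cmult:
  assumes "u \<in> V" "w \<in> V"
  shows "b (\<lambda>x. c * u x) w = c * b u w" "b w (\<lambda>x. c * u x) = cnj c * b w u"
  using sesq assms unfolding sesq_form_def by blast+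

lemma b_null: "u \<in> V \<Longrightarrow> v \<in> V \<Longrightarrow> l2norm \<Omega> u = 0 \<Longrightarrow> b u v = 0"
  using sesq unfolding sesq_form_def by blast

lemma shifted_sesquilinear:
  assumes "u \<in> V" "v \<in> V" "w \<in> V"
  shows "shifted (u + v) w = shifted u w + shifted v w" "shifted w (u + v) = shifted w u + shifted w v"
  using assms by (simp_all add: shifted_def b_sesquilinear linner.add_left linner.add_right V_L2 algebra_simps)

lemma shifted_cmult:
  assumes "u \<in> V" "w \<in> V"
  shows "shifted (\<lambda>x. c * u x) w = c * shifted u w" "shifted w (\<lambda>x. c * u x) = cnj c * shifted w u"
  using assms by (simp_all add: shifted_def b_cmult linner.smult_left linner.smult_right V_L2 algebra_simps)

lemma Re_shifted: "Re (shifted u u) = Re (b u u) + (1 - \<gamma>) * (l2norm \<Omega> u)\<^sup>2"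
  and Im_shifted: "Im (shifted u u) = Im (b u u)"
  by (simp_all add: shifted_def linner_self del: of_real_power)

lemma tan_nonneg: "0 \<le> tan \<theta>"
  using \<theta> tan_gt_zero[of \<theta>] by (cases "\<theta> = 0") auto

lemma Re_shifted_ge: "u \<in> V \<Longrightarrow> (l2norm \<Omega> u)\<^sup>2 \<le> Re (shifted u u)"
  and Im_shifted_le: "u \<in> V \<Longrightarrow> \<bar>Im (shifted u u)\<bar> \<le> tan \<theta> * Re (shifted u u)"
proof -
  assume u: "u \<in> V"
  note s = sectorD[OF sector[OF u] \<theta>]
  show "(l2norm \<Omega> u)\<^sup>2 \<le> Re (shifted u u)" using s(1) by (simp add: Re_shifted algebra_simps)
  have "tan \<theta> * (Re (b u u) - \<gamma> * (l2norm \<Omega> u)\<^sup>2) \<le> tan \<theta> * Re (shifted u u)"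
    using tan_nonneg by (intro mult_left_mono) (auto simp: Re_shifted algebra_simps)
  then show "\<bar>Im (shifted u u)\<bar> \<le> tan \<theta> * Re (shifted u u)" using s(2) by (simp add: Im_shifted)
qed

lemma semi_inner_form_ip: "semi_inner V form_ip"
proof
  show "form_ip (r *\<^sub>R x) y = r * form_ip x y" if "x \<in> V" "y \<in> V" for r x y
    using that by (simp add: form_ip_def scaleR_eq_cmult shifted_cmult algebra_simps add_divide_distrib)
  show "0 \<le> form_ip u u" if "u \<in> V" for u
    using order_trans[OF zero_le_power2 Re_shifted_ge[OF that]] by (simp add: form_ip_def)
qed (auto simp: form_ip_def shifted_sesquilinear subspace_V add_divide_distrib)

sublocale semi_inner V form_ip
  by (rule semi_inner_form_ip)

lemma nrm_eq_form_norm: "nrm u = form_norm \<Omega> b \<gamma> u"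
  by (simp add: nrm_def form_ip_def form_norm_def Re_shifted)

lemma nrm_power2_eq_Re_shifted: "u \<in> V \<Longrightarrow> (nrm u)\<^sup>2 = Re (shifted u u)"
  by (simp add: nrm_power2 form_ip_def)

lemma l2norm_le_nrm: "u \<in> V \<Longrightarrow> l2norm \<Omega> u \<le> nrm u"
  by (rule power2_le_imp_le) (simp_all add: nrm_power2_eq_Re_shifted Re_shifted_ge)

lemma nrm_eq_0_if_l2norm_eq_0: "u \<in> V \<Longrightarrow> l2norm \<Omega> u = 0 \<Longrightarrow> nrm u = 0"
  by (simp add: nrm_eq_form_norm form_norm_def b_null)

sublocale complex_semi_inner V form_ip "\<lambda>c u x. c * u x"
proof
  show "nrm (\<lambda>x. c * u x) = cmod c * nrm u" if u: "u \<in> V" for c u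
  proof -
    have "shifted (\<lambda>x. c * u x) (\<lambda>x. c * u x) = of_real ((cmod c)\<^sup>2) * shifted u u"
      using shifted_cmult(1)[OF u V_cmult[OF u, of c], of c] shifted_cmult(2)[OF u u, of c]
      by (simp add: complex_norm_square mult.assoc del: of_real_power)
    then have "(nrm (\<lambda>x. c * u x))\<^sup>2 = (cmod c * nrm u)\<^sup>2"
      using u V_cmult[OF u, of c] by (simp add: nrm_power2_eq_Re_shifted power_mult_distrib del: of_real_power)
    then show ?thesis using u V_cmult[OF u, of c] by (simp add: power2_eq_iff_nonneg)
  qed
qed (simp_all add: V_cmult scaleR_eq_cmult plus_fun_def algebra_simps)

text \<open>The imaginary part is a symmetric form \<open>h\<close> dominated by \<open>tan \<theta>\<close> times the inner product,
  and \<open>Re (shifted u v) = form_ip u v - h u (\<i> v)\<close>.\<close>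

lemma Re_shifted_bound:
  assumes u: "u \<in> V" and v: "v \<in> V"
  shows "\<bar>Re (shifted u v)\<bar> \<le> (1 + tan \<theta>) * (nrm u * nrm v)"
proof -
  define h where "h u v = (Im (shifted u v) + Im (shifted v u)) / 2" for u v
  let ?iv = "\<lambda>x. \<i> * v x"
  have iv_in_V: "?iv \<in> V" by (rule V_cmult[OF v])
  have "\<bar>h u ?iv\<bar> \<le> tan \<theta> * (nrm u * nrm ?iv)"
  proof (rule symmetric_form_bound[OF _ _ _ _ u iv_in_V])
    show "\<bar>h x x\<bar> \<le> tan \<theta> * form_ip x x" if "x \<in> V" for x
      using Im_shifted_le[OF that] by (simp add: h_def form_ip_def)
    show "h (r *\<^sub>R x) y = r * h x y" if "x \<in> V" "y \<in> V" for r x y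
      using that by (simp add: h_def scaleR_eq_cmult shifted_cmult algebra_simps add_divide_distrib)
    show "h (x + y) z = h x z + h y z" if "x \<in> V" "y \<in> V" "z \<in> V" for x y z
      unfolding h_def shifted_sesquilinear[OF that] by (simp add: add_divide_distrib)
  qed (simp add: h_def)
  then have "\<bar>h u ?iv\<bar> \<le> tan \<theta> * (nrm u * nrm v)" by (simp add: nrm_smult v)
  moreover have "Re (shifted u v) = form_ip u v - h u ?iv"
    by (simp add: h_def form_ip_def shifted_cmult u v field_simps)
  ultimately show ?thesis using cauchy_schwarz[OF u v] by (simp add: algebra_simps)
qed

lemma shifted_bound:
  assumes u: "u \<in> V" and v: "v \<in> V"
  shows "cmod (shifted u v) \<le> (1 + tan \<theta>) * (nrm u * nrm v)"
proof (cases "shifted u v = 0")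
  case False
  define c where "c = cnj (shifted u v) / of_real (cmod (shifted u v))"
  have "cmod c = 1" using False by (simp add: c_def norm_divide)
  have "c * shifted u v = of_real (cmod (shifted u v))"
    using False complex_norm_square[of "shifted u v"]
    by (simp add: c_def power2_eq_square mult.commute nonzero_divide_eq_eq)
  then have "shifted (\<lambda>x. c * u x) v = of_real (cmod (shifted u v))" by (simp add: shifted_cmult u v)
  then have "cmod (shifted u v) \<le> \<bar>Re (shifted (\<lambda>x. c * u x) v)\<bar>" by simp
  also have "\<dots> \<le> (1 + tan \<theta>) * (nrm (\<lambda>x. c * u x) * nrm v)" by (rule Re_shifted_bound[OF V_cmult[OF u] v])
  finally show ?thesis by (simp add: nrm_smult u \<open>cmod c = 1\<close>)
qed (use tan_nonneg u v in simp)

sublocale bounded_sesquilinear V form_ip "\<lambda>c u x. c * u x" b "1 + tan \<theta> + \<bar>1 - \<gamma>\<bar>"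
proof
  show "cmod (b u v) \<le> (1 + tan \<theta> + \<bar>1 - \<gamma>\<bar>) * (nrm u * nrm v)" if u: "u \<in> V" and v: "v \<in> V" for u v
  proof -
    have "cmod (b u v) \<le> cmod (shifted u v) + cmod (of_real (1 - \<gamma>) * linner \<Omega> u v)"
      using norm_triangle_ineq4[of "shifted u v" "of_real (1 - \<gamma>) * linner \<Omega> u v"] by (simp add: shifted_def)
    also have "cmod (of_real (1 - \<gamma>) * linner \<Omega> u v) = \<bar>1 - \<gamma>\<bar> * cmod (linner \<Omega> u v)"
      unfolding norm_mult norm_of_real ..
    also have "\<dots> \<le> \<bar>1 - \<gamma>\<bar> * (nrm u * nrm v)"
      using linner_bounded(2)[OF V_L2[OF u] V_L2[OF v]] u v
      by (intro mult_left_mono order_trans[OF _ mult_mono[OF l2norm_le_nrm l2norm_le_nrm]]) auto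
    finally show ?thesis using shifted_bound[OF u v] by (simp add: algebra_simps)
  qed
qed (use tan_nonneg in \<open>auto simp: b_sesquilinear b_cmult\<close>)

end

section \<open>Elliptic forms and their associated operators\<close>

locale elliptic_form = bounded_sesquilinear V ip smult a K + semi_hilbert V ip
  for V :: "'a::real_vector set" and ip smult a K +
  fixes \<Omega> :: "(real^'n) set" and j :: "'a \<Rightarrow> real^'n \<Rightarrow> complex" and \<mu> \<omega> :: real
  assumes j_add: "\<And>U W. U \<in> V \<Longrightarrow> W \<in> V \<Longrightarrow> j (U + W) = j U + j W"
    and j_smult: "\<And>c U. U \<in> V \<Longrightarrow> j (smult c U) = (\<lambda>x. c * j U x)"
    and j_L2: "\<And>U. U \<in> V \<Longrightarrow> L2 \<Omega> (j U)"
    and j_bounded: "\<And>U. U \<in> V \<Longrightarrow> l2norm \<Omega> (j U) \<le> nrm U"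
    and \<mu>_pos: "0 < \<mu>"
    and elliptic: "\<And>U. U \<in> V \<Longrightarrow> \<mu> * (nrm U)\<^sup>2 \<le> Re (a U U) + \<omega> * (l2norm \<Omega> (j U))\<^sup>2"
begin

lemma j_diff: "U \<in> V \<Longrightarrow> W \<in> V \<Longrightarrow> j (U - W) = j U - j W"
  using j_add[of "U - W" W] diff_in[of U W] by simp

lemma l2norm_j_diff_le: "U \<in> V \<Longrightarrow> W \<in> V \<Longrightarrow> l2norm \<Omega> (j U - j W) \<le> nrm (U - W)"
  using j_bounded[OF diff_in[of U W]] by (simp add: j_diff)

definition coercive_shift :: "'a \<Rightarrow> 'a \<Rightarrow> complex" where
  "coercive_shift U W = a U W + of_real \<omega> * linner \<Omega> (j U) (j W)"

lemma coercive_shift_coercive: "coercive_sesquilinear V ip smult coercive_shift (K + \<bar>\<omega>\<bar>) \<mu>"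
proof unfold_locales
  show "cmod (coercive_shift U W) \<le> (K + \<bar>\<omega>\<bar>) * (nrm U * nrm W)" if U: "U \<in> V" and W: "W \<in> V" for U W
  proof -
    have "cmod (linner \<Omega> (j U) (j W)) \<le> nrm U * nrm W"
      using U W by (intro order_trans[OF linner_bounded(2) mult_mono] j_bounded j_L2) auto
    then have "\<bar>\<omega>\<bar> * cmod (linner \<Omega> (j U) (j W)) \<le> \<bar>\<omega>\<bar> * (nrm U * nrm W)" by (rule mult_left_mono) simp
    then have "cmod (a U W) + cmod (of_real \<omega> * linner \<Omega> (j U) (j W)) \<le> K * (nrm U * nrm W) + \<bar>\<omega>\<bar> * (nrm U * nrm W)"
      unfolding norm_mult norm_of_real by (intro add_mono bounded U W)
    then show ?thesis
      unfolding coercive_shift_def distrib_right by (rule order_trans[OF norm_triangle_ineq])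
  qed
  show "\<mu> * (nrm U)\<^sup>2 \<le> Re (coercive_shift U U)" if "U \<in> V" for U
    using elliptic[OF that] by (simp add: coercive_shift_def linner_self del: of_real_power)
qed (auto simp: coercive_shift_def add_left add_right smult_left smult_right j_add j_smult j_L2 \<mu>_pos
    linner.add_left linner.add_right linner.smult_left linner.smult_right bound_nonneg algebra_simps)

sublocale coercive_shift: coercive_sesquilinear V ip smult coercive_shift "K + \<bar>\<omega>\<bar>" \<mu>
  by (rule coercive_shift_coercive)

lemma coercive_shift_solvable:
  assumes f: "L2 \<Omega> f"
  shows "\<exists>U\<in>V. \<forall>W\<in>V. coercive_shift U W = linner \<Omega> f (j W)"
    and "\<exists>U\<in>V. \<forall>W\<in>V. coercive_shift W U = linner \<Omega> (j W) f"
proof -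
  have bound: "cmod (linner \<Omega> f (j W)) \<le> l2norm \<Omega> f * nrm W" if "W \<in> V" for W
    using linner_bounded(2)[OF f j_L2[OF that]] mult_left_mono[OF j_bounded[OF that], of "l2norm \<Omega> f"] by simp
  then show "\<exists>U\<in>V. \<forall>W\<in>V. coercive_shift U W = linner \<Omega> f (j W)"
    by (intro coercive_shift.lax_milgram[where L = "l2norm \<Omega> f"])
      (simp_all add: j_add j_smult j_L2 f linner.add_right linner.smult_right)
  have "cmod (linner \<Omega> (j W) f) \<le> l2norm \<Omega> f * nrm W" if "W \<in> V" for W
    using bound[OF that] by (metis cnj_linner complex_mod_cnj)
  then show "\<exists>U\<in>V. \<forall>W\<in>V. coercive_shift W U = linner \<Omega> (j W) f"
    by (intro coercive_shift.lax_milgram_adjoint[where L = "l2norm \<Omega> f"])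
      (simp_all add: j_add j_smult j_L2 f linner.add_left linner.smult_left)
qed

end

locale elliptic_form_core = elliptic_form V ip smult a K \<Omega> j \<mu> \<omega>
  for V :: "'a::real_vector set" and ip smult a K and \<Omega> :: "(real^'n) set" and j \<mu> \<omega> +
  fixes D :: "(real^'n \<Rightarrow> complex) set" and G :: "(real^'n \<Rightarrow> complex) \<Rightarrow> 'a"
    and r :: "(real^'n \<Rightarrow> complex) \<Rightarrow> (real^'n \<Rightarrow> complex) \<Rightarrow> complex"
  assumes G_in: "\<And>u. u \<in> D \<Longrightarrow> G u \<in> V"
    and j_G: "\<And>u. u \<in> D \<Longrightarrow> j (G u) = u"
    and G_dense: "V \<subseteq> nrm_closure (G ` D)"
    and r_eq: "\<And>u v. u \<in> D \<Longrightarrow> v \<in> D \<Longrightarrow> r u v = a (G u) (G v)"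
begin

lemma core_sequence:
  assumes "U \<in> V"
  obtains s where "\<And>n::nat. s n \<in> D" "nrm_lim (\<lambda>n. G (s n)) U"
proof -
  obtain t where t: "\<And>n::nat. t n \<in> G ` D" "nrm_lim t U"
    using nrm_closure_sequence[of "G ` D" U] G_in G_dense assms by blast
  then have "\<forall>n. \<exists>u\<in>D. t n = G u" by blast
  then obtain s where s: "\<And>n. s n \<in> D" "\<And>n. t n = G (s n)" by metis
  have "nrm_lim (\<lambda>n. G (s n)) U" using t(2) by (simp add: nrm_lim_def s(2))
  with s(1) show thesis by (rule that)
qed

lemma assoc_opI:
  assumes x: "L2 \<Omega> x" and f: "L2 \<Omega> f" and U: "U \<in> V" "l2norm \<Omega> (j U - x) = 0"
    and eq: "\<And>W. W \<in> V \<Longrightarrow> a U W = linner \<Omega> f (j W)"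
  shows "(x, f) \<in> assoc_op \<Omega> r D"
proof -
  obtain s where s: "\<And>n. s n \<in> D" and lim: "nrm_lim (\<lambda>n. G (s n)) U" using core_sequence[OF U(1)] by blast
  have G: "G (s n) \<in> V" for n by (rule G_in[OF s])
  have "(\<lambda>n. l2norm \<Omega> (s n - x)) \<longlonglongrightarrow> 0"
  proof (rule nrm_lim_subst_le[OF lim l2norm_nonneg])
    show "l2norm \<Omega> (s n - x) \<le> 1 * nrm (G (s n) - U)" for n
      using linner.nrm_triangle_diff[OF j_L2[OF G] j_L2[OF U(1)] x, of n] l2norm_j_diff_le[OF G U(1), of n] U(2)
      by (simp add: j_G s)
  qed
  moreover obtain R where R: "0 \<le> R" "\<And>n. nrm (G (s n)) \<le> R" using nrm_lim_bounded[OF G U(1) lim] by blast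
  have "Re (r (s n) (s n)) \<le> K * (R * R)" for n
    unfolding r_eq[OF s s] using R bound_nonneg
    by (intro order_trans[OF complex_Re_le_cmod] order_trans[OF bounded[OF G G]] mult_left_mono mult_mono)
      (auto simp: G)
  moreover have "(\<lambda>n. r (s n) v) \<longlonglongrightarrow> linner \<Omega> f v" if v: "v \<in> D" for v
    using nrm_lim_left[OF G U(1) G_in[OF v] lim] by (simp add: r_eq s v eq G_in j_G)
  ultimately show ?thesis using x f s unfolding assoc_op_def fun_diff_def by blast
qed

lemma nrm_G_bounded:
  assumes s: "\<And>n::nat. s n \<in> D" and x: "L2 \<Omega> x" and lim: "(\<lambda>n. l2norm \<Omega> (s n - x)) \<longlonglongrightarrow> 0"
    and C: "\<And>n. Re (r (s n) (s n)) \<le> C"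
  obtains R where "0 \<le> R" "\<And>n. nrm (G (s n)) \<le> R"
proof -
  have "L2 \<Omega> (s n)" for n using j_L2[OF G_in[OF s]] by (simp add: j_G[OF s])
  then obtain Q where Q: "\<And>n. l2norm \<Omega> (s n) \<le> Q"
    using linner.nrm_lim_bounded[OF _ x] lim unfolding linner.nrm_lim_def by blast
  define R where "R = sqrt ((\<bar>C\<bar> + \<bar>\<omega>\<bar> * Q\<^sup>2) / \<mu>)"
  have "nrm (G (s n)) \<le> R" for n
  proof -
    have "\<mu> * (nrm (G (s n)))\<^sup>2 \<le> Re (r (s n) (s n)) + \<omega> * (l2norm \<Omega> (s n))\<^sup>2"
      using elliptic[OF G_in[OF s]] by (simp add: r_eq s j_G)
    also have "\<dots> \<le> \<bar>C\<bar> + \<bar>\<omega>\<bar> * Q\<^sup>2"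
      using C[of n] by (intro add_mono mult_mono power_mono Q) auto
    finally have "(nrm (G (s n)))\<^sup>2 \<le> (\<bar>C\<bar> + \<bar>\<omega>\<bar> * Q\<^sup>2) / \<mu>" using \<mu>_pos by (simp add: field_simps)
    then show ?thesis unfolding R_def by (rule real_le_rsqrt)
  qed
  moreover have "0 \<le> R" using \<mu>_pos by (simp add: R_def)
  ultimately show thesis by (rule that[rotated])
qed

lemma coercive_shift_weak_limit:
  assumes s: "\<And>n::nat. s n \<in> D" and R: "\<And>n. nrm (G (s n)) \<le> R" and U: "U \<in> V" and w: "w \<in> V"
    and lim: "\<And>v. v \<in> D \<Longrightarrow> (\<lambda>n. coercive_shift (G (s n)) (G v)) \<longlonglongrightarrow> coercive_shift U (G v)"
  shows "(\<lambda>n. coercive_shift (G (s n) - U) w) \<longlonglongrightarrow> 0"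
proof (rule coercive_shift.tendsto_0_on_closure)
  note G = G_in[OF s]
  show "w \<in> nrm_closure (G ` D)" using w G_dense by blast
  show "nrm (G (s n) - U) \<le> R + nrm U" for n
    using nrm_triangle_diff[OF G zero_in U, of n] nrm_minus_commute[OF zero_in U] R[of n] by simp
  fix W assume "W \<in> G ` D"
  then obtain v where v: "v \<in> D" and W: "W = G v" by blast
  have "(\<lambda>n. coercive_shift (G (s n)) W - coercive_shift U W) \<longlonglongrightarrow> coercive_shift U W - coercive_shift U W"
    unfolding W by (intro tendsto_intros lim v)
  then show "(\<lambda>n. coercive_shift (G (s n) - U) W) \<longlonglongrightarrow> 0"
    by (simp add: coercive_shift.diff_left G U W G_in v)
qed (use G_in s U in \<open>auto intro: diff_in\<close>)

text \<open>With \<open>y = x - j U\<close>, testing \<open>G (s n) - U\<close> with the solution of the adjoint problem for \<open>y\<close>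
  yields \<open>linner \<Omega> y y = 0\<close>.\<close>

lemma L2_limit_eq_weak_limit:
  assumes s: "\<And>n::nat. s n \<in> D" and R: "\<And>n. nrm (G (s n)) \<le> R" and U: "U \<in> V"
    and lim: "\<And>v. v \<in> D \<Longrightarrow> (\<lambda>n. coercive_shift (G (s n)) (G v)) \<longlonglongrightarrow> coercive_shift U (G v)"
    and x: "L2 \<Omega> x" and linner_s: "\<And>v. L2 \<Omega> v \<Longrightarrow> (\<lambda>n. linner \<Omega> (s n) v) \<longlonglongrightarrow> linner \<Omega> x v"
  shows "l2norm \<Omega> (j U - x) = 0"
proof -
  have G: "G (s n) \<in> V" and s_L2: "L2 \<Omega> (s n)" for n using G_in[OF s] j_L2[OF G_in[OF s]] by (simp_all add: j_G s)
  define y where "y = x - j U"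
  have y: "L2 \<Omega> y" unfolding y_def by (intro L2_diff x j_L2 U)
  obtain w where w: "w \<in> V" "\<And>W. W \<in> V \<Longrightarrow> coercive_shift W w = linner \<Omega> (j W) y"
    using coercive_shift_solvable(2)[OF y] by blast
  have "(\<lambda>n. coercive_shift (G (s n) - U) w) \<longlonglongrightarrow> 0" by (rule coercive_shift_weak_limit[OF s R U w(1) lim])
  moreover have "coercive_shift (G (s n) - U) w = linner \<Omega> (s n) y - linner \<Omega> (j U) y" for n
    by (simp add: w(2) diff_in G U j_diff j_G s linner.diff_left s_L2 y j_L2)
  moreover have "(\<lambda>n. linner \<Omega> (s n) y - linner \<Omega> (j U) y) \<longlonglongrightarrow> linner \<Omega> x y - linner \<Omega> (j U) y"
    by (intro tendsto_intros linner_s y)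
  ultimately have "linner \<Omega> x y - linner \<Omega> (j U) y = 0"
    by (simp only: LIMSEQ_unique[of "\<lambda>n. linner \<Omega> (s n) y - linner \<Omega> (j U) y" _ 0])
  moreover have "linner \<Omega> y y = linner \<Omega> x y - linner \<Omega> (j U) y"
    using linner.diff_left[OF x j_L2[OF U] y] by (simp add: y_def)
  ultimately have "linner \<Omega> y y = 0" by simp
  then show ?thesis using linner.nrm_minus_commute[OF x j_L2[OF U]] by (simp add: linner_self y_def)
qed

lemma assoc_opD:
  assumes "(x, f) \<in> assoc_op \<Omega> r D"
  shows "\<exists>U\<in>V. l2norm \<Omega> (j U - x) = 0 \<and> (\<forall>W\<in>V. a U W = linner \<Omega> f (j W))"
proof -
  obtain s C where x: "L2 \<Omega> x" and f: "L2 \<Omega> f" and s: "\<And>n. s n \<in> D"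
    and s_tendsto: "(\<lambda>n. l2norm \<Omega> (s n - x)) \<longlonglongrightarrow> 0" and C: "\<And>n. Re (r (s n) (s n)) \<le> C"
    and lim: "\<And>v. v \<in> D \<Longrightarrow> (\<lambda>n. r (s n) v) \<longlonglongrightarrow> linner \<Omega> f v"
    using assms unfolding assoc_op_def fun_diff_def by blast
  have D_L2: "L2 \<Omega> v" if "v \<in> D" for v using j_L2[OF G_in[OF that]] by (simp add: j_G that)
  have linner_s: "(\<lambda>n. linner \<Omega> (s n) v) \<longlonglongrightarrow> linner \<Omega> x v" if "L2 \<Omega> v" for v
    using linner.nrm_lim_left[OF D_L2[OF s] x that] s_tendsto by (simp add: linner.nrm_lim_def)
  define h where "h = f + (\<lambda>z. of_real \<omega> * x z)"
  have h: "L2 \<Omega> h" "\<And>v. L2 \<Omega> v \<Longrightarrow> linner \<Omega> h v = linner \<Omega> f v + of_real \<omega> * linner \<Omega> x v"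
    by (simp_all add: h_def L2_add L2_cmult f x linner.add_left linner.smult_left)
  obtain U where U: "U \<in> V" "\<And>W. W \<in> V \<Longrightarrow> coercive_shift U W = linner \<Omega> h (j W)"
    using coercive_shift_solvable(1)[OF h(1)] by blast
  obtain R where R: "\<And>n. nrm (G (s n)) \<le> R" using nrm_G_bounded[OF s x s_tendsto C] by blast
  have null: "l2norm \<Omega> (j U - x) = 0"
  proof (rule L2_limit_eq_weak_limit[OF s R U(1) _ x linner_s])
    fix v assume v: "v \<in> D"
    have "(\<lambda>n. r (s n) v + of_real \<omega> * linner \<Omega> (s n) v) \<longlonglongrightarrow> linner \<Omega> f v + of_real \<omega> * linner \<Omega> x v"
      by (intro tendsto_intros lim v linner_s D_L2)
    then show "(\<lambda>n. coercive_shift (G (s n)) (G v)) \<longlonglongrightarrow> coercive_shift U (G v)"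
      by (simp add: U(2) G_in v j_G h(2) D_L2) (simp add: coercive_shift_def r_eq s v j_G)
  qed
  have "a U W = linner \<Omega> f (j W)" if W: "W \<in> V" for W
    using U(2)[OF W] linner_eq_if_null(1)[OF j_L2[OF U(1)] x j_L2[OF W] null]
    by (simp add: coercive_shift_def h(2) j_L2 W)
  then show ?thesis using U(1) null by blast
qed

theorem assoc_op_iff:
  "(x, f) \<in> assoc_op \<Omega> r D \<longleftrightarrow> L2 \<Omega> x \<and> L2 \<Omega> f \<and>
     (\<exists>U\<in>V. l2norm \<Omega> (j U - x) = 0 \<and> (\<forall>W\<in>V. a U W = linner \<Omega> f (j W)))"
proof -
  have "L2 \<Omega> x \<and> L2 \<Omega> f" if "(x, f) \<in> assoc_op \<Omega> r D" using that by (simp add: assoc_op_def)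
  then show ?thesis using assoc_opI assoc_opD by blast
qed

end

section \<open>Closed forms and uniqueness of the regular part\<close>

lemma sectorial_vertex_iff: "sectorial_vertex \<Omega> b V \<gamma> \<longleftrightarrow> (\<exists>\<theta>. sectorial_form \<Omega> b V \<gamma> \<theta>)"
  unfolding sectorial_vertex_def sectorial_form_def by blast

locale closed_sectorial_form = sectorial_form \<Omega> b V \<gamma> \<theta>
  for \<Omega> :: "(real^'n) set" and b V \<gamma> \<theta> +
  assumes semi_hilbert_form_ip: "semi_hilbert V form_ip"
begin

sublocale semi_hilbert V form_ip
  by (rule semi_hilbert_form_ip)

sublocale elliptic_form V form_ip "\<lambda>c u x. c * u x" b "1 + tan \<theta> + \<bar>1 - \<gamma>\<bar>" \<Omega> "\<lambda>u. u" 1 "1 - \<gamma>"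
  by unfold_locales (simp_all add: V_L2 l2norm_le_nrm nrm_power2_eq_Re_shifted Re_shifted)

definition operator_domain :: "(real^'n \<Rightarrow> complex) set" where
  "operator_domain = {x \<in> V. \<exists>f. L2 \<Omega> f \<and> (\<forall>v\<in>V. b x v = linner \<Omega> f v)}"

lemma operator_domain_cmult:
  assumes "x \<in> operator_domain"
  shows "(\<lambda>y. c * x y) \<in> operator_domain"
proof -
  obtain f where x: "x \<in> V" and f: "L2 \<Omega> f" "\<forall>v\<in>V. b x v = linner \<Omega> f v"
    using assms by (auto simp: operator_domain_def)
  then have "\<forall>v\<in>V. b (\<lambda>y. c * x y) v = linner \<Omega> (\<lambda>y. c * f y) v"
    by (simp add: smult_left linner.smult_left V_L2)
  then show ?thesis using V_cmult[OF x] L2_cmult[OF f(1)] unfolding operator_domain_def by blast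
qed

lemma complex_subspace_operator_domain: "complex_subspace operator_domain"
  unfolding complex_subspace_def subspace_def scaleR_eq_cmult
proof (intro conjI ballI allI operator_domain_cmult)
  have "L2 \<Omega> 0" using V_0 V_L2 by blast
  then show "0 \<in> operator_domain"
    using V_0 diff_left[OF V_0 V_0] linner.diff_left[of \<Omega> 0 0] by (auto simp: operator_domain_def V_L2 intro!: exI[of _ 0])
next
  fix x y assume "x \<in> operator_domain" "y \<in> operator_domain"
  then obtain f f' where x: "x \<in> V" "L2 \<Omega> f" "\<forall>v\<in>V. b x v = linner \<Omega> f v"
    and y: "y \<in> V" "L2 \<Omega> f'" "\<forall>v\<in>V. b y v = linner \<Omega> f' v"
    unfolding operator_domain_def by blast
  then have "\<forall>v\<in>V. b (x + y) v = linner \<Omega> (f + f') v"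
    by (simp add: add_left linner.add_left V_L2)
  then show "x + y \<in> operator_domain"
    using V_add[OF x(1) y(1)] L2_add[OF x(2) y(2)] unfolding operator_domain_def by blast
qed

lemma operator_domain_dense: "V \<subseteq> nrm_closure operator_domain"
proof (rule coercive_shift.dense_if_annihilator_null[OF complex_subspace_operator_domain])
  show "operator_domain \<subseteq> V" by (auto simp: operator_domain_def)
  fix w assume w: "w \<in> V" and ann: "\<And>y. y \<in> operator_domain \<Longrightarrow> coercive_shift y w = 0"
  note wL = V_L2[OF w]
  obtain x where x: "x \<in> V" "\<And>v. v \<in> V \<Longrightarrow> coercive_shift x v = linner \<Omega> w v"
    using coercive_shift_solvable(1)[OF wL] by blast
  define c where "c = complex_of_real (1 - \<gamma>)"
  define f where "f = w - (\<lambda>y. c * x y)"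
  have "b x v = linner \<Omega> f v" if "v \<in> V" for v
    using x(2)[OF that, unfolded coercive_shift_def, folded c_def] that
    by (simp add: f_def linner.diff_left linner.smult_left wL V_L2 L2_cmult x(1) algebra_simps)
  moreover have "L2 \<Omega> f" unfolding f_def by (intro L2_diff L2_cmult wL V_L2 x)
  ultimately have "x \<in> operator_domain" using x(1) unfolding operator_domain_def by blast
  then have "linner \<Omega> w w = 0" using ann x(2)[OF w] by simp
  then show "nrm w = 0" using nrm_eq_0_if_l2norm_eq_0[OF w] by (simp add: linner_self)
qed

end

lemma closed_form_iff: "closed_form \<Omega> b V \<longleftrightarrow> (\<exists>\<gamma> \<theta>. closed_sectorial_form \<Omega> b V \<gamma> \<theta>)"
proof -
  have "semi_hilbert V (sectorial_form.form_ip \<Omega> b \<gamma>) \<longleftrightarrow>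
      (\<forall>s. (\<forall>n. s n \<in> V) \<and> (\<forall>e>0. \<exists>N. \<forall>m\<ge>N. \<forall>n\<ge>N. form_norm \<Omega> b \<gamma> (\<lambda>x. s m x - s n x) < e)
        \<longrightarrow> (\<exists>u\<in>V. (\<lambda>n. form_norm \<Omega> b \<gamma> (\<lambda>x. s n x - u x)) \<longlonglongrightarrow> 0))"
    if "sectorial_form \<Omega> b V \<gamma> \<theta>" for \<gamma> \<theta>
  proof -
    interpret sectorial_form \<Omega> b V \<gamma> \<theta> by fact
    show ?thesis
      unfolding semi_hilbert_def semi_hilbert_axioms_def nrm_Cauchy_def nrm_lim_def nrm_eq_form_norm fun_diff_def
      using semi_inner_form_ip by blast
  qed
  then show ?thesis
    unfolding closed_form_def sectorial_vertex_iff closed_sectorial_form_def closed_sectorial_form_axioms_def by blast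
qed

lemma sesq_form_subspace:
  assumes "sesq_form \<Omega> b V" "T \<subseteq> V" "0 \<in> T" "\<And>u v. u \<in> T \<Longrightarrow> v \<in> T \<Longrightarrow> u + v \<in> T"
    "\<And>c u. u \<in> T \<Longrightarrow> (\<lambda>x. c * u x) \<in> T"
  shows "sesq_form \<Omega> b T"
proof -
  have "b (\<lambda>x. u x + v x) w = b u w + b v w \<and> b (\<lambda>x. c * u x) w = c * b u w \<and>
      b w (\<lambda>x. u x + v x) = b w u + b w v \<and> b w (\<lambda>x. c * u x) = cnj c * b w u"
    if "u \<in> T" "v \<in> T" "w \<in> T" for u v w c
    using that assms(1,2) unfolding sesq_form_def by (meson subsetD)
  moreover have "L2 \<Omega> u" "l2norm \<Omega> u = 0 \<Longrightarrow> v \<in> T \<Longrightarrow> b u v = 0 \<and> b v u = 0" if "u \<in> T" for u v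
    using that assms(1,2) unfolding sesq_form_def by blast+
  ultimately show ?thesis
    unfolding sesq_form_def using assms(3-5) by (auto simp: zero_fun_def plus_fun_def)
qed

lemma sesq_form_cong:
  assumes b: "sesq_form \<Omega> b D" and eq: "\<And>u v. u \<in> D \<Longrightarrow> v \<in> D \<Longrightarrow> r u v = b u v"
  shows "sesq_form \<Omega> r D"
proof -
  have "(\<lambda>x. u x + v x) \<in> D" "(\<lambda>x. c * u x) \<in> D" if "u \<in> D" "v \<in> D" for u v c
    using b that unfolding sesq_form_def by blast+
  then show ?thesis using b unfolding sesq_form_def by (simp add: eq)
qed

context sectorial_form
begin

lemma sectorial_form_subspace:
  assumes T: "complex_subspace T" "T \<subseteq> V"
  shows "sectorial_form \<Omega> b T \<gamma> \<theta>"
proof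
  have "subspace T" using T(1) by (simp add: complex_subspace_def)
  then show "sesq_form \<Omega> b T"
    using T by (intro sesq_form_subspace[OF sesq T(2)])
      (auto simp: complex_subspace_def subspace_0 subspace_add)
qed (use T(2) \<theta> sector in auto)

lemma sectorial_form_cong:
  assumes "\<And>u v. u \<in> V \<Longrightarrow> v \<in> V \<Longrightarrow> r u v = b u v"
  shows "sectorial_form \<Omega> r V \<gamma> \<theta>"
proof
  show "sesq_form \<Omega> r V" by (rule sesq_form_cong[OF sesq assms])
  show "0 \<le> \<theta>" "\<theta> < pi / 2" by (fact \<theta>)+
  show "r u u - complex_of_real (\<gamma> * (l2norm \<Omega> u)\<^sup>2) \<in> sector \<theta>" if "u \<in> V" for u
    using sector[OF that] by (simp only: assms[OF that that])
qed

end

locale form_closure = closed_sectorial_form \<Omega> b V \<gamma> \<theta>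
  for \<Omega> :: "(real^'n) set" and b V \<gamma> \<theta> +
  fixes D :: "(real^'n \<Rightarrow> complex) set" and r :: "(real^'n \<Rightarrow> complex) \<Rightarrow> (real^'n \<Rightarrow> complex) \<Rightarrow> complex"
  assumes D_subset: "D \<subseteq> V"
    and extends: "\<And>u v. u \<in> D \<Longrightarrow> v \<in> D \<Longrightarrow> r u v = b u v"
    and dense: "V \<subseteq> nrm_closure D"
begin

sublocale elliptic_form_core V form_ip "\<lambda>c u x. c * u x" b "1 + tan \<theta> + \<bar>1 - \<gamma>\<bar>" \<Omega> "\<lambda>u. u" 1 "1 - \<gamma>" D "\<lambda>u. u" r
  by unfold_locales (use D_subset extends dense in auto)

end

lemma closable_form_closure:
  assumes sesq: "sesq_form \<Omega> r D" and "closable \<Omega> r D"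
  obtains b V \<gamma> \<theta> where "form_closure \<Omega> b V \<gamma> \<theta> D r"
proof -
  obtain b Db \<gamma> \<theta> where D_subset: "D \<subseteq> Db" and agree: "\<And>u v. u \<in> D \<Longrightarrow> v \<in> D \<Longrightarrow> b u v = r u v"
    and closed: "closed_sectorial_form \<Omega> b Db \<gamma> \<theta>"
    using assms(2) unfolding closable_def closed_form_iff by blast
  interpret F: closed_sectorial_form \<Omega> b Db \<gamma> \<theta> by (rule closed)
  have D: "F.complex_subspace D"
    using sesq unfolding F.complex_subspace_def subspace_def scaleR_eq_cmult sesq_form_def zero_fun_def plus_fun_def
    by blast
  have closure_subset: "F.nrm_closure D \<subseteq> Db" by (auto simp: F.nrm_closure_def)
  interpret closure: sectorial_form \<Omega> b "F.nrm_closure D" \<gamma> \<theta>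
    by (rule F.sectorial_form_subspace[OF F.complex_subspace_nrm_closure[OF D D_subset] closure_subset])
  have "form_closure \<Omega> b (F.nrm_closure D) \<gamma> \<theta> D r"
  proof (intro form_closure.intro closed_sectorial_form.intro closed_sectorial_form_axioms.intro form_closure_axioms.intro
      closure.sectorial_form_axioms)
    show "semi_hilbert (F.nrm_closure D) F.form_ip"
      using D by (intro F.semi_hilbert_nrm_closure D_subset) (simp add: F.complex_subspace_def)
    show "D \<subseteq> F.nrm_closure D" by (rule F.subset_nrm_closure[OF D_subset])
    show "F.nrm_closure D \<subseteq> closure.nrm_closure D"
      unfolding closure.nrm_closure_def using F.nrm_closureD by blast
  qed (simp add: agree)
  then show thesis by (rule that)
qed

locale form_closures_same_operator =
  F: form_closure \<Omega> b V \<gamma> \<theta> D r + F': form_closure \<Omega> b' V' \<gamma>' \<theta>' D r'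
  for \<Omega> :: "(real^'n) set" and b V \<gamma> \<theta> D r b' V' \<gamma>' \<theta>' r' +
  assumes same_operator: "assoc_op \<Omega> r D = assoc_op \<Omega> r' D"
begin

definition corresponds :: "(real^'n \<Rightarrow> complex) \<Rightarrow> (real^'n \<Rightarrow> complex) \<Rightarrow> bool" where
  "corresponds x x' \<longleftrightarrow> x \<in> V \<and> x' \<in> V' \<and> l2norm \<Omega> (x' - x) = 0 \<and>
     (\<exists>f. L2 \<Omega> f \<and> (\<forall>v\<in>V. b x v = linner \<Omega> f v) \<and> (\<forall>v\<in>V'. b' x' v = linner \<Omega> f v))"

lemma corresponds_L2: "corresponds x x' \<Longrightarrow> L2 \<Omega> x" "corresponds x x' \<Longrightarrow> L2 \<Omega> x'"
  by (auto simp: corresponds_def F.V_L2 F'.V_L2)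

lemma corresponds_exists:
  assumes "x \<in> F.operator_domain"
  shows "\<exists>x'. corresponds x x'"
proof -
  obtain f where x: "x \<in> V" and f: "L2 \<Omega> f" "\<And>v. v \<in> V \<Longrightarrow> b x v = linner \<Omega> f v"
    using assms by (auto simp: F.operator_domain_def)
  have "l2norm \<Omega> (x - x) = 0" by (simp add: l2norm_def)
  then have "(x, f) \<in> assoc_op \<Omega> r' D"
    using F.assoc_opI[OF F.V_L2[OF x] f(1) x] f(2) by (simp flip: same_operator)
  then obtain x' where "x' \<in> V'" "l2norm \<Omega> (x' - x) = 0" "\<forall>v\<in>V'. b' x' v = linner \<Omega> f v"
    using F'.assoc_opD by blast
  then show ?thesis using x f unfolding corresponds_def by blast
qed

lemma corresponds_diff:
  assumes x: "corresponds x x'" and y: "corresponds y y'"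
  shows "corresponds (x - y) (x' - y')"
proof -
  obtain f g where f: "L2 \<Omega> f" "\<And>v. v \<in> V \<Longrightarrow> b x v = linner \<Omega> f v" "\<And>v. v \<in> V' \<Longrightarrow> b' x' v = linner \<Omega> f v"
    and g: "L2 \<Omega> g" "\<And>v. v \<in> V \<Longrightarrow> b y v = linner \<Omega> g v" "\<And>v. v \<in> V' \<Longrightarrow> b' y' v = linner \<Omega> g v"
    and in_V: "x \<in> V" "y \<in> V" "x' \<in> V'" "y' \<in> V'"
    using x y by (auto simp: corresponds_def)
  have "x' - y' - (x - y) = (x' - x) + (y - y')" by simp
  then have "l2norm \<Omega> (x' - y' - (x - y)) \<le> l2norm \<Omega> (x' - x) + l2norm \<Omega> (y - y')"
    using corresponds_L2[OF x] corresponds_L2[OF y] by (simp only:) (intro linner.nrm_triangle L2_diff)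
  also have "\<dots> = 0"
    using x y linner.nrm_minus_commute[OF corresponds_L2[OF y]] by (simp add: corresponds_def)
  finally have "l2norm \<Omega> (x' - y' - (x - y)) = 0" by (simp add: antisym)
  moreover have "\<forall>v\<in>V. b (x - y) v = linner \<Omega> (f - g) v" "\<forall>v\<in>V'. b' (x' - y') v = linner \<Omega> (f - g) v"
    using f g by (simp_all add: F.diff_left F'.diff_left in_V linner.diff_left F.V_L2 F'.V_L2)
  ultimately show ?thesis
    using L2_diff[OF f(1) g(1)] in_V by (auto simp: corresponds_def F.diff_in F'.diff_in)
qed

lemma corresponds_form_eq: "corresponds x x' \<Longrightarrow> v \<in> V \<Longrightarrow> v \<in> V' \<Longrightarrow> b' x' v = b x v"
  by (auto simp: corresponds_def)

lemma corresponds_nrm_le: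
  assumes x: "corresponds x x'"
  shows "F'.nrm x' \<le> (1 + \<bar>\<gamma> - \<gamma>'\<bar>) * F.nrm x"
proof -
  define c where "c = 1 + \<bar>\<gamma> - \<gamma>'\<bar>"
  have c_ge_1: "1 \<le> c" by (simp add: c_def)
  obtain f where f: "L2 \<Omega> f" "\<And>v. v \<in> V \<Longrightarrow> b x v = linner \<Omega> f v" "\<And>v. v \<in> V' \<Longrightarrow> b' x' v = linner \<Omega> f v"
    and in_V: "x \<in> V" "x' \<in> V'" and null: "l2norm \<Omega> (x' - x) = 0"
    using x by (auto simp: corresponds_def)
  note eq = linner_eq_if_null[OF corresponds_L2(2)[OF x] corresponds_L2(1)[OF x] _ null]
  have form_eq: "b' x' x' = b x x" using eq(2)[OF f(1)] by (simp add: f in_V)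
  have "linner \<Omega> x' x' = linner \<Omega> x x"
    using eq(1)[OF corresponds_L2(2)[OF x]] eq(2)[OF corresponds_L2(1)[OF x]] by simp
  then have norm_eq: "(l2norm \<Omega> x')\<^sup>2 = (l2norm \<Omega> x)\<^sup>2" by (simp only: linner_self of_real_eq_iff)
  have "(F'.nrm x')\<^sup>2 = (F.nrm x)\<^sup>2 + (\<gamma> - \<gamma>') * (l2norm \<Omega> x)\<^sup>2"
    unfolding F'.nrm_power2_eq_Re_shifted[OF in_V(2)] F.nrm_power2_eq_Re_shifted[OF in_V(1)] F'.Re_shifted F.Re_shifted
      form_eq norm_eq by (simp add: algebra_simps)
  also have "\<dots> \<le> (F.nrm x)\<^sup>2 + \<bar>\<gamma> - \<gamma>'\<bar> * (F.nrm x)\<^sup>2"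
    by (intro add_left_mono mult_mono power_mono F.l2norm_le_nrm in_V) auto
  also have "\<dots> = c * (F.nrm x)\<^sup>2" by (simp add: c_def algebra_simps)
  also have "\<dots> \<le> c\<^sup>2 * (F.nrm x)\<^sup>2" using c_ge_1 by (intro mult_right_mono) (auto simp: power2_eq_square)
  finally have "(F'.nrm x')\<^sup>2 \<le> (c * F.nrm x)\<^sup>2" by (simp add: power_mult_distrib)
  then show ?thesis
    unfolding c_def[symmetric] by (rule power2_le_imp_le) (use c_ge_1 in_V in simp)
qed

lemma corresponds_nrm_Cauchy:
  assumes x: "\<And>n. corresponds (x n) (x' n)" and Cauchy: "F.nrm_Cauchy x"
  shows "F'.nrm_Cauchy x'"
  unfolding F'.nrm_Cauchy_def
proof (intro allI impI)
  fix e :: real assume e: "e > 0"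
  let ?c = "1 + \<bar>\<gamma> - \<gamma>'\<bar>"
  have c_pos: "?c > 0" by simp
  then obtain N where N: "\<And>m n. m \<ge> N \<Longrightarrow> n \<ge> N \<Longrightarrow> F.nrm (x m - x n) < e / ?c"
    using Cauchy e unfolding F.nrm_Cauchy_def by (metis divide_pos_pos)
  have "F'.nrm (x' m - x' n) < e" if "m \<ge> N" "n \<ge> N" for m n
    using corresponds_nrm_le[OF corresponds_diff[OF x x], of m n] N[OF that] c_pos
    by (simp add: pos_less_divide_eq mult.commute)
  then show "\<exists>N. \<forall>m\<ge>N. \<forall>n\<ge>N. F'.nrm (x' m - x' n) < e" by blast
qed

text \<open>The operator domain is a core of either closure, and the form norms on it are comparable.\<close>

theorem forms_eq:
  assumes u: "u \<in> D" and v: "v \<in> D"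
  shows "r u v = r' u v"
proof -
  have u_in: "u \<in> V" "u \<in> V'" and v_in: "v \<in> V" "v \<in> V'" using u v F.D_subset F'.D_subset by auto
  obtain x where x_dom: "\<And>n::nat. x n \<in> F.operator_domain" and x_lim: "F.nrm_lim x u"
    using F.nrm_closure_sequence[of F.operator_domain u] F.operator_domain_dense u_in(1)
    by (auto simp: F.operator_domain_def)
  obtain x' where x: "\<And>n. corresponds (x n) (x' n)" using corresponds_exists[OF x_dom] by metis
  have in_V: "x n \<in> V" "x' n \<in> V'" for n using x by (auto simp: corresponds_def)
  obtain w where w: "w \<in> V'" "F'.nrm_lim x' w"
    using F'.complete[OF in_V(2) corresponds_nrm_Cauchy[OF x F.nrm_lim_imp_nrm_Cauchy[OF in_V(1) u_in(1) x_lim]]] by blast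
  have all_L2: "L2 \<Omega> w" "L2 \<Omega> u" "L2 \<Omega> (x n)" "L2 \<Omega> (x' n)" for n using F'.V_L2 w(1) u_in(2) corresponds_L2[OF x] by auto
  have "l2norm \<Omega> (w - u) \<le> F'.nrm (x' n - w) + F.nrm (x n - u)" for n
  proof -
    have "l2norm \<Omega> (w - u) \<le> l2norm \<Omega> (w - x' n) + l2norm \<Omega> (x' n - u)"
      by (rule linner.nrm_triangle_diff[OF all_L2(1,4,2)])
    also have "l2norm \<Omega> (x' n - u) \<le> l2norm \<Omega> (x' n - x n) + l2norm \<Omega> (x n - u)"
      by (rule linner.nrm_triangle_diff[OF all_L2(4,3,2)])
    also have "l2norm \<Omega> (x' n - x n) = 0" using x by (simp add: corresponds_def)
    also have "l2norm \<Omega> (w - x' n) = l2norm \<Omega> (x' n - w)" by (rule linner.nrm_minus_commute[OF all_L2(1,4)])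
    finally show ?thesis
      using F'.l2norm_le_nrm[OF F'.diff_in[OF in_V(2) w(1)], of n] F.l2norm_le_nrm[OF F.diff_in[OF in_V(1) u_in(1)], of n]
      by linarith
  qed
  moreover have "(\<lambda>n. F'.nrm (x' n - w) + F.nrm (x n - u)) \<longlonglongrightarrow> 0 + 0"
    using w(2) x_lim unfolding F.nrm_lim_def F'.nrm_lim_def by (rule tendsto_add)
  ultimately have "l2norm \<Omega> (w - u) \<le> 0 + 0" by (intro LIMSEQ_le_const) auto
  then have "b' (w - u) v = 0" by (intro F'.b_null F'.diff_in w u_in v_in) (simp add: antisym)
  then have "b' w v = b' u v" by (simp add: F'.diff_left w u_in v_in)
  moreover have "(\<lambda>n. b' (x' n) v) \<longlonglongrightarrow> b' w v" by (rule F'.nrm_lim_left[OF in_V(2) w(1) v_in(2) w(2)])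
  moreover have "(\<lambda>n. b (x n) v) \<longlonglongrightarrow> b u v" by (rule F.nrm_lim_left[OF in_V(1) u_in(1) v_in(1) x_lim])
  ultimately have "b' u v = b u v" using corresponds_form_eq[OF x v_in] LIMSEQ_unique by simp
  then show ?thesis using F.extends[OF u v] F'.extends[OF u v] by simp
qed

end

theorem closable_form_unique:
  assumes r: "sesq_form \<Omega> r D" "closable \<Omega> r D" and r': "sesq_form \<Omega> r' D" "closable \<Omega> r' D"
    and eq: "assoc_op \<Omega> r D = assoc_op \<Omega> r' D" and u: "u \<in> D" and v: "v \<in> D"
  shows "r u v = r' u v"
proof -
  obtain b V \<gamma> \<theta> where F: "form_closure \<Omega> b V \<gamma> \<theta> D r" by (rule closable_form_closure[OF r])
  obtain b' V' \<gamma>' \<theta>' where F': "form_closure \<Omega> b' V' \<gamma>' \<theta>' D r'" by (rule closable_form_closure[OF r'])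
  interpret form_closures_same_operator \<Omega> b V \<gamma> \<theta> D r b' V' \<gamma>' \<theta>' r'
    by (intro form_closures_same_operator.intro F F' form_closures_same_operator_axioms.intro eq)
  show ?thesis by (rule forms_eq[OF u v])
qed

theorem reg_part_eqI:
  assumes r: "sectorial \<Omega> r D" "closable \<Omega> r D" "assoc_op \<Omega> r D = assoc_op \<Omega> b D"
    and outside: "\<And>u v. \<not> (u \<in> D \<and> v \<in> D) \<Longrightarrow> r u v = 0"
  shows "reg_part \<Omega> b D = r"
  unfolding reg_part_def
proof (rule the_equality)
  show "sectorial \<Omega> r D \<and> closable \<Omega> r D \<and> assoc_op \<Omega> r D = assoc_op \<Omega> b D \<and>
      (\<forall>u v. \<not> (u \<in> D \<and> v \<in> D) \<longrightarrow> r u v = 0)"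
    using assms by blast
  fix r' assume r': "sectorial \<Omega> r' D \<and> closable \<Omega> r' D \<and> assoc_op \<Omega> r' D = assoc_op \<Omega> b D \<and>
      (\<forall>u v. \<not> (u \<in> D \<and> v \<in> D) \<longrightarrow> r' u v = 0)"
  have "sesq_form \<Omega> r' D" "sesq_form \<Omega> r D"
    using r r' by (auto simp: sectorial_def sectorial_vertex_def)
  then have "r' u v = r u v" if "u \<in> D" "v \<in> D" for u v
    using closable_form_unique[of \<Omega> r' D r u v] r r' that by simp
  then show "r' = r" using outside r' by (intro ext) metis
qed

section \<open>The regular part of an elliptic form\<close>

context elliptic_form
begin

definition null_space :: "'a set" where
  "null_space = {U \<in> V. l2norm \<Omega> (j U) = 0}"

definition regular :: "'a \<Rightarrow> bool" where
  "regular U \<longleftrightarrow> U \<in> V \<and> (\<forall>W\<in>null_space. a U W = 0)"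

definition regular_lift :: "(real^'n \<Rightarrow> complex) \<Rightarrow> 'a \<Rightarrow> bool" where
  "regular_lift x U \<longleftrightarrow> regular U \<and> l2norm \<Omega> (j U - x) = 0"

lemma null_space_subset: "null_space \<subseteq> V"
  by (auto simp: null_space_def)

lemma regular_in: "regular U \<Longrightarrow> U \<in> V"
  by (simp add: regular_def)

lemma regular_null_space: "regular U \<Longrightarrow> W \<in> null_space \<Longrightarrow> a U W = 0"
  by (simp add: regular_def)

lemma complex_subspace_null_space: "complex_subspace null_space"
  unfolding complex_subspace_def subspace_def
proof (intro conjI ballI allI)
  have "j 0 = 0" using j_add[OF zero_in zero_in] by simp
  then show "0 \<in> null_space" using linner.nrm_zero zero_in by (simp add: null_space_def)
next
  fix U W assume "U \<in> null_space" "W \<in> null_space"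
  then show "U + W \<in> null_space" by (auto simp: null_space_def add_in j_add j_L2 linner.nrm_add_eq_0)
next
  have smult_null: "smult c U \<in> null_space" if "U \<in> null_space" for c U
    using that by (auto simp: null_space_def smult_in j_smult linner.nrm_smult j_L2)
  fix U assume U: "U \<in> null_space"
  then show "smult c U \<in> null_space" for c by (rule smult_null)
  show "r *\<^sub>R U \<in> null_space" for r
    using smult_null[OF U, of "of_real r"] U null_space_subset by (auto simp: smult_of_real)
qed

lemma semi_hilbert_null_space: "semi_hilbert null_space ip"
proof (rule semi_hilbert_closed_subspace[OF _ null_space_subset])
  show "subspace null_space" using complex_subspace_null_space by (simp add: complex_subspace_def)
  fix s U assume s: "\<And>n. s n \<in> null_space" and U: "U \<in> V" and lim: "nrm_lim s U"
  have s_in_V: "s n \<in> V" for n using s null_space_subset by blast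
  have "(\<lambda>n. l2norm \<Omega> (j U)) \<longlonglongrightarrow> 0"
  proof (rule nrm_lim_subst_le[OF lim l2norm_nonneg])
    show "l2norm \<Omega> (j U) \<le> 1 * nrm (s n - U)" for n
      using linner.nrm_le_diff_add[OF j_L2[OF U] j_L2[OF s_in_V], of n] l2norm_j_diff_le[OF U s_in_V, of n]
        nrm_minus_commute[OF U s_in_V, of n] s[of n] by (simp add: null_space_def)
  qed
  then show "U \<in> null_space" using U by (simp add: null_space_def LIMSEQ_const_iff)
qed

lemma regular_lift_exists:
  assumes U: "U \<in> V"
  shows "\<exists>U'. regular_lift (j U) U' \<and> nrm U' \<le> (1 + K / \<mu>) * nrm U"
proof -
  interpret null_space: coercive_sesquilinear null_space ip smult coercive_shift "K + \<bar>\<omega>\<bar>" \<mu>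
    by (rule coercive_shift.coercive_sesquilinear_closed_subspace[OF
        complex_subspace_null_space null_space_subset semi_hilbert_null_space])
  have shift: "coercive_shift Z W = a Z W" if "Z \<in> null_space" "W \<in> null_space" for Z W
    using that linner.null_left[of \<Omega> "j Z" "j W"] by (simp add: coercive_shift_def null_space_def j_L2)
  have "\<exists>Z\<in>null_space. \<forall>W\<in>null_space. coercive_shift Z W = a U W"
    using null_space_subset U bounded[OF U]
    by (intro null_space.lax_milgram[where L = "K * nrm U"])
      (auto simp: subset_iff add_right smult_right mult.assoc)
  then obtain Z where Z: "Z \<in> null_space" and eq: "\<And>W. W \<in> null_space \<Longrightarrow> a Z W = a U W"
    using shift by auto
  have Z_in_V: "Z \<in> V" using Z null_space_subset by blast
  have "\<mu> * (nrm Z)\<^sup>2 \<le> Re (a Z Z)" using elliptic[OF Z_in_V] Z by (simp add: null_space_def)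
  also have "\<dots> \<le> K * (nrm U * nrm Z)"
    unfolding eq[OF Z] by (rule order_trans[OF complex_Re_le_cmod bounded[OF U Z_in_V]])
  finally have "nrm Z * (\<mu> * nrm Z) \<le> nrm Z * (K * nrm U)" by (simp add: power2_eq_square mult_ac)
  moreover have "\<mu> * nrm Z \<le> K * nrm U" if "nrm Z = 0" using that bound_nonneg U by simp
  ultimately have "\<mu> * nrm Z \<le> K * nrm U"
    using nrm_nonneg[OF Z_in_V] by (cases "nrm Z = 0") (auto simp: mult_le_cancel_left)
  then have "nrm Z \<le> K / \<mu> * nrm U" using \<mu>_pos by (simp add: field_simps)
  then have "nrm (U - Z) \<le> (1 + K / \<mu>) * nrm U"
    using nrm_triangle_diff[OF U zero_in Z_in_V] nrm_minus_commute[OF zero_in Z_in_V] by (simp add: algebra_simps)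
  moreover have "regular_lift (j U) (U - Z)"
    using U Z_in_V Z eq null_space_subset linner.nrm_minus_commute[of \<Omega> "j U - j Z" "j U"]
    by (auto simp: regular_lift_def regular_def diff_in diff_left j_diff j_L2 L2_diff null_space_def)
  ultimately show ?thesis by blast
qed

lemma regular_lift_unique:
  assumes x: "L2 \<Omega> x" and U: "regular_lift x U" and W: "regular_lift x W"
  shows "nrm (U - W) = 0"
proof -
  have in_V: "U \<in> V" "W \<in> V" "U - W \<in> V" using U W by (auto simp: regular_lift_def regular_in diff_in)
  have "l2norm \<Omega> (x - j W) = 0"
    using W x in_V linner.nrm_minus_commute[of \<Omega> x "j W"] by (simp add: regular_lift_def j_L2)
  then have null: "l2norm \<Omega> (j (U - W)) = 0"
    using U x in_V by (auto simp: j_diff regular_lift_def j_L2 intro: linner.nrm_diff_0_trans[of _ _ x])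
  then have "a (U - W) (U - W) = 0"
    using U W in_V by (simp add: diff_left regular_lift_def regular_null_space null_space_def)
  then have "\<mu> * (nrm (U - W))\<^sup>2 \<le> 0" using elliptic[OF in_V(3)] null by simp
  then show ?thesis using \<mu>_pos by (simp add: mult_le_0_iff)
qed

lemma regular_lift_add:
  assumes "regular_lift x U" "regular_lift y W" "L2 \<Omega> x" "L2 \<Omega> y"
  shows "regular_lift (x + y) (U + W)"
proof -
  have in_V: "U \<in> V" "W \<in> V" using assms by (auto simp: regular_lift_def regular_in)
  have "j (U + W) - (x + y) = (j U - x) + (j W - y)" by (simp add: j_add in_V)
  moreover have "l2norm \<Omega> ((j U - x) + (j W - y)) = 0"
    using assms in_V by (intro linner.nrm_add_eq_0) (auto simp: regular_lift_def L2_diff j_L2)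
  moreover have "regular (U + W)"
    using assms in_V null_space_subset by (auto simp: regular_lift_def regular_def add_in add_left subset_iff)
  ultimately show ?thesis by (simp only: regular_lift_def)
qed

lemma regular_lift_smult:
  assumes "regular_lift x U" "L2 \<Omega> x"
  shows "regular_lift (\<lambda>y. c * x y) (smult c U)"
proof -
  have U: "U \<in> V" using assms by (auto simp: regular_lift_def regular_in)
  have "j (smult c U) - (\<lambda>y. c * x y) = (\<lambda>y. c * (j U - x) y)" by (simp add: j_smult U fun_eq_iff algebra_simps)
  moreover have "l2norm \<Omega> (\<lambda>y. c * (j U - x) y) = 0"
    using assms linner.nrm_smult[OF L2_diff[OF j_L2[OF U] assms(2)], of c] by (simp add: regular_lift_def)
  moreover have "regular (smult c U)"
    using assms U null_space_subset by (auto simp: regular_lift_def regular_def smult_in smult_left subset_iff)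
  ultimately show ?thesis by (simp only: regular_lift_def)
qed

lemma regular_lift_diff:
  assumes "regular_lift x U" "regular_lift y W" "L2 \<Omega> x" "L2 \<Omega> y"
  shows "regular_lift (x - y) (U - W)"
proof -
  have W: "W \<in> V" using assms by (auto simp: regular_lift_def regular_in)
  have "U + smult (-1) W = U - W" using smult_of_real[OF W, of "-1"] by simp
  moreover have "x + (\<lambda>z. - 1 * y z) = x - y" by (simp add: fun_eq_iff)
  ultimately show ?thesis
    using regular_lift_add[OF assms(1) regular_lift_smult[OF assms(2,4), of "-1"] assms(3) L2_cmult[OF assms(4), of "-1"]]
    by simp
qed

definition lift :: "(real^'n \<Rightarrow> complex) \<Rightarrow> 'a" where
  "lift x = (SOME U. regular_lift x U)"

definition regular_form :: "(real^'n \<Rightarrow> complex) \<Rightarrow> (real^'n \<Rightarrow> complex) \<Rightarrow> complex" where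
  "regular_form x y = a (lift x) (lift y)"

lemma range_L2: "x \<in> j ` V \<Longrightarrow> L2 \<Omega> x"
  by (auto simp: j_L2)

lemma range_add: "x \<in> j ` V \<Longrightarrow> y \<in> j ` V \<Longrightarrow> x + y \<in> j ` V"
  by (auto simp: add_in simp flip: j_add)

lemma range_cmult: "x \<in> j ` V \<Longrightarrow> (\<lambda>y. c * x y) \<in> j ` V"
  by (auto simp: smult_in simp flip: j_smult)

lemma range_diff: "x \<in> j ` V \<Longrightarrow> y \<in> j ` V \<Longrightarrow> x - y \<in> j ` V"
  by (auto simp: diff_in simp flip: j_diff)

lemma regular_lift_lift:
  assumes "x \<in> j ` V"
  shows "regular_lift x (lift x)"
proof -
  have "\<exists>U. regular_lift x U" using assms regular_lift_exists by blast
  then show ?thesis unfolding lift_def by (rule someI_ex)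
qed

lemma lift_in: "x \<in> j ` V \<Longrightarrow> lift x \<in> V"
  using regular_lift_lift by (simp add: regular_lift_def regular_in)

lemma regular_form_eq:
  assumes x: "x \<in> j ` V" "regular_lift x U" and y: "y \<in> j ` V" and W: "W \<in> V" "l2norm \<Omega> (j W - y) = 0"
  shows "regular_form x y = a U W"
proof -
  note xL = range_L2[OF x(1)] and yL = range_L2[OF y] and lx = lift_in[OF x(1)] and ly = lift_in[OF y]
  have U: "U \<in> V" "regular U" using x(2) by (auto simp: regular_lift_def regular_in)
  have "nrm (lift x - U) = 0" by (rule regular_lift_unique[OF xL regular_lift_lift[OF x(1)] x(2)])
  then have "a (lift x) (lift y) = a U (lift y)"
    using null_left[OF diff_in[OF lx U(1)] ly] by (simp add: diff_left lx ly U)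
  moreover have "l2norm \<Omega> (y - j W) = 0" using W yL linner.nrm_minus_commute[of \<Omega> y "j W"] by (simp add: j_L2)
  then have "l2norm \<Omega> (j (lift y) - j W) = 0"
    using regular_lift_lift[OF y] yL W ly
    by - (rule linner.nrm_diff_0_trans[of _ _ y], auto simp: regular_lift_def j_L2)
  then have "a U (lift y - W) = 0"
    using U(2) W ly by (intro regular_null_space) (auto simp: null_space_def diff_in j_diff)
  then have "a U (lift y) = a U W" by (simp add: diff_right U ly W)
  ultimately show ?thesis by (simp add: regular_form_def)
qed

lemma sesq_form_regular_form: "sesq_form \<Omega> regular_form (j ` V)"
  unfolding sesq_form_def
proof (intro conjI ballI allI impI)
  show "(\<lambda>x. 0) \<in> j ` V" using range_diff[OF imageI[OF zero_in] imageI[OF zero_in]] by (simp add: zero_fun_def)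
next
  fix x y z c assume x: "x \<in> j ` V" and y: "y \<in> j ` V" and z: "z \<in> j ` V"
  note lift_simps = regular_lift_lift[OF x] regular_lift_lift[OF y] regular_lift_lift[OF z] range_L2[OF x] range_L2[OF y]
  note in_V = lift_in[OF x] lift_in[OF y] lift_in[OF z]
  have add: "regular_lift (\<lambda>t. x t + y t) (lift x + lift y)"
    using regular_lift_add[OF lift_simps(1,2,4,5)] by (simp add: plus_fun_def)
  have cmult: "regular_lift (\<lambda>t. c * x t) (smult c (lift x))" by (rule regular_lift_smult[OF lift_simps(1,4)])
  have range: "(\<lambda>t. x t + y t) \<in> j ` V" "(\<lambda>t. c * x t) \<in> j ` V"
    using range_add[OF x y] range_cmult[OF x] by (simp_all add: plus_fun_def)
  have lift_null: "l2norm \<Omega> (j (lift z) - z) = 0" using lift_simps(3) by (simp add: regular_lift_def)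
  show "(\<lambda>t. x t + y t) \<in> j ` V" "(\<lambda>t. c * x t) \<in> j ` V" by fact+
  show "regular_form (\<lambda>t. x t + y t) z = regular_form x z + regular_form y z"
    "regular_form (\<lambda>t. c * x t) z = c * regular_form x z"
    using regular_form_eq[OF range(1) add z in_V(3) lift_null] regular_form_eq[OF range(2) cmult z in_V(3) lift_null]
    by (simp_all add: regular_form_def add_left smult_left in_V)
  show "regular_form z (\<lambda>t. x t + y t) = regular_form z x + regular_form z y"
    "regular_form z (\<lambda>t. c * x t) = cnj c * regular_form z x"
    using regular_form_eq[OF z lift_simps(3) range(1) add_in[OF in_V(1,2)]] add
      regular_form_eq[OF z lift_simps(3) range(2) smult_in[OF in_V(1)], of c] cmult
    by (simp_all add: regular_form_def add_right smult_right in_V regular_lift_def)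
next
  fix x y assume x: "x \<in> j ` V" and y: "y \<in> j ` V" and null: "l2norm \<Omega> x = 0"
  have lift_0: "regular_lift x 0"
    using null linner.nrm_minus_commute[OF range_L2[OF x] linner.zero_in] j_diff[OF zero_in zero_in]
      null_left[OF zero_in] null_space_subset
    by (auto simp: regular_lift_def regular_def zero_in)
  show "regular_form x y = 0" "regular_form y x = 0"
    using regular_form_eq[OF x lift_0 y lift_in[OF y]] regular_lift_lift[OF y]
      regular_form_eq[OF y regular_lift_lift[OF y] x zero_in] lift_0 null_left[OF zero_in lift_in[OF y]]
      null_right[OF lift_in[OF y] zero_in]
    by (simp_all add: regular_lift_def)
qed (auto simp: j_L2)

lemma l2norm_eq_if_regular_lift:
  assumes "L2 \<Omega> x" "regular_lift x U"
  shows "l2norm \<Omega> (j U) = l2norm \<Omega> x"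
proof -
  have U: "L2 \<Omega> (j U)" "l2norm \<Omega> (j U - x) = 0" using assms by (auto simp: regular_lift_def j_L2 regular_in)
  then show ?thesis
    using linner.nrm_le_diff_add[OF U(1) assms(1)] linner.nrm_le_diff_add[OF assms(1) U(1)]
      linner.nrm_minus_commute[OF U(1) assms(1)] by simp
qed

lemma sectorial_form_regular_form: "sectorial_form \<Omega> regular_form (j ` V) (- \<omega>) (arctan (K / \<mu>))"
proof
  show "0 \<le> arctan (K / \<mu>)" using bound_nonneg \<mu>_pos by simp
  show "arctan (K / \<mu>) < pi / 2" by (rule arctan_ubound)
  fix x assume x: "x \<in> j ` V"
  define U where "U = lift x"
  have U: "U \<in> V" "l2norm \<Omega> (j U) = l2norm \<Omega> x"
    using lift_in[OF x] l2norm_eq_if_regular_lift[OF range_L2[OF x] regular_lift_lift[OF x]] by (simp_all add: U_def)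
  have "\<bar>Im (a U U)\<bar> \<le> K / \<mu> * (\<mu> * (nrm U)\<^sup>2)"
    using order_trans[OF abs_Im_le_cmod bounded[OF U(1) U(1)]] \<mu>_pos by (simp add: power2_eq_square)
  also have "\<dots> \<le> K / \<mu> * (Re (a U U) + \<omega> * (l2norm \<Omega> x)\<^sup>2)"
    using bound_nonneg \<mu>_pos elliptic[OF U(1)] by (intro mult_left_mono) (simp_all add: U(2))
  finally have "a U U + of_real (\<omega> * (l2norm \<Omega> x)\<^sup>2) \<in> sector (arctan (K / \<mu>))"
    using order_trans[OF _ elliptic[OF U(1)]] \<mu>_pos by (intro sectorI) (simp_all add: U(2))
  then show "regular_form x x - of_real (- \<omega> * (l2norm \<Omega> x)\<^sup>2) \<in> sector (arctan (K / \<mu>))"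
    by (simp add: regular_form_def U_def)
qed (rule sesq_form_regular_form)

sublocale regular_form: sectorial_form \<Omega> regular_form "j ` V" "- \<omega>" "arctan (K / \<mu>)"
  by (rule sectorial_form_regular_form)

lemma regular_form_nrm_bounds:
  assumes x: "x \<in> j ` V" and U: "regular_lift x U"
  shows "sqrt \<mu> * nrm U \<le> regular_form.nrm x" "regular_form.nrm x \<le> sqrt (K + \<bar>1 + \<omega>\<bar>) * nrm U"
proof -
  have U_in_V: "U \<in> V" "l2norm \<Omega> (j U - x) = 0" using U by (auto simp: regular_lift_def regular_in)
  note l2norm_eq = l2norm_eq_if_regular_lift[OF range_L2[OF x] U]
  have sq: "(regular_form.nrm x)\<^sup>2 = Re (a U U) + (1 + \<omega>) * (l2norm \<Omega> (j U))\<^sup>2"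
    using regular_form.nrm_power2_eq_Re_shifted[OF x]
    by (simp add: regular_form.Re_shifted regular_form_eq[OF x U x U_in_V] l2norm_eq)
  have "\<mu> * (nrm U)\<^sup>2 \<le> (regular_form.nrm x)\<^sup>2"
    using order_trans[OF elliptic[OF U_in_V(1)] le_add_same_cancel1[THEN iffD2, OF zero_le_power2[of "l2norm \<Omega> (j U)"]]]
    unfolding sq by (simp add: algebra_simps)
  then have "(sqrt \<mu> * nrm U)\<^sup>2 \<le> (regular_form.nrm x)\<^sup>2" using \<mu>_pos by (simp add: power_mult_distrib)
  then show "sqrt \<mu> * nrm U \<le> regular_form.nrm x" by (rule power2_le_imp_le) (simp add: x)
  have "(regular_form.nrm x)\<^sup>2 \<le> K * (nrm U)\<^sup>2 + \<bar>1 + \<omega>\<bar> * (nrm U)\<^sup>2"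
    unfolding sq using order_trans[OF complex_Re_le_cmod bounded[OF U_in_V(1) U_in_V(1)]] j_bounded[OF U_in_V(1)]
    by (intro add_mono mult_mono power_mono) (auto simp: power2_eq_square)
  also have "\<dots> = (sqrt (K + \<bar>1 + \<omega>\<bar>) * nrm U)\<^sup>2"
    using bound_nonneg by (simp add: power_mult_distrib algebra_simps)
  finally show "regular_form.nrm x \<le> sqrt (K + \<bar>1 + \<omega>\<bar>) * nrm U"
    by (rule power2_le_imp_le) (use bound_nonneg U_in_V in simp)
qed

lemma semi_hilbert_regular_form: "semi_hilbert (j ` V) regular_form.form_ip"
proof unfold_locales
  fix s :: "nat \<Rightarrow> real^'n \<Rightarrow> complex"
  assume s: "\<And>n. s n \<in> j ` V" and Cauchy: "regular_form.nrm_Cauchy s"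
  have lift_diff: "regular_lift (s m - s n) (lift (s m) - lift (s n))" for m n
    by (intro regular_lift_diff regular_lift_lift range_L2 s)
  have "nrm_Cauchy (\<lambda>n. lift (s n))"
    unfolding nrm_Cauchy_def
  proof (intro allI impI)
    fix e :: real assume "e > 0"
    then have "sqrt \<mu> * e > 0" using \<mu>_pos by simp
    then obtain N where N: "\<And>m n. m \<ge> N \<Longrightarrow> n \<ge> N \<Longrightarrow> regular_form.nrm (s m - s n) < sqrt \<mu> * e"
      using Cauchy unfolding regular_form.nrm_Cauchy_def by blast
    have "nrm (lift (s m) - lift (s n)) < e" if "m \<ge> N" "n \<ge> N" for m n
      using le_less_trans[OF regular_form_nrm_bounds(1)[OF range_diff[OF s s] lift_diff] N[OF that]] \<mu>_pos by simp
    then show "\<exists>N. \<forall>m\<ge>N. \<forall>n\<ge>N. nrm (lift (s m) - lift (s n)) < e" by blast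
  qed
  then obtain U where U: "U \<in> V" "nrm_lim (\<lambda>n. lift (s n)) U" using complete[of "\<lambda>n. lift (s n)"] lift_in[OF s] by blast
  have "a U W = 0" if W: "W \<in> null_space" for W
  proof -
    have "(\<lambda>n. a (lift (s n)) W) \<longlonglongrightarrow> a U W"
      using W null_space_subset by (intro nrm_lim_left U lift_in s) auto
    moreover have "a (lift (s n)) W = 0" for n
      using regular_lift_lift[OF s] W by (simp add: regular_lift_def regular_null_space)
    ultimately show ?thesis by (simp add: LIMSEQ_const_iff)
  qed
  then have "regular_lift (j U) U" using U(1) by (simp add: regular_lift_def regular_def linner.nrm_zero)
  then have lift_U: "regular_lift (s n - j U) (lift (s n) - U)" for n
    using U(1) by (intro regular_lift_diff regular_lift_lift range_L2 s j_L2)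
  have "(\<lambda>n. regular_form.nrm (s n - j U)) \<longlonglongrightarrow> 0"
    using U(1) s by (intro nrm_lim_subst_le[OF U(2) _ regular_form_nrm_bounds(2)[OF _ lift_U]])
      (auto simp: range_diff)
  then show "\<exists>x\<in>j ` V. regular_form.nrm_lim s x" using U(1) unfolding regular_form.nrm_lim_def by blast
qed

lemma closed_sectorial_form_regular_form:
  "closed_sectorial_form \<Omega> regular_form (j ` V) (- \<omega>) (arctan (K / \<mu>))"
  by (intro closed_sectorial_form.intro closed_sectorial_form_axioms.intro
      sectorial_form_regular_form semi_hilbert_regular_form)

end

context elliptic_form_core
begin

lemma core_subset_range: "D \<subseteq> j ` V"
proof
  fix u assume "u \<in> D"
  then show "u \<in> j ` V" using imageI[OF G_in, of u j] by (simp add: j_G)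
qed

lemma core_dense_in_range: "j ` V \<subseteq> regular_form.nrm_closure D"
proof
  fix x assume x: "x \<in> j ` V"
  define U where "U = lift x"
  have U: "U \<in> V" "l2norm \<Omega> (j U - x) = 0"
    using lift_in[OF x] regular_lift_lift[OF x] by (auto simp: U_def regular_lift_def)
  obtain s where s: "\<And>n. s n \<in> D" and lim: "nrm_lim (\<lambda>n. G (s n)) U" by (rule core_sequence[OF U(1)]) blast
  have s_in_range: "s n \<in> j ` V" for n using s core_subset_range by blast
  define c where "c = sqrt (K + \<bar>1 + \<omega>\<bar>) * (1 + K / \<mu>)"
  have bound: "regular_form.nrm (s n - x) \<le> c * nrm (G (s n) - U)" for n
  proof -
    have G_s: "G (s n) \<in> V" "j (G (s n)) = s n" using s by (simp_all add: G_in j_G)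
    obtain U' where U': "regular_lift (j (G (s n) - U)) U'" "nrm U' \<le> (1 + K / \<mu>) * nrm (G (s n) - U)"
      using regular_lift_exists[OF diff_in[OF G_s(1) U(1)]] by blast
    have "regular_form.nrm (s n - j U) \<le> sqrt (K + \<bar>1 + \<omega>\<bar>) * nrm U'"
      using U' by (intro regular_form_nrm_bounds range_diff s_in_range imageI U) (simp add: j_diff G_s U)
    also have "\<dots> \<le> c * nrm (G (s n) - U)"
      unfolding c_def mult.assoc using U'(2) bound_nonneg by (intro mult_left_mono) auto
    finally have "regular_form.nrm (s n - j U) \<le> c * nrm (G (s n) - U)" .
    moreover have "regular_form.nrm (j U - x) = 0"
      using regular_form.nrm_eq_0_if_l2norm_eq_0[OF range_diff[OF imageI[OF U(1)] x] U(2)] .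
    ultimately show ?thesis
      using regular_form.nrm_triangle_diff[OF s_in_range imageI[OF U(1)] x, of n] by simp
  qed
  have "regular_form.nrm_lim s x"
    unfolding regular_form.nrm_lim_def
    by (rule nrm_lim_subst_le[OF lim _ bound]) (simp add: range_diff s_in_range x)
  then show "x \<in> regular_form.nrm_closure D"
    using s core_subset_range regular_form.subset_nrm_closure[of D]
    by (intro regular_form.nrm_closure_limit[OF core_subset_range _ x, of s]) auto
qed

text \<open>The form \<open>a\<close> on \<open>V\<close> and its restriction to the regular lifts define the same operator, because
  \<open>a U W = linner \<Omega> f (j W)\<close> for all \<open>W\<close> forces \<open>U\<close> to be regular.\<close>

lemma assoc_op_regular_form:
  assumes q: "\<And>u v. u \<in> D \<Longrightarrow> v \<in> D \<Longrightarrow> q u v = regular_form u v"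
  shows "assoc_op \<Omega> q D = assoc_op \<Omega> r D"
proof -
  interpret closure: form_closure \<Omega> regular_form "j ` V" "- \<omega>" "arctan (K / \<mu>)" D q
    by (intro form_closure.intro closed_sectorial_form_regular_form form_closure_axioms.intro
        core_subset_range core_dense_in_range q)
  have "(\<exists>y\<in>j ` V. l2norm \<Omega> (y - x) = 0 \<and> (\<forall>z\<in>j ` V. regular_form y z = linner \<Omega> f z)) \<longleftrightarrow>
      (\<exists>U\<in>V. l2norm \<Omega> (j U - x) = 0 \<and> (\<forall>W\<in>V. a U W = linner \<Omega> f (j W)))"
    (is "?lhs \<longleftrightarrow> ?rhs") if x: "L2 \<Omega> x" and f: "L2 \<Omega> f" for x f
  proof
    assume ?lhs
    then obtain y where y: "y \<in> j ` V" "l2norm \<Omega> (y - x) = 0" "\<And>z. z \<in> j ` V \<Longrightarrow> regular_form y z = linner \<Omega> f z"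
      by blast
    have "l2norm \<Omega> (j (lift y) - x) = 0"
      using regular_lift_lift[OF y(1)] lift_in[OF y(1)] y(2) range_L2[OF y(1)] x
      by - (rule linner.nrm_diff_0_trans[of _ _ y], auto simp: regular_lift_def j_L2)
    moreover have "a (lift y) W = linner \<Omega> f (j W)" if "W \<in> V" for W
      using regular_form_eq[OF y(1) regular_lift_lift[OF y(1)] imageI[OF that] that] y(3)[OF imageI[OF that]]
      by (simp add: linner.nrm_zero)
    ultimately show ?rhs using lift_in[OF y(1)] by blast
  next
    assume ?rhs
    then obtain U where U: "U \<in> V" "l2norm \<Omega> (j U - x) = 0" "\<And>W. W \<in> V \<Longrightarrow> a U W = linner \<Omega> f (j W)" by blast
    have "regular_lift (j U) U"
      using U f by (auto simp: regular_lift_def regular_def null_space_def linner.nrm_zero linner.null_right j_L2)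
    then have "regular_form (j U) (j W) = linner \<Omega> f (j W)" if "W \<in> V" for W
      using regular_form_eq[of "j U" U "j W" W] U that by (simp add: linner.nrm_zero)
    then show ?lhs using U by blast
  qed
  then have "(x, f) \<in> assoc_op \<Omega> q D \<longleftrightarrow> (x, f) \<in> assoc_op \<Omega> r D" for x f
    unfolding closure.assoc_op_iff assoc_op_iff by blast
  then show ?thesis by (simp add: set_eq_iff split_paired_all)
qed

theorem reg_part_eq:
  assumes D: "0 \<in> D" "\<And>u v. u \<in> D \<Longrightarrow> v \<in> D \<Longrightarrow> u + v \<in> D" "\<And>c u. u \<in> D \<Longrightarrow> (\<lambda>x. c * u x) \<in> D"
    and u: "u \<in> D" and v: "v \<in> D" and U: "regular_lift u U"
  shows "reg_part \<Omega> r D u v = a U (G v)"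
proof -
  define q where "q u v = (if u \<in> D \<and> v \<in> D then regular_form u v else 0)" for u v
  have q: "q u v = regular_form u v" if "u \<in> D" "v \<in> D" for u v using that by (simp add: q_def)
  have "regular_form.complex_subspace D"
    using D by (auto simp: regular_form.complex_subspace_def subspace_def scaleR_eq_cmult)
  then interpret restricted: sectorial_form \<Omega> regular_form D "- \<omega>" "arctan (K / \<mu>)"
    by (rule regular_form.sectorial_form_subspace[OF _ core_subset_range])
  have "reg_part \<Omega> r D = q"
  proof (rule reg_part_eqI)
    show "sectorial \<Omega> q D"
      unfolding sectorial_def sectorial_vertex_iff using restricted.sectorial_form_cong[OF q] by blast
    show "closable \<Omega> q D"
      unfolding closable_def closed_form_iff
      using core_subset_range q closed_sectorial_form_regular_form by metis
    show "assoc_op \<Omega> q D = assoc_op \<Omega> r D" by (rule assoc_op_regular_form[OF q])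
  qed (auto simp: q_def)
  moreover have "regular_form u v = a U (G v)"
    using core_subset_range u v U by (intro regular_form_eq) (auto simp: G_in j_G linner.nrm_zero)
  ultimately show ?thesis using q[OF u v] by simp
qed

end

section \<open>The compressed resolvent of a Hermitian matrix\<close>

definition compressed_resolvent :: "complex^'n^'n \<Rightarrow> complex^'n^'n \<Rightarrow> complex^'n^'n" where
  "compressed_resolvent Z Q = Q ** matrix_inv (mat 1 + cscale \<i> (Q ** Z ** Q)) ** Q"

lemma one_plus_i_mult_vec: "(mat 1 + cscale \<i> H) *v x = x + \<i> *s (H *v x)"
  by (simp add: matrix_vector_mult_add_rdistrib cscale_mult_vec)

lemma Re_cdot_one_plus_i_hermitian:
  assumes "hermitian H"
  shows "Re (cdot ((mat 1 + cscale \<i> H) *v x) x) = (norm x)\<^sup>2"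
  using hermitian_Im_0[OF assms, of x]
  by (simp add: one_plus_i_mult_vec cdot_add_left cdot_smult_left cdot_self del: of_real_power)

lemma invertible_one_plus_i_hermitian:
  assumes H: "hermitian H"
  shows "invertible (mat 1 + cscale \<i> H)"
proof -
  have "x = y" if "(mat 1 + cscale \<i> H) *v x = (mat 1 + cscale \<i> H) *v y" for x y
  proof -
    have "(mat 1 + cscale \<i> H) *v (x - y) = 0" using that by (simp add: matrix_vector_mult_diff_distrib)
    then have "(norm (x - y))\<^sup>2 = 0" using Re_cdot_one_plus_i_hermitian[OF H, of "x - y"] by simp
    then show ?thesis by simp
  qed
  then have "inj ((*v) (mat 1 + cscale \<i> H))" by (auto simp: inj_def)
  then obtain B where "B ** (mat 1 + cscale \<i> H) = mat 1"
    using matrix_left_invertible_injective by blast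
  then show ?thesis using invertible_left_inverse by blast
qed

lemma cdot_orthogonal_projection:
  assumes "hermitian Q" "Q ** Q = Q"
  shows "cdot (Q *v x) x = of_real ((norm (Q *v x))\<^sup>2)"
  using cdot_hermitian[OF assms(1), of "Q *v x" x] cdot_self[of "Q *v x"]
  by (simp add: matrix_vector_mul_assoc assms(2))

lemma norm_orthogonal_projection_le:
  assumes "hermitian Q" "Q ** Q = Q"
  shows "norm (Q *v x) \<le> norm x"
proof -
  have "(norm (Q *v x))\<^sup>2 = Re (cdot (Q *v x) x)"
    by (simp add: cdot_orthogonal_projection[OF assms] del: of_real_power)
  also have "\<dots> \<le> norm (Q *v x) * norm x" by (simp add: Re_cdot norm_cauchy_schwarz)
  finally show ?thesis by (cases "norm (Q *v x) = 0") (auto simp: power2_eq_square)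
qed

locale compression =
  fixes Z Q :: "complex^'n^'n"
  assumes Z_hermitian: "hermitian Z" and Q_hermitian: "hermitian Q" and Q_idem: "Q ** Q = Q"
begin

abbreviation "W \<equiv> compressed_resolvent Z Q"
abbreviation "P \<equiv> mat 1 - Q"
abbreviation "R \<equiv> matrix_inv (mat 1 + cscale \<i> (Q ** Z ** Q))"

lemma compressed_hermitian: "hermitian (Q ** Z ** Q)"
  using Z_hermitian Q_hermitian by (simp add: hermitian_def adj_mult matrix_mul_assoc)

lemma resolvent_eq: "R *v x + \<i> *s (Q *v (Z *v (Q *v (R *v x)))) = x"
proof -
  have "((mat 1 + cscale \<i> (Q ** Z ** Q)) ** R) *v x = x"
    using matrix_inv_cancel(1)[OF invertible_one_plus_i_hermitian[OF compressed_hermitian]] by simp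
  then show ?thesis by (simp add: one_plus_i_mult_vec flip: matrix_vector_mul_assoc)
qed

lemma P_mult_vec: "P *v x = x - Q *v x"
  by (simp add: matrix_vector_mult_diff_rdistrib)

lemma Q_Q: "Q *v (Q *v x) = Q *v x"
  by (simp add: matrix_vector_mul_assoc Q_idem)

lemma Q_P: "Q *v (P *v x) = 0"
  by (simp add: P_mult_vec matrix_vector_mult_diff_distrib Q_Q)

lemma P_idem: "P ** P = P"
  by (simp add: matrix_eq P_mult_vec matrix_vector_mult_diff_distrib Q_Q flip: matrix_vector_mul_assoc)

lemma P_hermitian: "hermitian P"
  using Q_hermitian by (simp add: hermitian_def adj_diff)

lemma norm_P_le: "norm (P *v x) \<le> norm x"
  by (rule norm_orthogonal_projection_le[OF P_hermitian P_idem])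

lemma W_mult_vec: "W *v x = Q *v (R *v (Q *v x))"
  by (simp add: compressed_resolvent_def flip: matrix_vector_mul_assoc)

lemma Q_W: "Q *v (W *v x) = W *v x"
  by (simp add: W_mult_vec Q_Q)

lemma W_eq: "W *v x + \<i> *s (Q *v (Z *v (W *v x))) = Q *v x"
  using arg_cong[OF resolvent_eq[of "Q *v x"], of "(*v) Q"]
  by (simp add: matrix_vector_right_distrib vector_scalar_commute Q_Q W_mult_vec)

lemma norm_resolvent_le: "norm (R *v (Q *v x)) \<le> norm x"
  and Re_cdot_W: "Re (cdot (W *v x) x) = (norm (R *v (Q *v x)))\<^sup>2"
proof -
  define y where "y = R *v (Q *v x)"
  have resolvent_x: "(mat 1 + cscale \<i> (Q ** Z ** Q)) *v y = Q *v x"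
    using resolvent_eq[of "Q *v x"] by (simp add: one_plus_i_mult_vec y_def flip: matrix_vector_mul_assoc)
  have sq: "(norm y)\<^sup>2 = Re (cdot (Q *v x) y)"
    using Re_cdot_one_plus_i_hermitian[OF compressed_hermitian, of y] resolvent_x by simp
  also have "\<dots> \<le> norm (Q *v x) * norm y" by (simp add: Re_cdot norm_cauchy_schwarz)
  also have "\<dots> \<le> norm x * norm y"
    by (intro mult_right_mono norm_orthogonal_projection_le Q_hermitian Q_idem) simp
  finally show "norm (R *v (Q *v x)) \<le> norm x"
    unfolding y_def[symmetric] by (cases "norm y = 0") (auto simp: power2_eq_square)
  have "cdot (W *v x) x = cdot y (Q *v x)" by (simp add: W_mult_vec y_def cdot_hermitian[OF Q_hermitian])
  then show "Re (cdot (W *v x) x) = (norm (R *v (Q *v x)))\<^sup>2"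
    using sq cnj_cdot[of "Q *v x" y] by (metis y_def cnj.simps(1))
qed

lemma norm_W_le: "norm (W *v x) \<le> norm x"
  using order_trans[OF norm_orthogonal_projection_le[OF Q_hermitian Q_idem] norm_resolvent_le] by (simp add: W_mult_vec)

end

section \<open>Jet forms and their regularization\<close>

definition jet_smult :: "complex \<Rightarrow> complex \<times> (complex^'n) \<Rightarrow> complex \<times> (complex^'n)" where
  "jet_smult a p = (a * fst p, a *s snd p)"

definition jet_form :: "complex^'n^'n \<Rightarrow> complex^'n \<Rightarrow> complex^'n \<Rightarrow> complex
    \<Rightarrow> complex \<times> (complex^'n) \<Rightarrow> complex \<times> (complex^'n) \<Rightarrow> complex" where
  "jet_form N X Y c p q = cdot (N *v snd p) (snd q) + cdot (snd p) X * cnj (fst q)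
     + fst p * cdot Y (snd q) + c * fst p * cnj (fst q)"

lemma norm_jet_smult: "norm (jet_smult a p) = cmod a * norm p"
proof -
  have "norm (jet_smult a p) = sqrt ((cmod a)\<^sup>2 * ((norm (fst p))\<^sup>2 + (norm (snd p))\<^sup>2))"
    by (simp add: jet_smult_def norm_prod_def norm_mult norm_smult_vec power_mult_distrib algebra_simps)
  then show ?thesis by (simp add: real_sqrt_mult norm_prod_def)
qed

lemma jet_form_add:
  "jet_form N X Y c (p + p') q = jet_form N X Y c p q + jet_form N X Y c p' q"
  "jet_form N X Y c p (q + q') = jet_form N X Y c p q + jet_form N X Y c p q'"
  by (simp_all add: jet_form_def cdot_add_left cdot_add_right matrix_vector_right_distrib algebra_simps)

lemma jet_form_smult:
  "jet_form N X Y c (jet_smult a p) q = a * jet_form N X Y c p q"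
  "jet_form N X Y c p (jet_smult a q) = cnj a * jet_form N X Y c p q"
  by (simp_all add: jet_form_def jet_smult_def cdot_smult_left cdot_smult_right vector_scalar_commute algebra_simps)

lemma jet_form_coercive:
  assumes N: "(norm (snd p))\<^sup>2 \<le> Re (cdot (N *v snd p) (snd p))"
    and X: "norm X \<le> \<kappa>" and Y: "norm Y \<le> \<kappa>" and c: "cmod c \<le> \<kappa>"
  shows "(norm p)\<^sup>2 / 2 \<le> Re (jet_form N X Y c p p) + (2 * \<kappa>\<^sup>2 + \<kappa> + 1/2) * (cmod (fst p))\<^sup>2"
proof -
  define s t where "s = norm (snd p)" and "t = cmod (fst p)"
  have nonneg: "0 \<le> s" "0 \<le> t" "0 \<le> \<kappa>" using order_trans[OF norm_ge_zero X] by (simp_all add: s_def t_def)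
  have "cmod (cdot (snd p) X * cnj (fst p)) \<le> (s * \<kappa>) * t"
    using norm_cdot_le[of "snd p" X] mult_left_mono[OF X, of s] nonneg
    by (simp add: norm_mult s_def t_def mult_right_mono order_trans)
  moreover have "cmod (fst p * cdot Y (snd p)) \<le> t * (\<kappa> * s)"
    using norm_cdot_le[of Y "snd p"] mult_right_mono[OF Y, of s] nonneg
    by (simp add: norm_mult s_def t_def mult_left_mono order_trans)
  moreover have "cmod (c * fst p * cnj (fst p)) \<le> \<kappa> * t\<^sup>2"
    using mult_right_mono[OF c, of "t * t"] by (simp add: norm_mult t_def power2_eq_square mult.assoc)
  moreover have "- cmod z \<le> Re z" for z using abs_Re_le_cmod[of z] by simp
  ultimately have terms: "- (\<kappa> * s * t) \<le> Re (cdot (snd p) X * cnj (fst p))"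
    "- (\<kappa> * s * t) \<le> Re (fst p * cdot Y (snd p))" "- (\<kappa> * t\<^sup>2) \<le> Re (c * fst p * cnj (fst p))"
    by (smt (verit) mult.assoc mult.commute)+
  have "0 \<le> (s - 2 * \<kappa> * t)\<^sup>2" by simp
  then have "2 * (\<kappa> * s * t) \<le> s\<^sup>2 / 2 + 2 * \<kappa>\<^sup>2 * t\<^sup>2" by (simp add: power2_eq_square algebra_simps)
  then have "s\<^sup>2 / 2 - (2 * \<kappa>\<^sup>2 + \<kappa>) * t\<^sup>2 \<le> Re (jet_form N X Y c p p)"
    using terms N unfolding jet_form_def s_def[symmetric] by (simp add: algebra_simps)
  moreover have "(norm p)\<^sup>2 = s\<^sup>2 + t\<^sup>2" by (simp add: norm_prod_def s_def t_def)
  ultimately show ?thesis by (simp add: t_def algebra_simps)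
qed

definition regular_matrix :: "complex^'n^'n \<Rightarrow> complex^'n^'n \<Rightarrow> complex^'n^'n" where
  "regular_matrix Z Q = mat 1 + cscale \<i> Z + Z ** compressed_resolvent Z Q ** Z"

definition corrector :: "complex^'n^'n \<Rightarrow> complex^'n^'n \<Rightarrow> complex^'n^'n" where
  "corrector Z Q = mat 1 - cscale \<i> (compressed_resolvent Z Q ** Z)"

definition dual_corrector :: "complex^'n^'n \<Rightarrow> complex^'n^'n \<Rightarrow> complex^'n^'n" where
  "dual_corrector Z Q = mat 1 + cscale \<i> (adj (compressed_resolvent Z Q) ** Z)"

definition project_jet :: "complex^'n^'n \<Rightarrow> complex \<times> (complex^'n) \<Rightarrow> complex \<times> (complex^'n)" where
  "project_jet Q p = (fst p, (mat 1 - Q) *v snd p)"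

text \<open>The regularized jet is the point of the fibre \<open>p + {0} \<times> range Q\<close> at which the jet form with matrix
  \<open>1 + \<i> Z\<close> vanishes in the test directions \<open>{0} \<times> range Q\<close>.\<close>

definition regularize_jet :: "complex^'n^'n \<Rightarrow> complex^'n^'n \<Rightarrow> complex^'n \<Rightarrow> complex \<times> (complex^'n) \<Rightarrow> complex \<times> (complex^'n)" where
  "regularize_jet Z Q Y p =
     (fst p, corrector Z Q *v ((mat 1 - Q) *v snd p) - fst p *s (compressed_resolvent Z Q *v Y))"

context compression
begin

lemma regular_matrix_mult_vec: "regular_matrix Z Q *v x = x + \<i> *s (Z *v x) + Z *v (W *v (Z *v x))"
  by (simp add: regular_matrix_def matrix_vector_mult_add_rdistrib cscale_mult_vec flip: matrix_vector_mul_assoc)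

lemma corrector_mult_vec: "corrector Z Q *v x = x - \<i> *s (W *v (Z *v x))"
  by (simp add: corrector_def matrix_vector_mult_diff_rdistrib cscale_mult_vec flip: matrix_vector_mul_assoc)

lemma dual_corrector_mult_vec: "dual_corrector Z Q *v x = x + \<i> *s (adj W *v (Z *v x))"
  by (simp add: dual_corrector_def matrix_vector_mult_add_rdistrib cscale_mult_vec flip: matrix_vector_mul_assoc)

lemma regular_matrix_accretive: "(norm x)\<^sup>2 \<le> Re (cdot (regular_matrix Z Q *v x) x)"
proof -
  have "regular_matrix Z Q *v x = (mat 1 + cscale \<i> Z) *v x + Z *v (W *v (Z *v x))"
    by (simp add: regular_matrix_mult_vec one_plus_i_mult_vec)
  then show ?thesis
    by (simp add: cdot_add_left cdot_hermitian[OF Z_hermitian, of "W *v (Z *v x)"] Re_cdot_W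
        Re_cdot_one_plus_i_hermitian[OF Z_hermitian])
qed

lemma regularized_coefficients_bounded:
  assumes Z: "norm Z \<le> k"
  shows "norm (regular_matrix Z Q *v x) \<le> (1 + k)\<^sup>2 * norm x"
    and "norm (corrector Z Q *v x) \<le> (1 + k) * norm x" and "norm (dual_corrector Z Q *v x) \<le> (1 + k) * norm x"
proof -
  have k_nonneg: "0 \<le> k" using order_trans[OF norm_ge_zero Z] .
  have norm_Z_le: "norm (Z *v y) \<le> k * norm y" for y
    using order_trans[OF norm_mult_vec_le mult_right_mono[OF Z norm_ge_zero]] .
  have "norm (Z *v (W *v (Z *v x))) \<le> k * (k * norm x)"
    using order_trans[OF norm_Z_le mult_left_mono[OF order_trans[OF norm_W_le norm_Z_le] k_nonneg]] .
  then have "norm (regular_matrix Z Q *v x) \<le> norm x + k * norm x + k * (k * norm x)"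
    unfolding regular_matrix_mult_vec by (intro norm_triangle_le add_mono) (simp_all add: norm_smult_vec norm_Z_le)
  also have "\<dots> \<le> (1 + k)\<^sup>2 * norm x" using k_nonneg by (simp add: power2_eq_square algebra_simps)
  finally show "norm (regular_matrix Z Q *v x) \<le> (1 + k)\<^sup>2 * norm x" .
  show "norm (corrector Z Q *v x) \<le> (1 + k) * norm x"
    using norm_triangle_ineq4[of x "\<i> *s (W *v (Z *v x))"] order_trans[OF norm_W_le norm_Z_le, of x]
    by (simp add: corrector_mult_vec norm_smult_vec distrib_right)
  have "norm (adj W *v y) \<le> norm y" for y using norm_adj_mult_vec_le[of W 1] norm_W_le by simp
  then show "norm (dual_corrector Z Q *v x) \<le> (1 + k) * norm x"
    using norm_triangle_ineq[of x "\<i> *s (adj W *v (Z *v x))"] order_trans[OF _ norm_Z_le, of _ x]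
    by (fastforce simp: dual_corrector_mult_vec norm_smult_vec distrib_right)
qed

lemma norm_regularize_jet_le:
  assumes Z: "norm Z \<le> k" and Y: "norm Y \<le> k"
  shows "norm (regularize_jet Z Q Y p) \<le> 2 * (1 + k) * norm p"
proof -
  have k_nonneg: "0 \<le> k" using order_trans[OF norm_ge_zero Z] .
  have "norm (corrector Z Q *v (P *v snd p)) \<le> (1 + k) * norm p"
    using order_trans[OF norm_P_le norm_fst_snd_le(2), of p] k_nonneg
    by (intro order_trans[OF regularized_coefficients_bounded(2)[OF Z] mult_left_mono]) auto
  moreover have "norm (fst p *s (W *v Y)) \<le> norm p * k"
    unfolding norm_smult_vec by (intro mult_mono norm_fst_snd_le order_trans[OF norm_W_le Y]) auto
  ultimately have "norm (snd (regularize_jet Z Q Y p)) \<le> (1 + k) * norm p + norm p * k"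
    unfolding regularize_jet_def snd_conv by (intro norm_triangle_le_diff add_mono)
  moreover have "norm (regularize_jet Z Q Y p) \<le> norm (fst p) + norm (snd (regularize_jet Z Q Y p))"
    unfolding norm_prod_def using sqrt_sum_squares_le_sum by (simp add: regularize_jet_def)
  ultimately show ?thesis using norm_fst_snd_le(1)[of p] by (simp add: algebra_simps)
qed

lemma regularize_jet_defect: "p - regularize_jet Z Q Y p = (0, Q *v snd (p - regularize_jet Z Q Y p))"
  by (simp add: regularize_jet_def corrector_mult_vec prod_eq_iff P_mult_vec matrix_vector_mult_diff_distrib
      matrix_vector_right_distrib vector_scalar_commute Q_Q Q_W algebra_simps)

lemma jet_form_regularize_jet_Q:
  "jet_form (mat 1 + cscale \<i> Z) X Y c (regularize_jet Z Q Y p) (0, Q *v z) = 0"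
proof -
  define w where "w = P *v snd p"
  define e where "e = \<i> *s (Z *v w) + fst p *s Y"
  define h where "h = w - W *v e"
  have h: "regularize_jet Z Q Y p = (fst p, h)"
    by (simp add: regularize_jet_def corrector_mult_vec w_def[symmetric] h_def e_def matrix_vector_right_distrib
        vector_scalar_commute)
  have "Q *v (h + \<i> *s (Z *v h)) + fst p *s (Q *v Y)
      = (\<i> *s (Q *v (Z *v w)) + fst p *s (Q *v Y)) - (W *v e + \<i> *s (Q *v (Z *v (W *v e))))"
    by (simp add: h_def w_def Q_P Q_W matrix_vector_right_distrib matrix_vector_mult_diff_distrib vector_scalar_commute
        vector_ssub_ldistrib)
  also have "\<dots> = 0"
    unfolding W_eq by (simp add: e_def matrix_vector_right_distrib vector_scalar_commute)
  finally have "cdot (Q *v (h + \<i> *s (Z *v h)) + fst p *s (Q *v Y)) z = 0" by simp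
  then show ?thesis
    by (simp add: jet_form_def h one_plus_i_mult_vec cdot_add_left cdot_smult_left cdot_hermitian[OF Q_hermitian])
qed

text \<open>The component of \<open>q\<close> in the range of \<open>Q\<close> does not contribute, and \<open>W\<close> maps into that range.\<close>

theorem jet_form_regularize_jet:
  "jet_form (mat 1 + cscale \<i> Z) X Y c (regularize_jet Z Q Y p) q
    = jet_form (regular_matrix Z Q) (adj (corrector Z Q) *v X) (adj (dual_corrector Z Q) *v Y)
        (c - cstar X (W *v Y)) (project_jet Q p) (project_jet Q q)"
proof -
  define u w v z where "u = fst p" and "w = P *v snd p" and "v = fst q" and "z = P *v snd q"
  have q: "q = (v, z) + (0, Q *v snd q)" by (simp add: v_def z_def P_mult_vec prod_eq_iff)
  have W_z: "cdot (W *v y) z = 0" for y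
    using cdot_hermitian[OF P_hermitian, of "W *v y" "snd q"] by (simp add: z_def P_mult_vec Q_W)

  have "jet_form (mat 1 + cscale \<i> Z) X Y c (regularize_jet Z Q Y p) q
      = jet_form (mat 1 + cscale \<i> Z) X Y c (u, corrector Z Q *v w - u *s (W *v Y)) (v, z)"
    using jet_form_add(2)[of "mat 1 + cscale \<i> Z" X Y c "regularize_jet Z Q Y p" "(v, z)" "(0, Q *v snd q)", folded q]
    by (simp only: jet_form_regularize_jet_Q add_0_right) (simp add: regularize_jet_def u_def w_def)
  also have "\<dots> = jet_form (regular_matrix Z Q) (adj (corrector Z Q) *v X) (adj (dual_corrector Z Q) *v Y)
      (c - cstar X (W *v Y)) (u, w) (v, z)"
    by (simp add: jet_form_def cstar_eq_cdot cdot_adj[symmetric] cdot_adj[of "adj _"] one_plus_i_mult_vec regular_matrix_mult_vec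
        corrector_mult_vec dual_corrector_mult_vec matrix_vector_right_distrib matrix_vector_mult_diff_distrib
        vector_scalar_commute cdot_add_left cdot_diff_left cdot_add_right cdot_smult_left cdot_smult_right
        cscale_mult_vec cdot_hermitian[OF Z_hermitian] W_z algebra_simps)
  finally show ?thesis by (simp add: project_jet_def u_def w_def v_def z_def)
qed

end

section \<open>Integrated jet forms with bounded coefficients\<close>

lemma complex_semi_inner_jets:
  "complex_semi_inner (Collect (sq_integrable M)) (inner_L2 M) (\<lambda>a U x. jet_smult a (U x))"
proof (intro complex_semi_inner.intro semi_inner_L2 complex_semi_inner_axioms.intro)
  fix a and U :: "'a \<Rightarrow> complex \<times> (complex^'n)" assume U: "U \<in> Collect (sq_integrable M)"
  have "(\<lambda>x. jet_smult a (U x)) \<in> borel_measurable M"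
    unfolding jet_smult_def using U
    by (intro borel_measurable_Pair borel_measurable_times borel_measurable_smult borel_measurable_const
        sq_integrable_measurable sq_integrable_fst_snd) auto
  then show "(\<lambda>x. jet_smult a (U x)) \<in> Collect (sq_integrable M)"
    using U by (simp add: sq_integrable_def norm_jet_smult power_mult_distrib)
  show "semi_inner.nrm (inner_L2 M) (\<lambda>x. jet_smult a (U x)) = cmod a * semi_inner.nrm (inner_L2 M) U"
    by (simp add: nrm_inner_L2 norm_L2_def norm_jet_smult power_mult_distrib real_sqrt_mult)
qed (simp_all add: jet_smult_def fun_eq_iff prod_eq_iff scaleR_fun_def scaleR_eq_smult scaleR_conv_of_real[where 'a=complex]
    vector_add_ldistrib distrib_left)

interpretation jets: complex_semi_inner "Collect (sq_integrable M)" "inner_L2 M" "\<lambda>a U x. jet_smult a (U x)"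
  rewrites "U \<in> Collect (sq_integrable M) \<longleftrightarrow> sq_integrable M U"
    and "semi_inner.nrm (inner_L2 M) = norm_L2 M"
  for M :: "'a measure"
  by (simp_all add: complex_semi_inner_jets nrm_inner_L2)

locale bounded_coefficients =
  fixes M :: "'a measure" and N :: "'a \<Rightarrow> complex^'n^'n" and X Y :: "'a \<Rightarrow> complex^'n" and c :: "'a \<Rightarrow> complex"
    and \<kappa> :: real
  assumes coefficients_measurable: "N \<in> borel_measurable M" "X \<in> borel_measurable M" "Y \<in> borel_measurable M"
      "c \<in> borel_measurable M"
    and N_bounded: "\<And>x \<xi>. x \<in> space M \<Longrightarrow> norm (N x *v \<xi>) \<le> \<kappa> * norm \<xi>"
    and X_bounded: "\<And>x. x \<in> space M \<Longrightarrow> norm (X x) \<le> \<kappa>"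
    and Y_bounded: "\<And>x. x \<in> space M \<Longrightarrow> norm (Y x) \<le> \<kappa>"
    and c_bounded: "AE x in M. cmod (c x) \<le> \<kappa>"
    and \<kappa>_nonneg: "0 \<le> \<kappa>"
    and accretive: "\<And>x \<xi>. x \<in> space M \<Longrightarrow> (norm \<xi>)\<^sup>2 \<le> Re (cdot (N x *v \<xi>) \<xi>)"
begin

definition jet_integral :: "('a \<Rightarrow> complex \<times> (complex^'n)) \<Rightarrow> ('a \<Rightarrow> complex \<times> (complex^'n)) \<Rightarrow> complex" where
  "jet_integral U V = (LINT x|M. jet_form (N x) (X x) (Y x) (c x) (U x) (V x))"

lemma terms_bounded:
  assumes x: "x \<in> space M"
  shows "cmod (cdot (N x *v snd p) (snd q)) \<le> \<kappa> * (norm p * norm q)"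
    and "cmod (cdot (snd p) (X x) * cnj (fst q)) \<le> \<kappa> * (norm p * norm q)"
    and "cmod (fst p * cdot (Y x) (snd q)) \<le> \<kappa> * (norm p * norm q)"
    and "cmod (c x) \<le> \<kappa> \<Longrightarrow> cmod (c x * fst p * cnj (fst q)) \<le> \<kappa> * (norm p * norm q)"
proof -
  note parts = norm_fst_snd_le[of p] norm_fst_snd_le[of q]
  have "cmod (cdot (N x *v snd p) (snd q)) \<le> (\<kappa> * norm p) * norm q"
    by (intro order_trans[OF norm_cdot_le] mult_mono parts order_trans[OF N_bounded[OF x]]) (auto simp: \<kappa>_nonneg)
  then show "cmod (cdot (N x *v snd p) (snd q)) \<le> \<kappa> * (norm p * norm q)" by (simp add: mult.assoc)
  have "cmod (cdot (snd p) (X x) * cnj (fst q)) \<le> (norm p * \<kappa>) * norm q"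
    unfolding norm_mult complex_mod_cnj
    by (intro mult_mono order_trans[OF norm_cdot_le] parts X_bounded x) (auto simp: \<kappa>_nonneg)
  then show "cmod (cdot (snd p) (X x) * cnj (fst q)) \<le> \<kappa> * (norm p * norm q)" by (simp add: mult_ac)
  have "cmod (fst p * cdot (Y x) (snd q)) \<le> norm p * (\<kappa> * norm q)"
    unfolding norm_mult by (intro mult_mono order_trans[OF norm_cdot_le] parts Y_bounded x) (auto simp: \<kappa>_nonneg)
  then show "cmod (fst p * cdot (Y x) (snd q)) \<le> \<kappa> * (norm p * norm q)" by (simp add: mult_ac)
  assume c: "cmod (c x) \<le> \<kappa>"
  then have "cmod (c x * fst p * cnj (fst q)) \<le> (\<kappa> * norm p) * norm q"
    unfolding norm_mult complex_mod_cnj by (intro mult_mono parts) (auto simp: \<kappa>_nonneg)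
  then show "cmod (c x * fst p * cnj (fst q)) \<le> \<kappa> * (norm p * norm q)" by (simp add: mult_ac)
qed

context
  fixes U V :: "'a \<Rightarrow> complex \<times> (complex^'n)"
  assumes U: "sq_integrable M U" and V: "sq_integrable M V"
begin

lemma terms_integrable:
  "integrable M (\<lambda>x. cdot (N x *v snd (U x)) (snd (V x)))"
  "integrable M (\<lambda>x. cdot (snd (U x)) (X x) * cnj (fst (V x)))"
  "integrable M (\<lambda>x. fst (U x) * cdot (Y x) (snd (V x)))"
  "integrable M (\<lambda>x. c x * fst (U x) * cnj (fst (V x)))"
proof -
  note integrableI = integral_norm_le_product(1)[OF U V _ \<kappa>_nonneg]
  note measurable = borel_measurable_times borel_measurable_cdot borel_measurable_mult_vec borel_measurable_cnj
    coefficients_measurable sq_integrable_measurable sq_integrable_fst_snd U V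
  show "integrable M (\<lambda>x. cdot (N x *v snd (U x)) (snd (V x)))"
    "integrable M (\<lambda>x. cdot (snd (U x)) (X x) * cnj (fst (V x)))"
    "integrable M (\<lambda>x. fst (U x) * cdot (Y x) (snd (V x)))"
    by (intro integrableI AE_I2 terms_bounded measurable; assumption)+
  show "integrable M (\<lambda>x. c x * fst (U x) * cnj (fst (V x)))"
  proof (rule integrableI)
    show "AE x in M. cmod (c x * fst (U x) * cnj (fst (V x))) \<le> \<kappa> * (norm (U x) * norm (V x))"
      using AE_space c_bounded by eventually_elim (rule terms_bounded)
  qed (intro measurable)
qed

lemma jet_integral_eq:
  "jet_integral U V = (LINT x|M. cdot (N x *v snd (U x)) (snd (V x))) + (LINT x|M. cdot (snd (U x)) (X x) * cnj (fst (V x)))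
     + (LINT x|M. fst (U x) * cdot (Y x) (snd (V x))) + (LINT x|M. c x * fst (U x) * cnj (fst (V x)))"
  by (simp add: jet_integral_def jet_form_def terms_integrable)

lemma jet_form_integrable: "integrable M (\<lambda>x. jet_form (N x) (X x) (Y x) (c x) (U x) (V x))"
  by (simp add: jet_form_def terms_integrable)

lemma jet_integral_bounded: "cmod (jet_integral U V) \<le> 4 * \<kappa> * (norm_L2 M U * norm_L2 M V)"
  unfolding jet_integral_def
proof (rule integral_norm_le_product(2)[OF U V])
  show "AE x in M. cmod (jet_form (N x) (X x) (Y x) (c x) (U x) (V x)) \<le> 4 * \<kappa> * (norm (U x) * norm (V x))"
    using AE_space c_bounded
  proof eventually_elim
    case (elim x)
    show ?case
      using terms_bounded(1-3)[OF elim(1), of "U x" "V x"] terms_bounded(4)[OF elim, of "U x" "V x"]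
      unfolding jet_form_def
      by (intro order_trans[OF norm_triangle_le[OF add_mono[OF norm_triangle_le[OF add_mono[OF norm_triangle_le[OF add_mono]]]]]])
         (auto simp: algebra_simps)
  qed
qed (use jet_form_integrable \<kappa>_nonneg in auto)

end

lemma bounded_sesquilinear_jet_integral:
  "bounded_sesquilinear (Collect (sq_integrable M)) (inner_L2 M) (\<lambda>a U x. jet_smult a (U x)) jet_integral (4 * \<kappa>)"
  by (intro bounded_sesquilinear.intro complex_semi_inner_jets bounded_sesquilinear_axioms.intro)
    (simp_all add: nrm_inner_L2 jet_integral_bounded \<kappa>_nonneg, simp_all add: jet_integral_def jet_form_add jet_form_smult
      jet_form_integrable)

sublocale jet_integral: bounded_sesquilinear "Collect (sq_integrable M)" "inner_L2 M" "\<lambda>a U x. jet_smult a (U x)"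
    jet_integral "4 * \<kappa>"
  rewrites "U \<in> Collect (sq_integrable M) \<longleftrightarrow> sq_integrable M U"
    and "semi_inner.nrm (inner_L2 M) = norm_L2 M"
  by (simp_all add: bounded_sesquilinear_jet_integral nrm_inner_L2)

lemma jet_integral_elliptic:
  assumes U: "sq_integrable M U"
  shows "1 / 2 * (norm_L2 M U)\<^sup>2
    \<le> Re (jet_integral U U) + (2 * \<kappa>\<^sup>2 + \<kappa> + 1 / 2) * (norm_L2 M (\<lambda>x. fst (U x)))\<^sup>2"
proof -
  let ?\<omega> = "2 * \<kappa>\<^sup>2 + \<kappa> + 1 / 2"
  note int_fst = sq_integrable_integrable[OF sq_integrable_fst_snd(1)[OF U]]
  note int_form = jet_form_integrable[OF U U]
  have "(LINT x|M. (norm (U x))\<^sup>2 / 2)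
      \<le> (LINT x|M. Re (jet_form (N x) (X x) (Y x) (c x) (U x) (U x)) + ?\<omega> * (cmod (fst (U x)))\<^sup>2)"
  proof (rule integral_mono_AE)
    show "AE x in M. (norm (U x))\<^sup>2 / 2 \<le> Re (jet_form (N x) (X x) (Y x) (c x) (U x) (U x)) + ?\<omega> * (cmod (fst (U x)))\<^sup>2"
      using AE_space c_bounded by eventually_elim (rule jet_form_coercive[OF accretive X_bounded Y_bounded])
  qed (use sq_integrable_integrable[OF U] int_fst int_form in auto)
  also have "\<dots> = Re (jet_integral U U) + ?\<omega> * (norm_L2 M (\<lambda>x. fst (U x)))\<^sup>2"
    using int_fst int_form by (simp add: jet_integral_def norm_L2_power2)
  finally show ?thesis by (simp add: norm_L2_power2)
qed

end

lemma elliptic_form_jet_integral: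
  fixes \<Omega> :: "(real^'m) set"
  assumes coefficients: "bounded_coefficients (lebesgue_on \<Omega>) N X Y c \<kappa>"
    and V: "jets.complex_subspace V" "V \<subseteq> Collect (sq_integrable (lebesgue_on \<Omega>))"
    and hilbert: "semi_hilbert V (inner_L2 (lebesgue_on \<Omega>))"
  shows "elliptic_form V (inner_L2 (lebesgue_on \<Omega>)) (\<lambda>a U x. jet_smult a (U x))
    (bounded_coefficients.jet_integral (lebesgue_on \<Omega>) N X Y c) (4 * \<kappa>) \<Omega> (\<lambda>U x. fst (U x))
    (1 / 2) (2 * \<kappa>\<^sup>2 + \<kappa> + 1 / 2)"
proof -
  interpret bounded_coefficients "lebesgue_on \<Omega>" N X Y c \<kappa> by (rule coefficients)
  interpret semi_hilbert V "inner_L2 (lebesgue_on \<Omega>)" by (rule hilbert)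
  interpret bounded_sesquilinear V "inner_L2 (lebesgue_on \<Omega>)" "\<lambda>a U x. jet_smult a (U x)" jet_integral "4 * \<kappa>"
    by (rule jet_integral.bounded_sesquilinear_subspace[OF V])
  have sq: "sq_integrable (lebesgue_on \<Omega>) U" if "U \<in> V" for U using that V(2) by blast
  show ?thesis
  proof
    show "1 / 2 * (nrm U)\<^sup>2 \<le> Re (jet_integral U U) + (2 * \<kappa>\<^sup>2 + \<kappa> + 1 / 2) * (l2norm \<Omega> (\<lambda>x. fst (U x)))\<^sup>2"
      if "U \<in> V" for U
      using jet_integral_elliptic[OF sq[OF that]] by (simp only: nrm_inner_L2 l2norm_eq_norm_L2)
  qed (simp_all add: fun_eq_iff jet_smult_def nrm_inner_L2 L2_eq_sq_integrable l2norm_eq_norm_L2 sq sq_integrable_fst_snd)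
qed

section \<open>Differential forms\<close>

lemma diff_form_eq_jet_integral:
  fixes \<Omega> :: "(real^'n) set"
  assumes coefficients: "bounded_coefficients (lebesgue_on \<Omega>) N X Y c \<kappa>"
    and C: "\<And>x. x \<in> \<Omega> \<Longrightarrow> C x = adj (T x) ** N x ** T x"
    and b: "\<And>x. x \<in> \<Omega> \<Longrightarrow> vconj (b x) = adj (T x) *v X x"
    and d: "\<And>x. x \<in> \<Omega> \<Longrightarrow> d x = adj (T x) *v Y x"
    and u: "sq_integrable (lebesgue_on \<Omega>) (\<lambda>x. (u x, T x *v grad u x))"
    and v: "sq_integrable (lebesgue_on \<Omega>) (\<lambda>x. (v x, T x *v grad v x))"
  shows "diff_form \<Omega> grad C b d c u v = bounded_coefficients.jet_integral (lebesgue_on \<Omega>) N X Y c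
    (\<lambda>x. (u x, T x *v grad u x)) (\<lambda>x. (v x, T x *v grad v x))"
proof -
  interpret bounded_coefficients "lebesgue_on \<Omega>" N X Y c \<kappa> by (rule coefficients)
  have "cdot (C x *v \<xi>) \<eta> = cdot (N x *v (T x *v \<xi>)) (T x *v \<eta>)" if "x \<in> \<Omega>" for x \<xi> \<eta>
    by (simp add: C[OF that] cdot_factored)
  moreover have "(\<Sum>k\<in>UNIV. b x $ k * \<xi> $ k) = cdot (T x *v \<xi>) (X x)" if "x \<in> \<Omega>" for x \<xi>
  proof -
    have "(\<Sum>k\<in>UNIV. b x $ k * \<xi> $ k) = cdot \<xi> (vconj (b x))" by (simp add: cdot_def vconj_def mult.commute)
    then show ?thesis by (simp add: b[OF that] cdot_adj)
  qed
  moreover have "(\<Sum>k\<in>UNIV. d x $ k * t * cnj (\<eta> $ k)) = t * cdot (Y x) (T x *v \<eta>)" if "x \<in> \<Omega>" for x t \<eta>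
  proof -
    have "(\<Sum>k\<in>UNIV. d x $ k * t * cnj (\<eta> $ k)) = t * cdot (d x) \<eta>"
      by (simp add: cdot_def sum_distrib_left mult_ac)
    then show ?thesis by (simp add: d[OF that] cdot_adj_left)
  qed
  ultimately show ?thesis
    unfolding diff_form_def jet_integral_eq[OF u v]
    by (intro arg_cong2[of _ _ _ _ "(+)"] Bochner_Integration.integral_cong) (simp_all add: space_restrict_space)
qed

context bounded_coefficients
begin

lemma factored_sector:
  assumes x: "x \<in> space M"
  shows "cdot ((adj T ** N x ** T) *v \<xi>) \<xi> \<in> sector (arctan \<kappa>)"
  unfolding cdot_factored
proof (rule sectorI)
  define \<eta> where "\<eta> = T *v \<xi>"
  show "0 \<le> Re (cdot (N x *v \<eta>) \<eta>)" using order_trans[OF zero_le_power2 accretive[OF x]] .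
  have "cmod (cdot (N x *v \<eta>) \<eta>) \<le> \<kappa> * norm \<eta> * norm \<eta>"
    by (intro order_trans[OF norm_cdot_le] mult_right_mono N_bounded x) simp
  also have "\<dots> \<le> \<kappa> * Re (cdot (N x *v \<eta>) \<eta>)"
    using mult_left_mono[OF accretive[OF x] \<kappa>_nonneg] by (simp add: power2_eq_square mult.assoc)
  finally show "\<bar>Im (cdot (N x *v \<eta>) \<eta>)\<bar> \<le> \<kappa> * Re (cdot (N x *v \<eta>) \<eta>)"
    using order_trans[OF abs_Im_le_cmod] by blast
qed

lemma norm_factor_le_msqrt:
  assumes x: "x \<in> space M"
  shows "norm (T *v \<xi>) \<le> norm (msqrt (herm_part (adj T ** N x ** T)) *v \<xi>)"
proof (rule power2_le_imp_le)
  have "0 \<le> Re (cdot ((adj T ** N x ** T) *v \<zeta>) \<zeta>)" for \<zeta>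
    unfolding cdot_factored using order_trans[OF zero_le_power2 accretive[OF x]] .
  from msqrt_herm_part(3)[OF this]
  show "(norm (T *v \<xi>))\<^sup>2 \<le> (norm (msqrt (herm_part (adj T ** N x ** T)) *v \<xi>))\<^sup>2"
    using accretive[OF x] by (simp add: cdot_factored)
qed simp

end

lemma diff_setting_factored:
  fixes \<Omega> :: "(real^'n) set"
  assumes setting: "diff_setting \<Omega> D grad C\<^sub>0 b\<^sub>0 d\<^sub>0 c\<^sub>0"
    and coefficients: "bounded_coefficients (lebesgue_on \<Omega>) N X Y c \<kappa>"
    and T: "T \<in> borel_measurable (lebesgue_on \<Omega>)"
    and jets: "\<And>u. u \<in> D \<Longrightarrow> sq_integrable (lebesgue_on \<Omega>) (\<lambda>x. (u x, T x *v grad u x))"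
  shows "diff_setting \<Omega> D grad (\<lambda>x. adj (T x) ** N x ** T x) (\<lambda>x. vconj (adj (T x) *v X x)) (\<lambda>x. adj (T x) *v Y x) c"
    (is "diff_setting \<Omega> D grad ?C ?b ?d c")
proof -
  interpret bounded_coefficients "lebesgue_on \<Omega>" N X Y c \<kappa> by (rule coefficients)
  have x_space: "x \<in> space (lebesgue_on \<Omega>)" if "x \<in> \<Omega>" for x using that by (simp add: space_restrict_space)
  have lower_order: "cmod (cdot (adj (T x) *v \<eta>) \<xi>) \<le> (\<kappa> + 1) * norm (sqrtA ?C x *v \<xi>)"
    if x: "x \<in> \<Omega>" and \<eta>: "norm \<eta> \<le> \<kappa>" for x \<xi> \<eta>
  proof -
    have "cmod (cdot (adj (T x) *v \<eta>) \<xi>) \<le> norm \<eta> * norm (T x *v \<xi>)" by (simp add: cdot_adj_left norm_cdot_le)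
    also have "\<dots> \<le> (\<kappa> + 1) * norm (sqrtA ?C x *v \<xi>)"
      unfolding sqrtA_def using \<eta> \<kappa>_nonneg by (intro mult_mono norm_factor_le_msqrt x_space x) auto
    finally show ?thesis .
  qed
  have "\<exists>\<theta>. 0 \<le> \<theta> \<and> \<theta> < pi / 2 \<and> (\<forall>x\<in>\<Omega>. \<forall>\<xi>. cdot (?C x *v \<xi>) \<xi> \<in> sector \<theta>)"
    using \<kappa>_nonneg by (intro exI[of _ "arctan \<kappa>"] conjI ballI allI arctan_ubound factored_sector x_space) simp
  moreover have "\<exists>K>0. \<forall>x\<in>\<Omega>. \<forall>\<xi>. cmod (cdot (vconj (?b x)) \<xi>) \<le> K * norm (sqrtA ?C x *v \<xi>) \<and>
      cmod (cdot (?d x) \<xi>) \<le> K * norm (sqrtA ?C x *v \<xi>)"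
    using \<kappa>_nonneg lower_order X_bounded Y_bounded x_space
    by (intro exI[of _ "\<kappa> + 1"]) simp
  moreover have "integrable (lebesgue_on \<Omega>) (\<lambda>x. cdot (?C x *v grad u x) (grad u x))" if "u \<in> D" for u
    using terms_integrable(1)[OF jets[OF that] jets[OF that]] by (simp add: cdot_factored)
  moreover have "?C \<in> borel_measurable (lebesgue_on \<Omega>)" "?b \<in> borel_measurable (lebesgue_on \<Omega>)"
    "?d \<in> borel_measurable (lebesgue_on \<Omega>)"
    by (intro borel_measurable_matrix_mult borel_measurable_mult_vec borel_measurable_vconj borel_measurable_adj
        coefficients_measurable T)+
  moreover have "ess_bounded \<Omega> c" using c_bounded by (auto simp: ess_bounded_def)
  ultimately show ?thesis using setting coefficients_measurable(4) unfolding diff_setting_def by blast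
qed

locale differential_form =
  fixes \<Omega> :: "(real^'n) set"
    and D :: "(real^'n \<Rightarrow> complex) set"
    and grad :: "(real^'n \<Rightarrow> complex) \<Rightarrow> real^'n \<Rightarrow> complex^'n"
    and C :: "real^'n \<Rightarrow> complex^'n^'n"
    and b d :: "real^'n \<Rightarrow> complex^'n"
    and c0 :: "real^'n \<Rightarrow> complex"
    and X Y :: "real^'n \<Rightarrow> complex^'n"
    and Z Q :: "real^'n \<Rightarrow> complex^'n^'n"
    and \<kappa> :: real
  assumes setting: "diff_setting \<Omega> D grad C b d c0"
    and X: "X \<in> borel_measurable (lebesgue_on \<Omega>)" "\<And>x. x \<in> \<Omega> \<Longrightarrow> norm (X x) \<le> \<kappa>"
      "\<And>x. x \<in> \<Omega> \<Longrightarrow> sqrtA C x *v X x = vconj (b x)"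
    and Y: "Y \<in> borel_measurable (lebesgue_on \<Omega>)" "\<And>x. x \<in> \<Omega> \<Longrightarrow> norm (Y x) \<le> \<kappa>"
      "\<And>x. x \<in> \<Omega> \<Longrightarrow> sqrtA C x *v Y x = d x"
    and Z: "Z \<in> borel_measurable (lebesgue_on \<Omega>)" "\<And>x. x \<in> \<Omega> \<Longrightarrow> norm (Z x) \<le> \<kappa>"
      "\<And>x. x \<in> \<Omega> \<Longrightarrow> hermitian (Z x)"
      "\<And>x. x \<in> \<Omega> \<Longrightarrow> sqrtA C x ** (mat 1 + cscale \<i> (Z x)) ** sqrtA C x = C x"
    and c0_bounded: "AE x in lebesgue_on \<Omega>. cmod (c0 x) \<le> \<kappa>"
    and \<kappa>_nonneg: "0 \<le> \<kappa>"
    and Q: "Q \<in> borel_measurable (lebesgue_on \<Omega>)" "\<And>x. x \<in> \<Omega> \<Longrightarrow> Q x ** Q x = Q x"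
      "\<And>x. x \<in> \<Omega> \<Longrightarrow> hermitian (Q x)"
    and Q_range: "\<And>w. L2v \<Omega> w \<Longrightarrow> (\<lambda>x. Q x *v w x) \<in> Vs \<Omega> D grad C"
    and Q_orthogonal: "\<And>w z. L2v \<Omega> w \<Longrightarrow> z \<in> Vs \<Omega> D grad C \<Longrightarrow> vinner \<Omega> (\<lambda>x. w x - Q x *v w x) z = 0"
begin

abbreviation "M \<equiv> lebesgue_on \<Omega>"
abbreviation "A \<equiv> sqrtA C"
abbreviation "a \<equiv> diff_form \<Omega> grad C b d c0"

lemma space_M: "space M = \<Omega>"
  by (simp add: space_restrict_space)

lemma open_\<Omega>: "open \<Omega>"
  using setting by (simp add: diff_setting_def)

lemma D_L2: "u \<in> D \<Longrightarrow> L2 \<Omega> u"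
  and D_add: "u \<in> D \<Longrightarrow> v \<in> D \<Longrightarrow> (\<lambda>x. u x + v x) \<in> D"
  and D_cmult: "u \<in> D \<Longrightarrow> (\<lambda>x. r * u x) \<in> D"
  and weak_grad_D: "u \<in> D \<Longrightarrow> weak_grad \<Omega> u (grad u)"
  and test_fn_D: "test_fn \<Omega> \<phi> \<Longrightarrow> \<phi> \<in> D"
  and C_c0_measurable: "C \<in> borel_measurable M" "c0 \<in> borel_measurable M"
  using setting unfolding diff_setting_def by blast+

lemma D_0: "(\<lambda>x. 0) \<in> D"
proof -
  have "iter_partial ks (\<lambda>x. 0) = (\<lambda>x. 0)" for ks :: "'n list"
    by (induction ks) (auto simp: partial_def)
  then show ?thesis by (intro test_fn_D) (simp add: test_fn_def smooth_def tsupp_def)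
qed

lemma C_accretive: "x \<in> \<Omega> \<Longrightarrow> 0 \<le> Re (cdot (C x *v \<xi>) \<xi>)"
  using setting sectorD(1) unfolding diff_setting_def by meson

lemma A_hermitian: "x \<in> \<Omega> \<Longrightarrow> hermitian (A x)"
  and norm_A_power2: "x \<in> \<Omega> \<Longrightarrow> (norm (A x *v \<xi>))\<^sup>2 = Re (cdot (C x *v \<xi>) \<xi>)"
  unfolding sqrtA_def using msqrt_herm_part[OF C_accretive] by blast+

lemma A_measurable: "A \<in> borel_measurable M"
  unfolding sqrtA_def
  by (rule borel_measurable_msqrt[OF borel_measurable_herm_part[OF C_c0_measurable(1)]])
    (use msqrt_herm_part(1)[OF C_accretive] in \<open>simp add: space_M\<close>)

lemma grad_measurable: "u \<in> D \<Longrightarrow> grad u \<in> borel_measurable M"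
  using weak_grad_D by (auto simp: weak_grad_def L1loc_def borel_measurable_vec_iff)

lemma compression: "x \<in> \<Omega> \<Longrightarrow> compression (Z x) (Q x)"
  using Z(3) Q(2,3) by unfold_locales

lemma resolvent_measurable: "(\<lambda>x. compressed_resolvent (Z x) (Q x)) \<in> borel_measurable M"
  unfolding compressed_resolvent_def
  by (intro borel_measurable_matrix_mult borel_measurable_matrix_inv borel_measurable_add borel_measurable_const
      borel_measurable_cscale Q(1) Z(1))
    (use invertible_one_plus_i_hermitian compression.compressed_hermitian[OF compression] space_M in blast)

lemma regularized_coefficients_measurable:
  "(\<lambda>x. regular_matrix (Z x) (Q x)) \<in> borel_measurable M"
  "(\<lambda>x. corrector (Z x) (Q x)) \<in> borel_measurable M"
  "(\<lambda>x. dual_corrector (Z x) (Q x)) \<in> borel_measurable M"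
  unfolding regular_matrix_def corrector_def dual_corrector_def
  by (intro borel_measurable_add borel_measurable_diff borel_measurable_const borel_measurable_cscale
      borel_measurable_matrix_mult borel_measurable_adj resolvent_measurable Z(1))+

sublocale coefficients: bounded_coefficients M "\<lambda>x. mat 1 + cscale \<i> (Z x)" X Y c0 "1 + \<kappa>"
proof
  show "(\<lambda>x. mat 1 + cscale \<i> (Z x)) \<in> borel_measurable M"
    by (intro borel_measurable_add borel_measurable_const borel_measurable_cscale Z(1))
  show "AE x in M. cmod (c0 x) \<le> 1 + \<kappa>" using c0_bounded by eventually_elim simp
  fix x \<xi> assume "x \<in> space M"
  then have x: "x \<in> \<Omega>" by (simp add: space_M)
  have "norm (Z x *v \<xi>) \<le> \<kappa> * norm \<xi>"
    by (rule order_trans[OF norm_mult_vec_le mult_right_mono[OF Z(2)[OF x] norm_ge_zero]])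
  then show "norm ((mat 1 + cscale \<i> (Z x)) *v \<xi>) \<le> (1 + \<kappa>) * norm \<xi>"
    using norm_triangle_ineq[of \<xi> "\<i> *s (Z x *v \<xi>)"]
    by (simp add: one_plus_i_mult_vec norm_smult_vec distrib_right)
  show "norm (X x) \<le> 1 + \<kappa>" "norm (Y x) \<le> 1 + \<kappa>" using X(2)[OF x] Y(2)[OF x] by simp_all
  show "(norm \<xi>)\<^sup>2 \<le> Re (cdot ((mat 1 + cscale \<i> (Z x)) *v \<xi>) \<xi>)"
    by (simp add: Re_cdot_one_plus_i_hermitian Z(3)[OF x])
qed (use X(1) Y(1) C_c0_measurable \<kappa>_nonneg in auto)

definition regular_X :: "real^'n \<Rightarrow> complex^'n" where
  "regular_X x = adj (corrector (Z x) (Q x)) *v X x"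

definition regular_Y :: "real^'n \<Rightarrow> complex^'n" where
  "regular_Y x = adj (dual_corrector (Z x) (Q x)) *v Y x"

definition regular_c0 :: "real^'n \<Rightarrow> complex" where
  "regular_c0 x = c0 x - cstar (X x) (compressed_resolvent (Z x) (Q x) *v Y x)"

sublocale regular_coefficients:
  bounded_coefficients M "\<lambda>x. regular_matrix (Z x) (Q x)" regular_X regular_Y regular_c0 "(1 + \<kappa>)\<^sup>2"
proof
  show "regular_X \<in> borel_measurable M" "regular_Y \<in> borel_measurable M" "regular_c0 \<in> borel_measurable M"
    unfolding regular_X_def[abs_def] regular_Y_def[abs_def] regular_c0_def[abs_def] cstar_eq_cdot
    by (intro borel_measurable_mult_vec borel_measurable_adj borel_measurable_diff borel_measurable_cdot
        regularized_coefficients_measurable resolvent_measurable C_c0_measurable X(1) Y(1))+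
  have power2_bound: "(1 + \<kappa>) * \<kappa> \<le> (1 + \<kappa>)\<^sup>2" using \<kappa>_nonneg by (simp add: power2_eq_square)
  have bounds: "norm (regular_matrix (Z x) (Q x) *v \<xi>) \<le> (1 + \<kappa>)\<^sup>2 * norm \<xi>" "norm (regular_X x) \<le> (1 + \<kappa>)\<^sup>2"
    "norm (regular_Y x) \<le> (1 + \<kappa>)\<^sup>2"
    "cmod (cstar (X x) (compressed_resolvent (Z x) (Q x) *v Y x)) \<le> \<kappa> * \<kappa>" if x: "x \<in> \<Omega>" for x \<xi>
  proof -
    interpret compression "Z x" "Q x" by (rule compression[OF x])
    note bounded = regularized_coefficients_bounded[OF Z(2)[OF x]]
    show "norm (regular_matrix (Z x) (Q x) *v \<xi>) \<le> (1 + \<kappa>)\<^sup>2 * norm \<xi>" by (rule bounded)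
    show "norm (regular_X x) \<le> (1 + \<kappa>)\<^sup>2" "norm (regular_Y x) \<le> (1 + \<kappa>)\<^sup>2"
      unfolding regular_X_def regular_Y_def using X(2)[OF x] Y(2)[OF x] \<kappa>_nonneg
      by (auto intro!: order_trans[OF norm_adj_mult_vec_le order_trans[OF mult_left_mono power2_bound]] bounded)
    show "cmod (cstar (X x) (W *v Y x)) \<le> \<kappa> * \<kappa>"
      unfolding cstar_eq_cdot using X(2)[OF x] Y(2)[OF x] \<kappa>_nonneg
      by (intro order_trans[OF norm_cdot_le] mult_mono order_trans[OF norm_W_le]) auto
  qed
  show "AE x in M. cmod (regular_c0 x) \<le> (1 + \<kappa>)\<^sup>2"
    using AE_space c0_bounded
  proof eventually_elim
    case (elim x)
    then have "cmod (regular_c0 x) \<le> \<kappa> + \<kappa> * \<kappa>"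
      unfolding regular_c0_def by (intro norm_triangle_le_diff add_mono bounds) (simp_all add: space_M)
    then show ?case using power2_bound by (simp add: distrib_right)
  qed
  fix x \<xi> assume "x \<in> space M"
  then have x: "x \<in> \<Omega>" by (simp add: space_M)
  show "norm (regular_matrix (Z x) (Q x) *v \<xi>) \<le> (1 + \<kappa>)\<^sup>2 * norm \<xi>" "norm (regular_X x) \<le> (1 + \<kappa>)\<^sup>2"
    "norm (regular_Y x) \<le> (1 + \<kappa>)\<^sup>2"
    by (rule bounds[OF x])+
  show "(norm \<xi>)\<^sup>2 \<le> Re (cdot (regular_matrix (Z x) (Q x) *v \<xi>) \<xi>)"
    by (rule compression.regular_matrix_accretive[OF compression[OF x]])
qed (rule regularized_coefficients_measurable, simp)

end

context differential_form
begin

definition jet :: "(real^'n \<Rightarrow> complex) \<Rightarrow> real^'n \<Rightarrow> complex \<times> (complex^'n)" where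
  "jet u x = (u x, A x *v grad u x)"

definition jets_of_D :: "(real^'n \<Rightarrow> complex \<times> (complex^'n)) set" where
  "jets_of_D = {U. sq_integrable M U \<and> (\<exists>u\<in>D. AE x in M. U x = jet u x)}"

definition jet_space :: "(real^'n \<Rightarrow> complex \<times> (complex^'n)) set" where
  "jet_space = L2.nrm_closure M jets_of_D"

lemma sq_integrable_jet:
  assumes u: "u \<in> D"
  shows "sq_integrable M (jet u)"
proof -
  have "integrable M (\<lambda>x. Re (cdot (C x *v grad u x) (grad u x)))"
    using setting u by (intro integrable_Re) (auto simp: diff_setting_def)
  then have "integrable M (\<lambda>x. (norm (A x *v grad u x))\<^sup>2)"
    by (subst Bochner_Integration.integrable_cong[OF refl norm_A_power2]) (auto simp: space_M)
  moreover have "(\<lambda>x. A x *v grad u x) \<in> borel_measurable M"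
    by (intro borel_measurable_mult_vec A_measurable grad_measurable u)
  ultimately have "sq_integrable M (\<lambda>x. A x *v grad u x)" by (simp add: sq_integrable_def)
  then show ?thesis
    unfolding jet_def[abs_def] using D_L2[OF u] by (intro sq_integrable_Pair) (simp_all add: L2_eq_sq_integrable)
qed

lemma jet_add_AE:
  assumes u: "u \<in> D" and v: "v \<in> D"
  shows "AE x in M. jet (\<lambda>x. u x + v x) x = jet u x + jet v x"
proof -
  have "weak_grad \<Omega> (\<lambda>x. u x + 1 * v x) (grad (\<lambda>x. u x + v x))" using weak_grad_D[OF D_add[OF u v]] by simp
  from weak_grad_linear[OF open_\<Omega> D_L2[OF u] D_L2[OF v] weak_grad_D[OF u] weak_grad_D[OF v] this]
  show ?thesis by eventually_elim (simp add: jet_def matrix_vector_right_distrib)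
qed

lemma jet_cmult_AE:
  assumes u: "u \<in> D"
  shows "AE x in M. jet (\<lambda>x. r * u x) x = jet_smult r (jet u x)"
proof -
  have "L2 \<Omega> (\<lambda>x. 0)" "weak_grad \<Omega> (\<lambda>x. 0) (\<lambda>x. 0)" by (simp_all add: L2_def weak_grad_def L1loc_def)
  moreover have "weak_grad \<Omega> (\<lambda>x. 0 + r * u x) (grad (\<lambda>x. r * u x))" using weak_grad_D[OF D_cmult[OF u]] by simp
  ultimately have "AE x in M. grad (\<lambda>x. r * u x) x = 0 + r *s grad u x"
    using weak_grad_linear[OF open_\<Omega> _ D_L2[OF u] _ weak_grad_D[OF u]] by blast
  then show ?thesis by eventually_elim (simp add: jet_def jet_smult_def vector_scalar_commute)
qed

lemma jets_of_D_subset: "jets_of_D \<subseteq> Collect (sq_integrable M)"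
  by (auto simp: jets_of_D_def)

lemma jet_in_jets_of_D: "u \<in> D \<Longrightarrow> jet u \<in> jets_of_D"
  using sq_integrable_jet by (auto simp: jets_of_D_def)

lemma complex_subspace_jets_of_D: "jets.complex_subspace jets_of_D"
  unfolding jets.complex_subspace_def subspace_def
proof (intro conjI ballI allI)
  have "AE x in M. jet (\<lambda>x. 0) x = 0"
    using jet_cmult_AE[OF D_0, of 0] by eventually_elim (simp add: jet_smult_def zero_prod_def)
  then show "0 \<in> jets_of_D" using D_0 by (auto simp: jets_of_D_def elim: eventually_mono)
next
  fix U V assume "U \<in> jets_of_D" "V \<in> jets_of_D"
  then obtain u v where u: "u \<in> D" "AE x in M. U x = jet u x" and v: "v \<in> D" "AE x in M. V x = jet v x"
    and sq: "sq_integrable M U" "sq_integrable M V"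
    by (auto simp: jets_of_D_def)
  have "AE x in M. (U + V) x = jet (\<lambda>x. u x + v x) x"
    using u(2) v(2) jet_add_AE[OF u(1) v(1)] by eventually_elim simp
  then show "U + V \<in> jets_of_D" using sq D_add[OF u(1) v(1)] by (auto simp: jets_of_D_def sq_integrable_add)
next
  have smult: "(\<lambda>x. jet_smult r (U x)) \<in> jets_of_D" if "U \<in> jets_of_D" for r U
  proof -
    from that obtain u where u: "u \<in> D" "AE x in M. U x = jet u x" and U: "sq_integrable M U"
      by (auto simp: jets_of_D_def)
    have "AE x in M. jet_smult r (U x) = jet (\<lambda>x. r * u x) x"
      using u(2) jet_cmult_AE[OF u(1), of r] by eventually_elim simp
    then show ?thesis using jets.smult_in[OF U] D_cmult[OF u(1)] by (auto simp: jets_of_D_def)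
  qed
  fix U assume U: "U \<in> jets_of_D"
  then show "(\<lambda>x. jet_smult r (U x)) \<in> jets_of_D" for r by (rule smult)
  show "r *\<^sub>R U \<in> jets_of_D" for r
    using smult[OF U, of "of_real r"] jets.smult_of_real[of M U] U jets_of_D_subset by auto
qed

lemma jet_space_subset: "jet_space \<subseteq> Collect (sq_integrable M)"
  by (auto simp: jet_space_def L2.nrm_closure_def)

lemma jet_in_jet_space: "u \<in> D \<Longrightarrow> jet u \<in> jet_space"
  unfolding jet_space_def using jet_in_jets_of_D L2.subset_nrm_closure jets_of_D_subset by blast

lemma jet_space_cong_AE:
  assumes U: "U \<in> jet_space" and V: "sq_integrable M V" and eq: "AE x in M. U x = V x"
  shows "V \<in> jet_space"
  unfolding jet_space_def
proof (rule L2.nrm_closureI_approx[OF _ V])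
  have "norm_L2 M (U - V) = 0"
    using eq U V jet_space_subset by (subst norm_L2_eq_0_iff) (auto simp: sq_integrable_diff elim: eventually_mono)
  then show "\<exists>W\<in>L2.nrm_closure M jets_of_D. norm_L2 M (W - V) < e" if "e > 0" for e
    using U that by (intro bexI[of _ U]) (auto simp: jet_space_def)
qed (use jets_of_D_subset in auto)

lemma jets_dense: "jet_space \<subseteq> L2.nrm_closure M (jet ` D)"
proof
  fix U assume U: "U \<in> jet_space"
  have "\<exists>V\<in>jet ` D. norm_L2 M (V - U) < e" if e: "e > 0" for e
  proof -
    obtain V u where V: "norm_L2 M (V - U) < e" "sq_integrable M V" and u: "u \<in> D" "AE x in M. V x = jet u x"
      using L2.nrm_closureD[OF U[unfolded jet_space_def] e] by (auto simp: jets_of_D_def)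
    have "norm_L2 M (jet u - U) = norm_L2 M (V - U)"
      using u(2) U V(2) sq_integrable_jet[OF u(1)] jet_space_subset
      by (intro norm_L2_cong_AE sq_integrable_measurable sq_integrable_diff) (auto elim: eventually_mono)
    then show ?thesis using V(1) u(1) by (intro bexI[of _ "jet u"]) simp_all
  qed
  then show "U \<in> L2.nrm_closure M (jet ` D)" using U jet_space_subset by (auto simp: L2.nrm_closure_def)
qed

lemma diff_form_eq: "u \<in> D \<Longrightarrow> v \<in> D \<Longrightarrow> a u v = coefficients.jet_integral (jet u) (jet v)"
  unfolding jet_def[abs_def]
  using X(3) Y(3) Z(4) A_hermitian sq_integrable_jet[unfolded jet_def[abs_def]]
  by (intro diff_form_eq_jet_integral[OF coefficients.bounded_coefficients_axioms]) (simp_all add: hermitian_def)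

lemma elliptic_form_core_jet:
  "elliptic_form_core jet_space (inner_L2 M) (\<lambda>r U x. jet_smult r (U x)) coefficients.jet_integral (4 * (1 + \<kappa>)) \<Omega>
    (\<lambda>U x. fst (U x)) (1 / 2) (2 * (1 + \<kappa>)\<^sup>2 + (1 + \<kappa>) + 1 / 2) D jet a"
proof (intro elliptic_form_core.intro elliptic_form_jet_integral coefficients.bounded_coefficients_axioms
    elliptic_form_core_axioms.intro)
  show "jets.complex_subspace jet_space"
    unfolding jet_space_def by (rule jets.complex_subspace_nrm_closure[OF complex_subspace_jets_of_D jets_of_D_subset])
  show "semi_hilbert jet_space (inner_L2 M)"
    unfolding jet_space_def using complex_subspace_jets_of_D
    by (intro L2.semi_hilbert_nrm_closure jets_of_D_subset) (simp add: jets.complex_subspace_def)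
  then interpret semi_hilbert jet_space "inner_L2 M" .
  show "jet_space \<subseteq> nrm_closure (jet ` D)"
    using jets_dense by (auto simp: nrm_closure_def L2.nrm_closure_def nrm_inner_L2)
qed (use jet_space_subset jet_in_jet_space diff_form_eq in \<open>auto simp: jet_def\<close>)

sublocale form: elliptic_form_core jet_space "inner_L2 M" "\<lambda>r U x. jet_smult r (U x)" coefficients.jet_integral
    "4 * (1 + \<kappa>)" \<Omega> "\<lambda>U x. fst (U x)" "1 / 2" "2 * (1 + \<kappa>)\<^sup>2 + (1 + \<kappa>) + 1 / 2" D jet a
  rewrites "semi_inner.nrm (inner_L2 M) = norm_L2 M"
  by (rule elliptic_form_core_jet) (simp add: nrm_inner_L2)

lemma Vs_iff:
  assumes w: "sq_integrable M w"
  shows "w \<in> Vs \<Omega> D grad C \<longleftrightarrow> (\<lambda>x. (0, w x)) \<in> jet_space"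
proof
  let ?W = "\<lambda>x. (0, w x)"
  have W: "sq_integrable M ?W" by (rule sq_integrable_Pair(1)[OF sq_integrable_zero(2) w])
  have parts: "sq_integrable M s" "sq_integrable M (\<lambda>x. A x *v grad s x - w x)" if "s \<in> D" for s
    using sq_integrable_fst_snd(1,3)[OF sq_integrable_jet[OF that]] sq_integrable_diff[OF _ w]
    by (auto simp: jet_def fun_diff_def)
  have diff: "jet s - ?W = (\<lambda>x. (s x, A x *v grad s x - w x))" for s by (simp add: fun_eq_iff jet_def)
  {
    assume "w \<in> Vs \<Omega> D grad C"
    then obtain s where s: "\<And>n. s n \<in> D"
      and lim: "(\<lambda>n. norm_L2 M (s n)) \<longlonglongrightarrow> 0" "(\<lambda>n. norm_L2 M (\<lambda>x. A x *v grad (s n) x - w x)) \<longlonglongrightarrow> 0"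
      by (auto simp: Vs_def l2norm_eq_norm_L2)
    have "(\<lambda>n. sqrt ((norm_L2 M (s n))\<^sup>2 + (norm_L2 M (\<lambda>x. A x *v grad (s n) x - w x))\<^sup>2)) \<longlonglongrightarrow> sqrt (0\<^sup>2 + 0\<^sup>2)"
      by (intro tendsto_intros lim)
    then have lim_jet: "L2.nrm_lim M (\<lambda>n. jet (s n)) ?W"
      by (simp add: L2.nrm_lim_def diff sq_integrable_Pair(2)[OF parts[OF s], symmetric])
    show "?W \<in> jet_space"
      unfolding jet_space_def
      by (rule L2.nrm_closure_limit[OF _ jet_in_jet_space[OF s, unfolded jet_space_def] W lim_jet])
        (use jets_of_D_subset in auto)
  }
  assume "?W \<in> jet_space"
  then obtain s where s: "\<And>n. s n \<in> D" and lim: "form.nrm_lim (\<lambda>n. jet (s n)) ?W"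
    using form.core_sequence by metis
  have "norm_L2 M (s n) \<le> norm_L2 M (jet (s n) - ?W)"
    "norm_L2 M (\<lambda>x. A x *v grad (s n) x - w x) \<le> norm_L2 M (jet (s n) - ?W)" for n
    using sq_integrable_fst_snd(2,4)[OF sq_integrable_diff[OF sq_integrable_jet[OF s] W], of n] by (simp_all add: diff)
  then have "(\<lambda>n. norm_L2 M (s n)) \<longlonglongrightarrow> 0" "(\<lambda>n. norm_L2 M (\<lambda>x. A x *v grad (s n) x - w x)) \<longlonglongrightarrow> 0"
    by (intro Lim_null_comparison[OF _ lim[unfolded form.nrm_lim_def]]; simp)+
  then show "w \<in> Vs \<Omega> D grad C"
    using w s by (auto simp: Vs_def L2_eq_sq_integrable l2norm_eq_norm_L2)
qed

lemma Q_in_jet_space: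
  assumes w: "sq_integrable M w"
  shows "(\<lambda>x. (0, Q x *v w x)) \<in> jet_space"
proof -
  have in_Vs: "(\<lambda>x. Q x *v w x) \<in> Vs \<Omega> D grad C" using Q_range w by (simp add: L2_eq_sq_integrable)
  then have "sq_integrable M (\<lambda>x. Q x *v w x)" by (simp add: Vs_def L2_eq_sq_integrable)
  then show ?thesis using Vs_iff in_Vs by blast
qed

lemma null_space_AE:
  assumes W: "W \<in> form.null_space"
  shows "AE x in M. W x = (0, Q x *v snd (W x))"
proof -
  define w where "w x = snd (W x)" for x
  have W_in: "W \<in> jet_space" "sq_integrable M W" using W jet_space_subset by (auto simp: form.null_space_def)
  have w: "sq_integrable M w" unfolding w_def by (rule sq_integrable_fst_snd(3)[OF W_in(2)])
  have fst_0: "AE x in M. fst (W x) = 0"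
    using W norm_L2_eq_0_iff[OF sq_integrable_fst_snd(1)[OF W_in(2)]] by (simp add: form.null_space_def l2norm_eq_norm_L2)
  then have "AE x in M. W x = (0, w x)" by eventually_elim (simp add: w_def prod_eq_iff)
  then have "(\<lambda>x. (0, w x)) \<in> jet_space"
    by (intro jet_space_cong_AE[OF W_in(1)] sq_integrable_Pair sq_integrable_zero w)
  then have "0 = vinner \<Omega> (\<lambda>x. w x - Q x *v w x) w"
    using Vs_iff[OF w] w by (simp add: Q_orthogonal L2_eq_sq_integrable)
  also have "\<dots> = (LINT x|M. of_real ((norm (w x - Q x *v w x))\<^sup>2))"
    unfolding vinner_def
  proof (rule Bochner_Integration.integral_cong)
    fix x assume "x \<in> space M"
    then interpret compression "Z x" "Q x" by (intro compression) (simp add: space_M)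
    show "cdot (w x - Q x *v w x) (w x) = of_real ((norm (w x - Q x *v w x))\<^sup>2)"
      using cdot_orthogonal_projection[OF P_hermitian P_idem, of "w x"] by (simp add: P_mult_vec)
  qed simp
  finally have "complex_of_real (LINT x|M. (norm (w x - Q x *v w x))\<^sup>2) = 0"
    by (simp only: integral_complex_of_real)
  then have "norm_L2 M (\<lambda>x. w x - Q x *v w x) = 0" by (simp add: norm_L2_def)
  moreover have "sq_integrable M (\<lambda>x. Q x *v w x)"
    using sq_integrable_fst_snd(3)[of M "\<lambda>x. (0 :: complex, Q x *v w x)"] Q_in_jet_space[OF w] jet_space_subset by auto
  then have "sq_integrable M (\<lambda>x. w x - Q x *v w x)" using sq_integrable_diff[OF w] by (simp add: fun_diff_def)
  ultimately have "AE x in M. w x - Q x *v w x = 0" using norm_L2_eq_0_iff by blast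
  with fst_0 show ?thesis by eventually_elim (simp add: w_def prod_eq_iff)
qed

definition regular_jet :: "(real^'n \<Rightarrow> complex) \<Rightarrow> real^'n \<Rightarrow> complex \<times> (complex^'n)" where
  "regular_jet u x = regularize_jet (Z x) (Q x) (Y x) (jet u x)"

lemma sq_integrable_regular_jet:
  assumes u: "u \<in> D"
  shows "sq_integrable M (regular_jet u)"
proof (rule sq_integrable_dominated(1)[OF sq_integrable_jet[OF u]])
  show "0 \<le> 2 * (1 + \<kappa>)" using \<kappa>_nonneg by simp
  have "u \<in> borel_measurable M" using D_L2[OF u] by (simp add: L2_def)
  then show "regular_jet u \<in> borel_measurable M"
    unfolding regular_jet_def[abs_def] regularize_jet_def jet_def fst_conv snd_conv
    by (intro borel_measurable_Pair borel_measurable_diff borel_measurable_const borel_measurable_mult_vec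
        borel_measurable_smult regularized_coefficients_measurable resolvent_measurable A_measurable grad_measurable
        Q(1) Y(1) u)
  show "AE x in M. norm (regular_jet u x) \<le> 2 * (1 + \<kappa>) * norm (jet u x)"
    unfolding regular_jet_def
    by (intro AE_I2 compression.norm_regularize_jet_le[OF compression] Z(2) Y(2)) (simp_all add: space_M)
qed

lemma regular_lift_regular_jet:
  assumes u: "u \<in> D"
  shows "form.regular_lift u (regular_jet u)"
proof -
  let ?defect = "jet u - regular_jet u"
  note sq = sq_integrable_jet[OF u] sq_integrable_regular_jet[OF u]
  have "jet u - (\<lambda>x. (0, Q x *v snd (?defect x))) \<in> jet_space"
    using sq_integrable_diff[OF sq] by (intro form.diff_in jet_in_jet_space Q_in_jet_space sq_integrable_fst_snd u)
  moreover have "AE x in M. (jet u - (\<lambda>x. (0, Q x *v snd (?defect x)))) x = regular_jet u x"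
  proof (rule AE_I2)
    fix x assume "x \<in> space M"
    then interpret compression "Z x" "Q x" by (intro compression) (simp add: space_M)
    show "(jet u - (\<lambda>x. (0, Q x *v snd (?defect x)))) x = regular_jet u x"
      using regularize_jet_defect[of "jet u x" "Y x"] by (simp add: regular_jet_def minus_apply diff_eq_eq add.commute)
  qed
  ultimately have in_V: "regular_jet u \<in> jet_space" by (rule jet_space_cong_AE[OF _ sq(2)])
  have "coefficients.jet_integral (regular_jet u) W = 0" if W: "W \<in> form.null_space" for W
    unfolding coefficients.jet_integral_def
  proof (rule integral_eq_zero_AE)
    show "AE x in M. jet_form (mat 1 + cscale \<i> (Z x)) (X x) (Y x) (c0 x) (regular_jet u x) (W x) = 0"
      using AE_space null_space_AE[OF W]
    proof eventually_elim
      case (elim x)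
      then interpret compression "Z x" "Q x" by (intro compression) (simp add: space_M)
      show ?case by (subst elim(2)) (simp add: regular_jet_def jet_form_regularize_jet_Q)
    qed
  qed
  moreover have "(\<lambda>x. fst (regular_jet u x)) - u = (\<lambda>x. 0)" by (simp add: fun_eq_iff regular_jet_def regularize_jet_def jet_def)
  ultimately show ?thesis using in_V by (simp add: form.regular_lift_def form.regular_def l2norm_def)
qed

definition projected_jet :: "(real^'n \<Rightarrow> complex) \<Rightarrow> real^'n \<Rightarrow> complex \<times> (complex^'n)" where
  "projected_jet u x = (u x, (mat 1 - Q x) *v (A x *v grad u x))"

lemma sq_integrable_projected_jet:
  assumes u: "u \<in> D"
  shows "sq_integrable M (projected_jet u)"
proof -
  have w: "sq_integrable M (\<lambda>x. A x *v grad u x)"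
    using sq_integrable_fst_snd(3)[OF sq_integrable_jet[OF u]] by (simp add: jet_def)
  have "sq_integrable M (\<lambda>x. (mat 1 - Q x) *v (A x *v grad u x))"
  proof (rule sq_integrable_dominated(1)[OF w _ zero_le_one])
    show "AE x in M. norm ((mat 1 - Q x) *v (A x *v grad u x)) \<le> 1 * norm (A x *v grad u x)"
      using compression.norm_P_le[OF compression] by (auto simp: space_M)
  qed (intro borel_measurable_mult_vec borel_measurable_diff borel_measurable_const Q(1) A_measurable grad_measurable u)
  then show ?thesis
    unfolding projected_jet_def[abs_def] using D_L2[OF u] by (intro sq_integrable_Pair) (simp_all add: L2_eq_sq_integrable)
qed

theorem reg_part_eq_jet_integral:
  assumes u: "u \<in> D" and v: "v \<in> D"
  shows "reg_part \<Omega> a D u v = regular_coefficients.jet_integral (projected_jet u) (projected_jet v)"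
proof -
  have "reg_part \<Omega> a D u v = coefficients.jet_integral (regular_jet u) (jet v)"
    using D_0 D_add D_cmult
    by (intro form.reg_part_eq regular_lift_regular_jet u v) (auto simp: zero_fun_def plus_fun_def)
  also have "\<dots> = regular_coefficients.jet_integral (projected_jet u) (projected_jet v)"
    unfolding coefficients.jet_integral_def regular_coefficients.jet_integral_def
  proof (rule Bochner_Integration.integral_cong)
    fix x assume "x \<in> space M"
    then interpret compression "Z x" "Q x" by (intro compression) (simp add: space_M)
    show "jet_form (mat 1 + cscale \<i> (Z x)) (X x) (Y x) (c0 x) (regular_jet u x) (jet v x)
        = jet_form (regular_matrix (Z x) (Q x)) (regular_X x) (regular_Y x) (regular_c0 x) (projected_jet u x) (projected_jet v x)"
      by (simp add: regular_jet_def jet_form_regularize_jet regular_X_def regular_Y_def regular_c0_def project_jet_def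
          projected_jet_def jet_def)
  qed simp
  finally show ?thesis .
qed

theorem reg_part_formula:
  assumes u: "u \<in> D" and v: "v \<in> D"
  shows "reg_part \<Omega> a D u v =
    vinner \<Omega> (\<lambda>x. regular_matrix (Z x) (Q x) *v ((mat 1 - Q x) *v (A x *v grad u x)))
      (\<lambda>x. (mat 1 - Q x) *v (A x *v grad v x))
    + linner \<Omega> (\<lambda>x. cstar (X x) (corrector (Z x) (Q x) *v ((mat 1 - Q x) *v (A x *v grad u x)))) v
    + linner \<Omega> u (\<lambda>x. cstar (Y x) (dual_corrector (Z x) (Q x) *v ((mat 1 - Q x) *v (A x *v grad v x))))
    - linner \<Omega> (\<lambda>x. cstar (X x) (compressed_resolvent (Z x) (Q x) *v Y x) * u x) v
    + linner \<Omega> (\<lambda>x. c0 x * u x) v"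
proof -
  have "integrable M (\<lambda>x. c0 x * u x * cnj (v x))" "integrable M (\<lambda>x. regular_c0 x * u x * cnj (v x))"
    using coefficients.terms_integrable(4)[OF sq_integrable_jet[OF u] sq_integrable_jet[OF v]]
      regular_coefficients.terms_integrable(4)[OF sq_integrable_projected_jet[OF u] sq_integrable_projected_jet[OF v]]
    by (simp_all add: jet_def projected_jet_def)
  moreover have "cstar (X x) (compressed_resolvent (Z x) (Q x) *v Y x) * u x * cnj (v x)
      = c0 x * u x * cnj (v x) - regular_c0 x * u x * cnj (v x)" for x
    by (simp add: regular_c0_def algebra_simps)
  ultimately have "(LINT x|M. regular_c0 x * u x * cnj (v x)) = linner \<Omega> (\<lambda>x. c0 x * u x) v
      - linner \<Omega> (\<lambda>x. cstar (X x) (compressed_resolvent (Z x) (Q x) *v Y x) * u x) v"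
    by (simp add: linner_def)
  moreover have "cdot w (regular_X x) = cstar (X x) (corrector (Z x) (Q x) *v w)"
    "cdot (regular_Y x) w = cnj (cstar (Y x) (dual_corrector (Z x) (Q x) *v w))" for x w
    using cdot_adj[of "adj (dual_corrector (Z x) (Q x))"]
    by (simp_all add: regular_X_def regular_Y_def cstar_eq_cdot cdot_adj cnj_cdot)
  ultimately show ?thesis
    by (simp add: reg_part_eq_jet_integral[OF u v] vinner_def linner_def projected_jet_def
        regular_coefficients.jet_integral_eq[OF sq_integrable_projected_jet[OF u] sq_integrable_projected_jet[OF v]])
qed

theorem reg_part_differential_form:
  obtains C' b' d' c0' where "diff_setting \<Omega> D grad C' b' d' c0'"
    and "\<And>u v. u \<in> D \<Longrightarrow> v \<in> D \<Longrightarrow> reg_part \<Omega> a D u v = diff_form \<Omega> grad C' b' d' c0' u v"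
proof -
  let ?T = "\<lambda>x. (mat 1 - Q x) ** A x"
  have projected_jet: "projected_jet u = (\<lambda>x. (u x, ?T x *v grad u x))" for u
    by (simp add: fun_eq_iff projected_jet_def matrix_vector_mul_assoc)
  note coefficients' = regular_coefficients.bounded_coefficients_axioms
  have jets: "sq_integrable M (\<lambda>x. (u x, ?T x *v grad u x))" if "u \<in> D" for u
    using sq_integrable_projected_jet[OF that] by (simp only: projected_jet)
  have "?T \<in> borel_measurable M"
    by (intro borel_measurable_matrix_mult borel_measurable_diff borel_measurable_const Q(1) A_measurable)
  note setting' = diff_setting_factored[OF setting coefficients' this jets]
  note diff_form' = diff_form_eq_jet_integral[where grad = grad and T = ?T, OF coefficients' refl vconj_vconj refl jets jets]
  show thesis
    by (rule that[OF setting']) (simp_all add: reg_part_eq_jet_integral diff_form' projected_jet)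
qed

end

theorem theorem3p2:
  fixes \<Omega> :: "(real^'n) set"
    and D :: "(real^'n \<Rightarrow> complex) set"
    and grad :: "(real^'n \<Rightarrow> complex) \<Rightarrow> real^'n \<Rightarrow> complex^'n"
    and C :: "real^'n \<Rightarrow> complex^'n^'n"
    and b d :: "real^'n \<Rightarrow> complex^'n"
    and c0 :: "real^'n \<Rightarrow> complex"
    and X Y :: "real^'n \<Rightarrow> complex^'n"
    and Z Q :: "real^'n \<Rightarrow> complex^'n^'n"
  assumes setting: "diff_setting \<Omega> D grad C b d c0"
    and LB: "condL \<Omega> D C \<or> condB \<Omega> D C"
    and X: "X \<in> borel_measurable (lebesgue_on \<Omega>)" "bounded (X ` \<Omega>)"
           "\<forall>x\<in>\<Omega>. sqrtA C x *v X x = vconj (b x)"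
    and Y: "Y \<in> borel_measurable (lebesgue_on \<Omega>)" "bounded (Y ` \<Omega>)"
           "\<forall>x\<in>\<Omega>. sqrtA C x *v Y x = d x"
    and Z: "Z \<in> borel_measurable (lebesgue_on \<Omega>)" "bounded (Z ` \<Omega>)"
           "\<forall>x\<in>\<Omega>. hermitian (Z x)"
           "\<forall>x\<in>\<Omega>. sqrtA C x ** (mat 1 + cscale \<i> (Z x)) ** sqrtA C x = C x"
    and Q: "Q \<in> borel_measurable (lebesgue_on \<Omega>)"
           "\<forall>x\<in>\<Omega>. Q x ** Q x = Q x \<and> hermitian (Q x)"
           "\<forall>w. L2v \<Omega> w \<longrightarrow> (\<lambda>x. Q x *v w x) \<in> Vs \<Omega> D grad C \<and>
                (\<forall>z\<in>Vs \<Omega> D grad C. vinner \<Omega> (\<lambda>x. w x - Q x *v w x) z = 0)"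
  shows
    "let a = diff_form \<Omega> grad C b d c0;
         Ah = sqrtA C;
         W = (\<lambda>x. Q x ** matrix_inv (mat 1 + cscale \<i> (Q x ** Z x ** Q x)) ** Q x);
         P = (\<lambda>x. mat 1 - Q x)
     in (\<forall>u\<in>D. \<forall>v\<in>D.
           reg_part \<Omega> a D u v =
             vinner \<Omega> (\<lambda>x. (mat 1 + cscale \<i> (Z x) + Z x ** W x ** Z x) *v (P x *v (Ah x *v grad u x)))
                      (\<lambda>x. P x *v (Ah x *v grad v x))
           + linner \<Omega> (\<lambda>x. cstar (X x) ((mat 1 - cscale \<i> (W x ** Z x)) *v (P x *v (Ah x *v grad u x)))) v
           + linner \<Omega> u (\<lambda>x. cstar (Y x) ((mat 1 + cscale \<i> (adj (W x) ** Z x)) *v (P x *v (Ah x *v grad v x))))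
           - linner \<Omega> (\<lambda>x. cstar (X x) (W x *v Y x) * u x) v
           + linner \<Omega> (\<lambda>x. c0 x * u x) v)
        \<and> (\<exists>C' b' d' c0'. diff_setting \<Omega> D grad C' b' d' c0' \<and>
             (\<forall>u\<in>D. \<forall>v\<in>D. reg_part \<Omega> a D u v = diff_form \<Omega> grad C' b' d' c0' u v))"
proof -
  obtain x where x: "\<forall>t\<in>\<Omega>. norm (X t) \<le> x" using X(2) by (auto simp: bounded_iff)
  obtain y where y: "\<forall>t\<in>\<Omega>. norm (Y t) \<le> y" using Y(2) by (auto simp: bounded_iff)
  obtain z where z: "\<forall>t\<in>\<Omega>. norm (Z t) \<le> z" using Z(2) by (auto simp: bounded_iff)
  obtain c where c0: "AE t in lebesgue_on \<Omega>. cmod (c0 t) \<le> c" using setting by (auto simp: diff_setting_def ess_bounded_def)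
  define \<kappa> where "\<kappa> = Max {x, y, z, c, 0}"
  have \<kappa>_ge: "x \<le> \<kappa>" "y \<le> \<kappa>" "z \<le> \<kappa>" "c \<le> \<kappa>" "0 \<le> \<kappa>" by (simp_all add: \<kappa>_def)
  have c0_le: "AE t in lebesgue_on \<Omega>. cmod (c0 t) \<le> \<kappa>" using c0 by eventually_elim (use \<kappa>_ge in simp)
  have "norm (X t) \<le> \<kappa>" "norm (Y t) \<le> \<kappa>" "norm (Z t) \<le> \<kappa>" if "t \<in> \<Omega>" for t
    using x y z \<kappa>_ge that by (meson order_trans)+
  then interpret differential_form \<Omega> D grad C b d c0 X Y Z Q \<kappa>
    using setting X(1,3) Y(1,3) Z(1,3,4) Q c0_le \<kappa>_ge(5) by unfold_locales simp_all
  obtain C' b' d' c0' where "diff_setting \<Omega> D grad C' b' d' c0'"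
    "\<forall>u\<in>D. \<forall>v\<in>D. reg_part \<Omega> a D u v = diff_form \<Omega> grad C' b' d' c0' u v"
    using reg_part_differential_form by metis
  then show ?thesis
    unfolding Let_def compressed_resolvent_def[symmetric] regular_matrix_def[symmetric] corrector_def[symmetric]
      dual_corrector_def[symmetric] using reg_part_formula by blast
qed

end
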